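(* Assume that the frequency $\lambda$ satisfies one of the following: $L(\lambda)=0$; or $\lambda$ satisfies $(LC)$ and $L(\lambda)<\infty$; or $\lambda$ is $\mathbb{Q}$-linearly independent. Let $1\le p\le\infty$ and let $(D^N)_N\subset\mathcal{H}_p(\lambda)$ be a bounded sequence. Then there are a subsequence $(D^{N_k})_k$ and some $D\in\mathcal{H}_p(\lambda)$ such that for all $\varepsilon>0$ the translations $D^{N_k}_\varepsilon$ converge to $D_\varepsilon$ in $\mathcal{H}_p(\lambda)$ as $k\to\infty$.
   Context: A frequency is a strictly increasing sequence $\lambda=(\lambda_n)_{n\ge1}$ of non-negative real numbers tending to $\infty$. A $\lambda$-Dirichlet series is a formal sum $D=\sum a_n e^{-\lambda_n s}$ with complex coefficients $a_n$; its translation about $z\in\mathbb{C}$ is $D_z=\sum a_ne^{-\lambda_nz}e^{-\lambda_ns}$. $L(\lambda):=\limsup_{n\to\infty}\frac{\log n}{\lambda_n}$. Landau's condition $(LC)$: for every $\delta>0$ there is $C>0$ with $\lambda_{n+1}-\lambda_n\ge Ce^{-e^{\delta\lambda_n}}$ for all $n\in\mathbb{N}$. A Dirichlet group is a pair $(G,\beta)$ of a compact abelian group $G$ and a continuous homomorphism $\beta\colon\mathbb{R}\to G$ with dense range. It is a $\lambda$-Dirichlet group if for every $n$ there is a (necessarily unique) character $h_{\lambda_n}\in\widehat{G}$ with $h_{\lambda_n}(\beta(t))=e^{-i\lambda_n t}$ for all $t\in\mathbb{R}$. $L_p(G)$ is taken with respect to the normalized Haar measure $m$, and $\widehat{f}(\gamma)=\int_G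 f\overline{\gamma}\,dm$. $H_p^\lambda(G)$ is the space of all $f\in L_p(G)$ such that $\widehat f(\gamma)\ne0$ only if $\gamma=h_{\lambda_n}$ for some $n$. $\mathcal{H}_p(\lambda)$ is the Banach space of all $\lambda$-Dirichlet series $D=\sum a_ne^{-\lambda_ns}$ for which there is $f\in H_p^\lambda(G)$ with $\widehat f(h_{\lambda_n})=a_n$ for all $n$, with norm $\|D\|_p=\|f\|_p$; it does not depend on the choice of the $\lambda$-Dirichlet group $(G,\beta)$. *)

theory Defs
  imports "HOL-Probability.Probability"
begin

section \<open>Frequencies\<close>

text \<open>All sequences are indexed from 0: \<open>lam n\<close> stands for $\lambda_{n+1}$, and likewise
  \<open>a n\<close> for the coefficient $a_{n+1}$ of a Dirichlet series.\<close>

definition frequency :: "(nat \<Rightarrow> real) \<Rightarrow> bool" where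
  "frequency lam \<longleftrightarrow>
     strict_mono lam \<and> (\<forall>n. 0 \<le> lam n) \<and> filterlim lam at_top sequentially"

text \<open>The shift of the index turns $\log n / \lambda_n$ into \<open>ln (Suc n) / lam n\<close>.\<close>

definition freq_L :: "(nat \<Rightarrow> real) \<Rightarrow> ereal" where
  "freq_L lam = limsup (\<lambda>n. ereal (ln (real (Suc n)) / lam n))"

definition landau_condition :: "(nat \<Rightarrow> real) \<Rightarrow> bool" where
  "landau_condition lam \<longleftrightarrow>
     (\<forall>\<delta>>0. \<exists>C>0. \<forall>n. lam (Suc n) - lam n \<ge> C * exp (- exp (\<delta> * lam n)))"

text \<open>Linear independence of the set of values; as a frequency is injective, this is the same
  as linear independence of the family.\<close>

definition rat_lin_independent :: "(nat \<Rightarrow> real) \<Rightarrow> bool" where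
  "rat_lin_independent lam \<longleftrightarrow>
     \<not> module.dependent (\<lambda>(q::rat) (x::real). of_rat q * x) (range lam)"


section \<open>Dirichlet groups\<close>

text \<open>The compact abelian group is the type \<open>'g\<close> itself, written additively.\<close>

definition dirichlet_group ::
    "(real \<Rightarrow> 'g::{topological_ab_group_add, t2_space}) \<Rightarrow> bool" where
  "dirichlet_group \<beta> \<longleftrightarrow>
     compact (UNIV :: 'g set) \<and>
     continuous_on UNIV \<beta> \<and> (\<forall>s t. \<beta> (s + t) = \<beta> s + \<beta> t) \<and>
     closure (range \<beta>) = UNIV"

definition group_character ::
    "('g::{topological_ab_group_add, t2_space} \<Rightarrow> complex) \<Rightarrow> bool" where
  "group_character \<gamma> \<longleftrightarrow>
     continuous_on UNIV \<gamma> \<and> (\<forall>x. norm (\<gamma> x) = 1) \<and> (\<forall>x y. \<gamma> (x + y) = \<gamma> x * \<gamma> y)"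

definition represents_freq ::
    "(real \<Rightarrow> 'g::{topological_ab_group_add, t2_space}) \<Rightarrow> real \<Rightarrow> ('g \<Rightarrow> complex) \<Rightarrow> bool" where
  "represents_freq \<beta> x h \<longleftrightarrow>
     group_character h \<and> (\<forall>t. h (\<beta> t) = exp (- (\<i> * of_real x * of_real t)))"

definition freq_dirichlet_group ::
    "(nat \<Rightarrow> real) \<Rightarrow> (real \<Rightarrow> 'g::{topological_ab_group_add, t2_space}) \<Rightarrow> bool" where
  "freq_dirichlet_group lam \<beta> \<longleftrightarrow>
     dirichlet_group \<beta> \<and> (\<forall>n. \<exists>h. represents_freq \<beta> (lam n) h)"

definition freq_char ::
    "(real \<Rightarrow> 'g::{topological_ab_group_add, t2_space}) \<Rightarrow> real \<Rightarrow> 'g \<Rightarrow> complex" where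
  "freq_char \<beta> x = (THE h. represents_freq \<beta> x h)"

lemma represents_freq_unique:
  assumes "dirichlet_group \<beta>" "represents_freq \<beta> x h" "represents_freq \<beta> x h'"
  shows "h = h'"
proof
  fix y
  have c: "continuous_on UNIV h" "continuous_on UNIV h'"
    using assms by (auto simp: represents_freq_def group_character_def)
  have "closed {z. h z = h' z}"
    by (rule closed_Collect_eq[OF c])
  moreover have "range \<beta> \<subseteq> {z. h z = h' z}"
    using assms by (auto simp: represents_freq_def)
  ultimately have "closure (range \<beta>) \<subseteq> {z. h z = h' z}"
    by (rule closure_minimal[rotated])
  then show "h y = h' y"
    using assms(1) by (auto simp: dirichlet_group_def)
qed

lemma represents_freq_char:
  assumes "freq_dirichlet_group lam \<beta>"
  shows "represents_freq \<beta> (lam n) (freq_char \<beta> (lam n))"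
  using assms unfolding freq_char_def freq_dirichlet_group_def
  by (metis (mono_tags, lifting) represents_freq_unique theI)

text \<open>Regularity is part of the definition since \<open>'g\<close> need not be metrizable.\<close>

definition normalized_haar :: "('g::{topological_ab_group_add, t2_space}) measure \<Rightarrow> bool" where
  "normalized_haar m \<longleftrightarrow>
     sets m = sets borel \<and> prob_space m \<and>
     (\<forall>x. \<forall>A\<in>sets borel. emeasure m ((+) x ` A) = emeasure m A) \<and>
     (\<forall>A\<in>sets borel.
        emeasure m A = (INF U\<in>{U. open U \<and> A \<subseteq> U}. emeasure m U) \<and>
        emeasure m A = (SUP K\<in>{K. compact K \<and> K \<subseteq> A}. emeasure m K))"


section \<open>Hardy spaces\<close>

definition in_Lp :: "ennreal \<Rightarrow> 'a measure \<Rightarrow> ('a \<Rightarrow> complex) \<Rightarrow> bool" where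
  "in_Lp p M f \<longleftrightarrow> f \<in> borel_measurable M \<and>
     (if p = \<infinity> then esssup M (\<lambda>x. ennreal (norm (f x))) < \<infinity>
      else integrable M (\<lambda>x. norm (f x) powr enn2real p))"

definition Lp_norm :: "ennreal \<Rightarrow> 'a measure \<Rightarrow> ('a \<Rightarrow> complex) \<Rightarrow> real" where
  "Lp_norm p M f =
     (if p = \<infinity> then enn2real (esssup M (\<lambda>x. ennreal (norm (f x))))
      else (\<integral>x. norm (f x) powr enn2real p \<partial>M) powr (1 / enn2real p))"

definition fourier_coeff :: "'g measure \<Rightarrow> ('g \<Rightarrow> complex) \<Rightarrow> ('g \<Rightarrow> complex) \<Rightarrow> complex" where
  "fourier_coeff m f \<gamma> = (\<integral>x. f x * cnj (\<gamma> x) \<partial>m)"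

definition hardy_group ::
    "ennreal \<Rightarrow> (nat \<Rightarrow> real) \<Rightarrow> (real \<Rightarrow> 'g::{topological_ab_group_add, t2_space}) \<Rightarrow>
     'g measure \<Rightarrow> ('g \<Rightarrow> complex) set" where
  "hardy_group p lam \<beta> m =
     {f. in_Lp p m f \<and>
         (\<forall>\<gamma>. group_character \<gamma> \<and> fourier_coeff m f \<gamma> \<noteq> 0 \<longrightarrow>
              (\<exists>n. \<gamma> = freq_char \<beta> (lam n)))}"

text \<open>A Dirichlet series over a given frequency is a formal sum, i.e. the sequence of its
  coefficients. The relation below says that \<open>a\<close> is the Dirichlet series of \<open>f\<close>; it determines
  \<open>f\<close> almost everywhere, whence the description in \<open>hardy_dir_norm\<close>.\<close>

definition bohr_related ::
    "ennreal \<Rightarrow> (nat \<Rightarrow> real) \<Rightarrow> (real \<Rightarrow> 'g::{topological_ab_group_add, t2_space}) \<Rightarrow>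
     'g measure \<Rightarrow> (nat \<Rightarrow> complex) \<Rightarrow> ('g \<Rightarrow> complex) \<Rightarrow> bool" where
  "bohr_related p lam \<beta> m a f \<longleftrightarrow>
     f \<in> hardy_group p lam \<beta> m \<and> (\<forall>n. fourier_coeff m f (freq_char \<beta> (lam n)) = a n)"

definition hardy_dir ::
    "ennreal \<Rightarrow> (nat \<Rightarrow> real) \<Rightarrow> (real \<Rightarrow> 'g::{topological_ab_group_add, t2_space}) \<Rightarrow>
     'g measure \<Rightarrow> (nat \<Rightarrow> complex) set" where
  "hardy_dir p lam \<beta> m = {a. \<exists>f. bohr_related p lam \<beta> m a f}"

definition hardy_dir_norm ::
    "ennreal \<Rightarrow> (nat \<Rightarrow> real) \<Rightarrow> (real \<Rightarrow> 'g::{topological_ab_group_add, t2_space}) \<Rightarrow>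
     'g measure \<Rightarrow> (nat \<Rightarrow> complex) \<Rightarrow> real" where
  "hardy_dir_norm p lam \<beta> m a = (THE r. \<exists>f. bohr_related p lam \<beta> m a f \<and> r = Lp_norm p m f)"

definition hardy_dir_bounded ::
    "ennreal \<Rightarrow> (nat \<Rightarrow> real) \<Rightarrow> (real \<Rightarrow> 'g::{topological_ab_group_add, t2_space}) \<Rightarrow>
     'g measure \<Rightarrow> (nat \<Rightarrow> nat \<Rightarrow> complex) \<Rightarrow> bool" where
  "hardy_dir_bounded p lam \<beta> m D \<longleftrightarrow>
     (\<forall>N. D N \<in> hardy_dir p lam \<beta> m) \<and> (\<exists>C. \<forall>N. hardy_dir_norm p lam \<beta> m (D N) \<le> C)"

text \<open>Convergence in the normed space; membership of the sequence and of its limit is part of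
  the assertion.\<close>

definition hardy_dir_tendsto ::
    "ennreal \<Rightarrow> (nat \<Rightarrow> real) \<Rightarrow> (real \<Rightarrow> 'g::{topological_ab_group_add, t2_space}) \<Rightarrow>
     'g measure \<Rightarrow> (nat \<Rightarrow> nat \<Rightarrow> complex) \<Rightarrow> (nat \<Rightarrow> complex) \<Rightarrow> bool" where
  "hardy_dir_tendsto p lam \<beta> m D a \<longleftrightarrow>
     (\<forall>k. D k \<in> hardy_dir p lam \<beta> m) \<and> a \<in> hardy_dir p lam \<beta> m \<and>
     (\<lambda>k. hardy_dir_norm p lam \<beta> m (\<lambda>n. D k n - a n)) \<longlonglongrightarrow> 0"

definition dir_translate ::
    "(nat \<Rightarrow> real) \<Rightarrow> complex \<Rightarrow> (nat \<Rightarrow> complex) \<Rightarrow> nat \<Rightarrow> complex" where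
  "dir_translate lam z a = (\<lambda>n. a n * exp (- (of_real (lam n) * z)))"

end

theory Submission
  imports Defs "HOL-Complex_Analysis.Complex_Analysis"
    "HOL-Computational_Algebra.Fundamental_Theorem_Algebra" "HOL-Real_Asymp.Real_Asymp"
begin

text \<open>
Translating a Dirichlet series by \<open>\<epsilon> > 0\<close> corresponds to averaging its function \<open>f\<close> on the group along the
flow \<open>t \<mapsto> x + \<beta> t\<close> against the Poisson kernel \<open>poisson \<epsilon>\<close>, whose Fourier transform at \<open>x\<close> is
\<open>exp (- \<epsilon> * \<bar>x\<bar>)\<close>. Averaging against the kernel \<open>exp (- \<epsilon> * R) * exp (\<i> * R * t)\<close> times \<open>poisson \<epsilon>\<close> has the
multiplier \<open>exp (- \<epsilon> * (R + \<bar>x - R\<bar>))\<close>, which is the same for \<open>x \<ge> R\<close>, while the norm of this average is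
at most \<open>exp (- \<epsilon> * R)\<close>. Hence a translated series is a polynomial in the frequencies below \<open>R\<close> plus a tail of
norm at most \<open>exp (- \<epsilon> * R)\<close> times the norm of \<open>f\<close> (\<open>Pois_split\<close>). As only finitely many frequencies lie
below \<open>R\<close>, a bounded sequence whose coefficients tend to zero has translates that tend to zero in norm, for every
exponent. A subsequence with convergent coefficients exists because coefficients are bounded by norms.

What remains is that the limit coefficients belong to a function in the Hardy space (\<open>bounded_limit\<close>). The translates
of the sequence converge in mean to functions \<open>G \<epsilon>\<close>, and these must converge in mean as \<open>\<epsilon>\<close> tends to 0. This is a
theorem of F. and M. Riesz type. It follows from an inequality for analytic functions in the disc: the
mean of \<open>\<bar>f - f 0\<bar>\<close> is at most \<open>\<eta> * M + (M - \<bar>f 0\<bar>) / \<eta>\<close>, where \<open>M\<close> is the mean of \<open>\<bar>f\<bar>\<close> and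
\<open>\<eta> > 0\<close> is arbitrary (\<open>H1_gap_split_factor\<close>). Transplanted to the half-plane and integrated over the group it
bounds the distance of \<open>G \<epsilon>\<close> and \<open>G (\<epsilon> + 2 * \<delta>)\<close> in terms of the difference of the norms of \<open>G \<epsilon>\<close> and
\<open>G (\<epsilon> + \<delta>)\<close> (\<open>Pois_gap\<close>), and these norms are monotone in \<open>\<epsilon>\<close>. Bounds for other exponents pass to the limit by
Fatou's lemma.

That the norm of a Dirichlet series is well defined requires that an integrable function is determined by its
Fourier coefficients (\<open>fourier_uniqueness\<close>). By regularity of Haar measure and a convolution this comes down to
finding, for a continuous \<open>f \<noteq> 0\<close>, a character with nonzero coefficient (\<open>exists_character\<close>). The flow supplies one:
recurrence of \<open>x \<mapsto> x + \<beta> \<tau>\<close> in the compact group bounds the mean square of the autocorrelation of \<open>f\<close> along the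
orbit from below, so its spectrum has an atom, the mean ergodic averages at the atom converge to an
eigenfunction of that translation, and averaging this over one period gives an eigenfunction of the flow.
\<close>

section \<open>A gap inequality for analytic functions on the disc\<close>

text \<open>Lebesgue measure of the unit interval, but on all Borel sets of the line, so that it can also
  serve as the weight of an average along a flow.\<close>
definition unif01 :: "real measure" where
  "unif01 = density lborel (\<lambda>x. ennreal (indicator {0..1} x))"

lemma sets_unif01 [measurable_cong, simp]: "sets unif01 = sets borel"
  by (simp add: unif01_def)

lemma space_unif01 [simp]: "space unif01 = UNIV"
  by (simp add: unif01_def)

lemma prob_space_unif01: "prob_space unif01"
  by (rule prob_spaceI) (simp add: unif01_def emeasure_density ennreal_indicator)

interpretation unif01: prob_space unif01
  by (rule prob_space_unif01)

lemma measure_unif01_UNIV [simp]: "measure unif01 UNIV = 1"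
  using unif01.prob_space by simp

lemma AE_unif01: "AE t in unif01. t \<in> {0<..<1}"
proof -
  have "AE t in lborel. t \<noteq> (0::real)" "AE t in lborel. t \<noteq> (1::real)"
    by (rule AE_lborel_singleton)+
  then show ?thesis
    unfolding unif01_def by (subst AE_density) (auto split: split_indicator)
qed

lemma integral_unif01:
  fixes f :: "real \<Rightarrow> 'b::euclidean_space"
  assumes "continuous_on UNIV f"
  shows "integral\<^sup>L unif01 (\<lambda>t. f t) = integral {0..1} f"
proof -
  have [measurable]: "f \<in> borel_measurable borel"
    using assms by (rule borel_measurable_continuous_onI)
  have "integral\<^sup>L unif01 f = (LINT t:{0..1}|lborel. f t)"
    unfolding unif01_def set_lebesgue_integral_def
    using integral_density[of f lborel "indicator {0..1::real}"] by simp
  also have "\<dots> = integral {0..1} f"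
    by (intro set_borel_integral_eq_integral(2) borel_integrable_atLeastAtMost')
       (auto intro: continuous_on_subset[OF assms])
  finally show ?thesis .
qed

lemma unif01_mean_value:
  fixes f :: "complex \<Rightarrow> complex"
  assumes "continuous_on (cball 0 1) f" "f holomorphic_on ball 0 1"
  shows "(\<integral>t. f (cis (2 * pi * t)) \<partial>unif01) = f 0"
proof -
  have c: "continuous_on UNIV (\<lambda>t. f (cis (2 * pi * t)))"
    by (rule continuous_on_compose2[OF assms(1)]) (auto intro!: continuous_intros)
  have "((\<lambda>u. f u/(u-0)) has_contour_integral (2 * of_real pi * \<i> * f 0)) (circlepath 0 1)"
    by (rule Cauchy_integral_circlepath) (use assms in auto)
  then have "((\<lambda>t. (2 * of_real pi * \<i>) * f (cis (2 * pi * t))) has_integral (2 * of_real pi * \<i> * f 0)) {0..1}"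
    unfolding has_contour_integral
    by (elim has_integral_eq[rotated], subst vector_derivative_circlepath) (simp add: circlepath cis_conv_exp mult_ac)
  then have "((\<lambda>t. f (cis (2 * pi * t))) has_integral f 0) {0..1}"
    by (subst (asm) has_integral_mult_right_iff) auto
  then show ?thesis
    using integral_unif01[OF c] by (simp add: integral_unique)
qed

text \<open>An elementary stand-in for the factorisation of an $H^1$ function into two $H^2$ functions of
  equal modulus on the circle. The property passes to products, so that for polynomials it reduces to
  linear factors.\<close>
definition split_factor :: "(complex \<Rightarrow> complex) \<Rightarrow> bool" where
  "split_factor f \<longleftrightarrow> (\<exists>u v. continuous_on (cball 0 1) u \<and> continuous_on (cball 0 1) v \<and>
     u holomorphic_on ball 0 1 \<and> v holomorphic_on ball 0 1 \<and>
     (\<forall>z\<in>cball 0 1. f z = u z * v z) \<and> (\<forall>z\<in>sphere 0 1. norm (u z) = norm (v z)))"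

lemma split_factor_const: "split_factor (\<lambda>_. c)"
  unfolding split_factor_def
  by (intro exI[of _ "\<lambda>_. csqrt c"]) (auto simp flip: power2_eq_square)

lemma split_factor_mult:
  assumes "split_factor f" "split_factor g"
  shows "split_factor (\<lambda>z. f z * g z)"
proof -
  obtain u v where 1: "continuous_on (cball 0 1) u" "continuous_on (cball 0 1) v"
     "u holomorphic_on ball 0 1" "v holomorphic_on ball 0 1"
     "\<And>z. z\<in>cball 0 1 \<Longrightarrow> f z = u z * v z" "\<And>z. z\<in>sphere 0 1 \<Longrightarrow> norm (u z) = norm (v z)"
    using assms(1) unfolding split_factor_def by blast
  obtain u' v' where 2: "continuous_on (cball 0 1) u'" "continuous_on (cball 0 1) v'"
     "u' holomorphic_on ball 0 1" "v' holomorphic_on ball 0 1"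
     "\<And>z. z\<in>cball 0 1 \<Longrightarrow> g z = u' z * v' z" "\<And>z. z\<in>sphere 0 1 \<Longrightarrow> norm (u' z) = norm (v' z)"
    using assms(2) unfolding split_factor_def by blast
  show ?thesis
    unfolding split_factor_def
    by (rule exI[of _ "\<lambda>z. u z * u' z"], rule exI[of _ "\<lambda>z. v z * v' z"])
       (use 1 2 in \<open>auto intro!: continuous_intros holomorphic_intros simp: norm_mult\<close>)
qed

lemma continuous_on_csqrt_right_half_plane: "continuous_on {z. Re z \<ge> 0} csqrt"
proof -
  have "continuous (at z within {z. Re z \<ge> 0}) csqrt" if "Re z \<ge> 0" for z
  proof (cases "z = 0")
    case True
    have "((\<lambda>w. sqrt (norm w)) \<longlongrightarrow> sqrt (norm (0::complex))) (at 0 within {z. Re z \<ge> 0})"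
      by (intro tendsto_intros)
    then have "((\<lambda>w. norm (csqrt w)) \<longlongrightarrow> 0) (at 0 within {z. Re z \<ge> 0})"
      by simp
    then have "(csqrt \<longlongrightarrow> 0) (at 0 within {z. Re z \<ge> 0})"
      by (rule tendsto_norm_zero_cancel)
    then show ?thesis
      unfolding True continuous_within by simp
  next
    case False
    with that have "z \<notin> \<real>\<^sub>\<le>\<^sub>0" 
      by (auto simp: complex_nonpos_Reals_iff complex_eq_iff)
    then show ?thesis by (rule continuous_within_csqrt)
  qed
  then show ?thesis by (simp add: continuous_on_eq_continuous_within)
qed

text \<open>If \<open>a\<close> lies outside the open disc, then \<open>a - z\<close> has a square root on the closed disc, analytic
  inside, which serves as both factors.
  If \<open>a\<close> lies inside, then \<open>\<bar>a - z\<bar> = \<bar>1 - cnj a * z\<bar>\<close> on the circle, and the second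
  factor is the square root of \<open>1 - cnj a * z\<close>, which has no zero in the closed disc.\<close>
lemma split_factor_linear: "split_factor (\<lambda>z. a - z)"
proof (cases "norm a < 1")
  case False
  then have a: "norm a \<ge> 1" "a \<noteq> 0" by auto
  define s where "s z = csqrt a * csqrt (1 - z / a)" for z
  have r: "Re (1 - z / a) \<ge> 0" if "norm z \<le> 1" for z
  proof -
    have "norm (z / a) \<le> 1" using that a by (simp add: norm_divide divide_le_eq)
    then show ?thesis using complex_Re_le_cmod[of "z/a"] by simp
  qed
  have r': "1 - z / a \<notin> \<real>\<^sub>\<le>\<^sub>0" if "norm z < 1" for z
  proof -
    have "norm (z / a) < 1" using that a by (simp add: norm_divide divide_less_eq)
    then have "Re (1 - z / a) > 0" using complex_Re_le_cmod[of "z/a"] by simp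
    then show ?thesis by (auto simp: complex_nonpos_Reals_iff)
  qed
  have "continuous_on (cball 0 1) s"
    unfolding s_def using a
    by (intro continuous_intros continuous_on_compose2[OF continuous_on_csqrt_right_half_plane])
       (use r in auto)
  moreover have "s holomorphic_on ball 0 1"
    unfolding s_def using a by (intro holomorphic_intros) (use r' in auto)
  moreover have "a - z = s z * s z" for z
  proof -
    have "s z * s z = (csqrt a)\<^sup>2 * (csqrt (1 - z/a))\<^sup>2"
      unfolding s_def by (simp only: power2_eq_square mult_ac)
    also have "\<dots> = a - z"
      using a unfolding power2_csqrt by (simp add: field_simps)
    finally show ?thesis by simp
  qed
  ultimately show ?thesis
    unfolding split_factor_def by blast
next
  case True
  define v where "v z = csqrt (1 - cnj a * z)" for z
  have r: "Re (1 - cnj a * z) > 0" if "norm z \<le> 1" for z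
  proof -
    have "norm (cnj a * z) \<le> norm a" using that by (simp add: norm_mult mult_left_le)
    then show ?thesis using complex_Re_le_cmod[of "cnj a * z"] True by simp
  qed
  have r2: "1 - cnj a * z \<notin> \<real>\<^sub>\<le>\<^sub>0" if "norm z \<le> 1" for z
    using r[OF that] by (metis complex_nonpos_Reals_iff not_less)
  have nz: "v z \<noteq> 0" if "norm z \<le> 1" for z
    using r[OF that] unfolding v_def by (metis csqrt_eq_0 less_irrefl zero_complex.sel(1))
  have c1: "continuous_on (cball 0 1) v"
    unfolding v_def
    by (intro continuous_intros continuous_on_compose2[OF continuous_on_csqrt])
       (use r2 in auto)
  have c2: "v holomorphic_on ball 0 1"
    unfolding v_def
    by (intro holomorphic_on_csqrt' holomorphic_intros)
       (use r2 in auto)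
  note c = c1 c2
  have "norm ((a - z) / v z) = norm (v z)" if "norm z = 1" for z
  proof -
    have "norm (a - z) = norm (cnj z * (a - z))" using that by (simp add: norm_mult)
    also have "cnj z * (a - z) = cnj (cnj a * z - z * cnj z)" by (simp add: algebra_simps)
    also have "z * cnj z = 1" using that by (simp flip: complex_norm_square)
    also have "norm (cnj (cnj a * z - 1)) = norm (1 - cnj a * z)" by (simp add: norm_minus_commute del: complex_cnj_diff)
    also have "\<dots> = (norm (v z))\<^sup>2" unfolding v_def by simp
    finally show ?thesis using nz[of z] that by (simp add: norm_divide power2_eq_square)
  qed
  then show ?thesis
    unfolding split_factor_def
    by (intro exI[of _ "\<lambda>z. (a - z) / v z"] exI[of _ v])
       (use c nz in \<open>auto intro!: continuous_intros holomorphic_intros\<close>)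
qed

lemma split_factor_poly: "split_factor (poly p)"
proof (induction p rule: poly_root_induct[where P = "\<lambda>_. True"])
  case 0
  then show ?case using split_factor_const[of 0] by (simp add: poly_0[abs_def])
next
  case (no_roots p)
  then have "constant (poly p)"
    using fundamental_theorem_of_algebra by blast
  then have "poly p = (\<lambda>_. poly p 0)"
    by (auto simp: constant_def)
  then show ?case using split_factor_const by metis
next
  case (root a p)
  have "poly ([:a, -1:] * p) = (\<lambda>z. (a - z) * poly p z)" by (auto simp: fun_eq_iff algebra_simps)
  then show ?case using split_factor_mult[OF split_factor_linear root.IH] by simp
qed

lemma unif01_integrable_cont:
  fixes f :: "real \<Rightarrow> 'b::euclidean_space"
  assumes "continuous_on UNIV f"
  shows "integrable unif01 f"
proof -
  have m: "f \<in> borel_measurable borel" using assms by (rule borel_measurable_continuous_onI)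
  have "set_integrable lborel {0..1} f"
    by (intro borel_integrable_atLeastAtMost') (auto intro: continuous_on_subset[OF assms])
  then show ?thesis
    unfolding unif01_def set_integrable_def using m
    by (subst integrable_density) auto
qed

text \<open>The distance of \<open>f\<close> from its value at the centre is controlled by the gap between the mean of
  \<open>\<bar>f\<bar>\<close> and \<open>\<bar>f 0\<bar>\<close>. With \<open>f = u * v\<close> one has
  \<open>f - f 0 = u * (v - v 0) + v 0 * (u - u 0)\<close>; the mean squares of \<open>u\<close> and \<open>v\<close> are both \<open>M\<close>, those of
  \<open>u - u 0\<close> and \<open>v - v 0\<close> are \<open>M - \<bar>u 0\<bar>\<^sup>2\<close> and \<open>M - \<bar>v 0\<bar>\<^sup>2\<close>, and
  \<open>\<bar>u 0\<bar>\<^sup>2 + \<bar>v 0\<bar>\<^sup>2 \<ge> 2 * \<bar>f 0\<bar>\<close>. Young's inequality with the free weight \<open>\<eta>\<close> keeps the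
  bound linear in \<open>M\<close> and \<open>\<bar>f 0\<bar>\<close>, which is what allows it to be integrated over a group later.\<close>
lemma H1_gap_split_factor:
  assumes "split_factor f" and \<eta>: "\<eta> > 0"
  defines "M \<equiv> (\<integral>t. norm (f (cis (2 * pi * t))) \<partial>unif01)"
  shows "(\<integral>t. norm (f (cis (2 * pi * t)) - f 0) \<partial>unif01) \<le> \<eta> * M + (M - norm (f 0)) / \<eta>"
proof -
  obtain u v where uv: "continuous_on (cball 0 1) u" "continuous_on (cball 0 1) v"
     "u holomorphic_on ball 0 1" "v holomorphic_on ball 0 1"
     "\<And>z. z\<in>cball 0 1 \<Longrightarrow> f z = u z * v z" "\<And>z. z\<in>sphere 0 1 \<Longrightarrow> norm (u z) = norm (v z)"
    using assms(1) unfolding split_factor_def by blast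
  let ?e = "\<lambda>t. cis (2 * pi * t)"
  have cc: "continuous_on UNIV (\<lambda>t. g (?e t))" if "continuous_on (cball 0 1) g" for g :: "complex \<Rightarrow> complex"
    by (rule continuous_on_compose2[OF that]) (auto intro!: continuous_intros)
  note cu = cc[OF uv(1)] and cv = cc[OF uv(2)]
  have fe: "f (?e t) = u (?e t) * v (?e t)" for t by (rule uv(5)) auto
  have cf: "continuous_on UNIV (\<lambda>t. f (?e t))"
    unfolding fe by (intro continuous_intros cu cv)
  have f0: "f 0 = u 0 * v 0" by (rule uv(5)) auto
  have ne: "norm (u (?e t)) = norm (v (?e t))" for t by (rule uv(6)) auto
  have M1: "(\<integral>t. (norm (u (?e t)))\<^sup>2 \<partial>unif01) = M" and M2: "(\<integral>t. (norm (v (?e t)))\<^sup>2 \<partial>unif01) = M"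
    unfolding M_def fe norm_mult ne power2_eq_square by auto
  have var: "(\<integral>t. (norm (g (?e t) - g 0))\<^sup>2 \<partial>unif01) = (\<integral>t. (norm (g (?e t)))\<^sup>2 \<partial>unif01) - (norm (g 0))\<^sup>2"
    if g: "continuous_on (cball 0 1) g" "g holomorphic_on ball 0 1" for g :: "complex \<Rightarrow> complex"
  proof -
    note cg [continuous_intros] = cc[OF g(1)]
    have mv: "(\<integral>t. g (?e t) \<partial>unif01) = g 0" by (rule unif01_mean_value) fact+
    have i: "integrable unif01 (\<lambda>t. g (?e t))" by (rule unif01_integrable_cont[OF cg])
    have i2: "integrable unif01 (\<lambda>t. (norm (g (?e t)))\<^sup>2)" by (intro unif01_integrable_cont continuous_intros)
    have "(norm (g (?e t) - g 0))\<^sup>2 = (norm (g (?e t)))\<^sup>2 - 2 * Re (g (?e t) * cnj (g 0)) + (norm (g 0))\<^sup>2" for t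
      unfolding cmod_power2 by (simp add: power2_eq_square algebra_simps)
    then have "(\<integral>t. (norm (g (?e t) - g 0))\<^sup>2 \<partial>unif01) =
       (\<integral>t. (norm (g (?e t)))\<^sup>2 \<partial>unif01) - 2 * (\<integral>t. Re (g (?e t) * cnj (g 0)) \<partial>unif01) + (norm (g 0))\<^sup>2"
      using i i2 by simp
    also have "(\<integral>t. Re (g (?e t) * cnj (g 0)) \<partial>unif01) = Re (g 0 * cnj (g 0))"
      using i by (simp add: integral_Re mv)
    also have "\<dots> = (norm (g 0))\<^sup>2" by (simp flip: complex_norm_square)
    finally show ?thesis by simp
  qed
  have young: "x * y \<le> (\<eta> * x\<^sup>2 + y\<^sup>2 / \<eta>) / 2" for x y :: real
  proof -
    have "0 \<le> (\<eta> * x - y)\<^sup>2 / \<eta>" using \<eta> by simp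
    also have "\<dots> = \<eta> * x\<^sup>2 - 2 * x * y + y\<^sup>2 / \<eta>" using \<eta> by (simp add: power2_eq_square field_simps)
    finally show ?thesis by simp
  qed
  have pt: "norm (f (?e t) - f 0) \<le> (\<eta> * (norm (u (?e t)))\<^sup>2 + (norm (v (?e t) - v 0))\<^sup>2 / \<eta>) / 2
      + (\<eta> * (norm (v 0))\<^sup>2 + (norm (u (?e t) - u 0))\<^sup>2 / \<eta>) / 2" for t
  proof -
    have "f (?e t) - f 0 = u (?e t) * (v (?e t) - v 0) + v 0 * (u (?e t) - u 0)"
      unfolding fe f0 by (simp add: algebra_simps)
    then have "norm (f (?e t) - f 0) \<le> norm (u (?e t)) * norm (v (?e t) - v 0) + norm (v 0) * norm (u (?e t) - u 0)"
      by (metis norm_mult norm_triangle_ineq)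
    then show ?thesis using young[of "norm (u (?e t))" "norm (v (?e t) - v 0)"] young[of "norm (v 0)" "norm (u (?e t) - u 0)"]
      by linarith
  qed
  have "(\<integral>t. norm (f (?e t) - f 0) \<partial>unif01) \<le> (\<integral>t. (\<eta> * (norm (u (?e t)))\<^sup>2 + (norm (v (?e t) - v 0))\<^sup>2 / \<eta>) / 2
      + (\<eta> * (norm (v 0))\<^sup>2 + (norm (u (?e t) - u 0))\<^sup>2 / \<eta>) / 2 \<partial>unif01)"
    by (intro integral_mono pt unif01_integrable_cont) (use \<eta> in \<open>auto intro!: continuous_intros cu cv cf\<close>)
  also have "\<dots> = (\<eta> * M + (M - (norm (v 0))\<^sup>2) / \<eta>) / 2 + (\<eta> * (norm (v 0))\<^sup>2 + (M - (norm (u 0))\<^sup>2) / \<eta>) / 2"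
  proof -
    have "integrable unif01 (\<lambda>t. (norm (u (?e t)))\<^sup>2)" "integrable unif01 (\<lambda>t. (norm (v (?e t) - v 0))\<^sup>2)"
      "integrable unif01 (\<lambda>t. (norm (u (?e t) - u 0))\<^sup>2)"
      by (intro unif01_integrable_cont continuous_intros cu cv)+
    then show ?thesis
      using \<eta> by (simp add: M1 M2 var uv)
  qed
  also have "\<dots> \<le> \<eta> * M + (M - norm (f 0)) / \<eta>"
  proof -
    have "0 \<le> (\<integral>t. (norm (v (?e t) - v 0))\<^sup>2 \<partial>unif01)" by simp
    then have 1: "\<eta> * (norm (v 0))\<^sup>2 \<le> \<eta> * M" using var[OF uv(2,4)] M2 \<eta> by simp
    have "0 \<le> (norm (u 0) - norm (v 0))\<^sup>2" by simp
    then have "2 * norm (f 0) \<le> (norm (u 0))\<^sup>2 + (norm (v 0))\<^sup>2" by (simp add: f0 norm_mult power2_diff)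
    then have "(2 * M - (norm (u 0))\<^sup>2 - (norm (v 0))\<^sup>2) / \<eta> \<le> (2 * M - 2 * norm (f 0)) / \<eta>"
      using \<eta> by (intro divide_right_mono) auto
    then have 2: "(M - (norm (u 0))\<^sup>2) / \<eta> + (M - (norm (v 0))\<^sup>2) / \<eta> \<le> 2 * ((M - norm (f 0)) / \<eta>)"
      by (simp add: diff_divide_distrib add_divide_distrib)
    have "(x + a) / 2 + (y + b) / 2 \<le> x + c" if "y \<le> x" "b + a \<le> 2 * c" for x y a b c :: real
      using that by (simp add: field_simps)
    from this[OF 1 2] show ?thesis .
  qed
  finally show ?thesis .
qed

text \<open>Taylor polynomials approximate \<open>f\<close> uniformly on a circle of radius less than one, and polynomials
  split.\<close>
lemma H1_gap_circle:
  assumes hol: "f holomorphic_on ball 0 1" and r: "0 < r" "r < 1" and \<eta>: "\<eta> > 0"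
  defines "M \<equiv> (\<integral>t. norm (f (of_real r * cis (2 * pi * t))) \<partial>unif01)"
  shows "(\<integral>t. norm (f (of_real r * cis (2 * pi * t)) - f 0) \<partial>unif01) \<le> \<eta> * M + (M - norm (f 0)) / \<eta>"
proof -
  let ?e = "\<lambda>t. cis (2 * pi * t)"
  define a where "a n = (deriv ^^ n) f 0 / fact n" for n
  have sums: "(\<lambda>n. a n * w ^ n) sums f w" if "norm w < 1" for w
    using holomorphic_power_series[OF hol, of w] that by (simp add: a_def)
  have "conv_radius a \<ge> norm (of_real ((1 + r) / 2) :: complex)"
    by (rule conv_radius_geI, rule sums_summable, rule sums, subst norm_of_real) (use r in auto)
  also have "norm (of_real ((1 + r) / 2) :: complex) = (1 + r) / 2"
    by (subst norm_of_real) (use r in auto)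
  finally have "conv_radius a \<ge> ereal ((1 + r) / 2)" .
  moreover have "ereal r < ereal ((1 + r) / 2)" using r by simp
  ultimately have cr: "ereal r < conv_radius a" by (rule less_le_trans[rotated])
  have ul: "uniform_limit (cball 0 r) (\<lambda>n x. \<Sum>i<n. a i * x ^ i) f sequentially"
  proof (rule uniform_limit_cong'[THEN iffD1, OF _ _ powser_uniform_limit[OF cr, of 0]])
    fix x :: complex assume "x \<in> cball 0 r"
    then show "(\<Sum>i. a i * (x - 0) ^ i) = f x"
      using sums[of x] r by (simp add: sums_iff)
  qed auto
  have cf: "continuous_on UNIV (\<lambda>t. f (of_real r * ?e t))"
    by (rule continuous_on_compose2[OF holomorphic_on_imp_continuous_on[OF hol]])
       (use r in \<open>auto intro!: continuous_intros simp: norm_mult\<close>)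
  define L where "L = (\<integral>t. norm (f (of_real r * ?e t) - f 0) \<partial>unif01)"
  have key: "L \<le> \<eta> * M + (M - norm (f 0)) / \<eta> + e * (2 + \<eta> + 2 / \<eta>)" if e: "e > 0" for e
  proof -
    obtain n where n: "\<And>x. x \<in> cball 0 r \<Longrightarrow> norm ((\<Sum>i<n. a i * x ^ i) - f x) < e"
      using uniform_limitD[OF ul e] by (auto simp: dist_norm eventually_sequentially) (metis mem_cball_0 order_refl)
    define p where "p = (\<Sum>i<n. monom (a i * of_real r ^ i) i)"
    have pp: "poly p z = (\<Sum>i<n. a i * (of_real r * z) ^ i)" for z
      by (simp add: p_def poly_sum poly_monom power_mult_distrib mult_ac)
    have d: "norm (poly p z - f (of_real r * z)) \<le> e" if "norm z \<le> 1" for z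
      using n[of "of_real r * z"] that r unfolding pp by (auto simp: norm_mult mult_left_le)
    have cp [continuous_intros]: "continuous_on UNIV (\<lambda>t. poly p (?e t))"
      by (intro continuous_intros)
    note cf [continuous_intros]
    have "(\<integral>t. norm (f (of_real r * ?e t) - f 0) \<partial>unif01) \<le> (\<integral>t. norm (poly p (?e t) - poly p 0) + 2 * e \<partial>unif01)"
    proof (intro integral_mono unif01_integrable_cont continuous_intros)
      fix t
      have "f (of_real r * ?e t) - f 0 = (poly p (?e t) - poly p 0) - (poly p (?e t) - f (of_real r * ?e t)) + (poly p 0 - f 0)"
        by simp
      also have "norm \<dots> \<le> norm (poly p (?e t) - poly p 0) + norm (poly p (?e t) - f (of_real r * ?e t)) + norm (poly p 0 - f 0)"
        by (meson norm_triangle_ineq norm_triangle_ineq4 order_trans add_right_mono)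
      finally show "norm (f (of_real r * ?e t) - f 0) \<le> norm (poly p (?e t) - poly p 0) + 2 * e"
        using d[of "?e t"] d[of 0] by simp
    qed
    also have "\<dots> = (\<integral>t. norm (poly p (?e t) - poly p 0) \<partial>unif01) + 2 * e"
      by (subst Bochner_Integration.integral_add) (auto intro!: unif01_integrable_cont continuous_intros)
    also have "(\<integral>t. norm (poly p (?e t) - poly p 0) \<partial>unif01) \<le> \<eta> * (\<integral>t. norm (poly p (?e t)) \<partial>unif01)
        + ((\<integral>t. norm (poly p (?e t)) \<partial>unif01) - norm (poly p 0)) / \<eta>"
      by (rule H1_gap_split_factor[OF split_factor_poly \<eta>])
    finally have 1: "L \<le> \<eta> * (\<integral>t. norm (poly p (?e t)) \<partial>unif01)
        + ((\<integral>t. norm (poly p (?e t)) \<partial>unif01) - norm (poly p 0)) / \<eta> + 2 * e" by (simp add: L_def)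
    have "(\<integral>t. norm (poly p (?e t)) \<partial>unif01) \<le> (\<integral>t. norm (f (of_real r * ?e t)) + e \<partial>unif01)"
    proof (intro integral_mono unif01_integrable_cont continuous_intros)
      fix t show "norm (poly p (?e t)) \<le> norm (f (of_real r * ?e t)) + e"
        using d[of "?e t"] norm_triangle_ineq2[of "poly p (?e t)" "f (of_real r * ?e t)"] by simp
    qed
    also have "\<dots> = M + e"
      unfolding M_def by (subst Bochner_Integration.integral_add) (auto intro!: unif01_integrable_cont continuous_intros)
    finally have 2: "(\<integral>t. norm (poly p (?e t)) \<partial>unif01) \<le> M + e" .
    have 3: "norm (f 0) \<le> norm (poly p 0) + e"
      using d[of 0] norm_triangle_ineq2[of "f 0" "poly p 0"] by (simp add: norm_minus_commute)
    have "\<eta> * (\<integral>t. norm (poly p (?e t)) \<partial>unif01) \<le> \<eta> * (M + e)"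
      using 2 \<eta> by simp
    moreover have "((\<integral>t. norm (poly p (?e t)) \<partial>unif01) - norm (poly p 0)) / \<eta> \<le> ((M + e) - (norm (f 0) - e)) / \<eta>"
      using 2 3 \<eta> by (intro divide_right_mono) auto
    ultimately have "L \<le> \<eta> * (M + e) + ((M + e) - (norm (f 0) - e)) / \<eta> + 2 * e"
      using 1 by linarith
    also have "\<dots> = \<eta> * M + (M - norm (f 0)) / \<eta> + e * (2 + \<eta> + 2 / \<eta>)"
      using \<eta> by (simp add: field_simps)
    finally show ?thesis .
  qed
  have "L \<le> \<eta> * M + (M - norm (f 0)) / \<eta>"
  proof (rule field_le_epsilon)
    fix e :: real assume e: "e > 0"
    define c where "c = 2 + \<eta> + 2 / \<eta>"
    have c: "c > 0" using \<eta> by (simp add: c_def add_pos_pos)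
    have "L \<le> \<eta> * M + (M - norm (f 0)) / \<eta> + (e / c) * c"
      unfolding c_def by (rule key) (use e c in \<open>auto simp: c_def[symmetric]\<close>)
    then show "L \<le> \<eta> * M + (M - norm (f 0)) / \<eta> + e" using c by simp
  qed
  then show ?thesis unfolding L_def .
qed

text \<open>Since \<open>f\<close> is bounded, dominated convergence carries the mean value property and the gap
  inequality over to radial boundary values.\<close>
lemma H1_gap_radial:
  assumes hol: "f holomorphic_on ball 0 1" and \<eta>: "\<eta> > 0"
  and bd: "\<And>z. norm z < 1 \<Longrightarrow> norm (f z) \<le> K"
  and g [measurable]: "g \<in> borel_measurable borel"
  and lim: "AE t in unif01. ((\<lambda>r. f (of_real r * cis (2 * pi * t))) \<longlongrightarrow> g t) (at_left (1::real))"
  defines "M \<equiv> (\<integral>t. norm (g t) \<partial>unif01)"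
  shows "(\<integral>t. g t \<partial>unif01) = f 0"
    and "(\<integral>t. norm (g t - f 0) \<partial>unif01) \<le> \<eta> * M + (M - norm (f 0)) / \<eta>"
proof -
  let ?e = "\<lambda>t. cis (2 * pi * t)"
  define r :: "nat \<Rightarrow> real" where "r n = 1 - 1 / real (n + 2)" for n
  have r: "0 < r n" "r n < 1" for n by (auto simp: r_def field_simps)
  have "r \<longlonglongrightarrow> 1 - 0"
    unfolding r_def by (intro tendsto_intros LIMSEQ_ignore_initial_segment[OF lim_1_over_n])
  then have rl: "filterlim r (at_left 1) sequentially"
    by (auto simp: filterlim_at r less_imp_neq intro!: always_eventually)
  have lim': "AE t in unif01. (\<lambda>n. f (of_real (r n) * ?e t)) \<longlonglongrightarrow> g t"
    using lim by eventually_elim (rule filterlim_compose[OF _ rl])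
  have K: "norm (f (of_real (r n) * ?e t)) \<le> K" for n t
    using r[of n] by (intro bd) (simp add: norm_mult)
  have K0: "norm (f 0) \<le> K" by (rule bd) simp
  have cf: "continuous_on UNIV (\<lambda>t. f (of_real (r n) * ?e t))" for n
    by (rule continuous_on_compose2[OF holomorphic_on_imp_continuous_on[OF hol]])
       (use r[of n] in \<open>auto intro!: continuous_intros simp: norm_mult\<close>)
  have mf [measurable]: "(\<lambda>t. f (of_real (r n) * ?e t)) \<in> borel_measurable borel" for n
    by (rule borel_measurable_continuous_onI[OF cf])
  have "(\<lambda>n. \<integral>t. f (of_real (r n) * ?e t) \<partial>unif01) \<longlonglongrightarrow> (\<integral>t. g t \<partial>unif01)"
    by (rule integral_dominated_convergence[where w = "\<lambda>_. K"]) (use lim' K in auto)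
  moreover have "(\<integral>t. f (of_real (r n) * ?e t) \<partial>unif01) = f 0" for n
  proof -
    have lt: "r n * norm z < 1" if "norm z \<le> 1" for z :: complex
      by (rule le_less_trans[OF mult_left_le[OF that] r(2)]) (use r(1)[of n] in simp)
    have "(\<lambda>z. f (of_real (r n) * z)) holomorphic_on cball 0 1"
      by (rule holomorphic_on_compose_gen[OF _ hol, unfolded o_def])
         (use r[of n] lt in \<open>auto intro!: holomorphic_intros simp: norm_mult\<close>)
    then show ?thesis
      using unif01_mean_value[OF holomorphic_on_imp_continuous_on holomorphic_on_subset[OF _ ball_subset_cball]]
      by fastforce
  qed
  ultimately show "(\<integral>t. g t \<partial>unif01) = f 0"
    using LIMSEQ_unique[OF _ tendsto_const] by simp
  have l1: "(\<lambda>n. \<integral>t. norm (f (of_real (r n) * ?e t)) \<partial>unif01) \<longlonglongrightarrow> M"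
    unfolding M_def
    by (rule integral_dominated_convergence[where w = "\<lambda>_. K"]) (use lim' K in \<open>auto intro: tendsto_norm\<close>)
  have "(\<lambda>n. \<integral>t. norm (f (of_real (r n) * ?e t) - f 0) \<partial>unif01) \<longlonglongrightarrow> (\<integral>t. norm (g t - f 0) \<partial>unif01)"
  proof (rule integral_dominated_convergence[where w = "\<lambda>_. K + K"])
    show "AE t in unif01. (\<lambda>n. norm (f (of_real (r n) * ?e t) - f 0)) \<longlonglongrightarrow> norm (g t - f 0)"
      using lim' by eventually_elim (intro tendsto_intros)
    show "AE t in unif01. norm (norm (f (of_real (r n) * ?e t) - f 0)) \<le> K + K" for n
    proof (rule AE_I2)
      fix t show "norm (norm (f (of_real (r n) * ?e t) - f 0)) \<le> K + K"
        using K[of n t] K0 norm_triangle_ineq4[of "f (of_real (r n) * ?e t)" "f 0"] by simp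
    qed
  qed auto
  then show "(\<integral>t. norm (g t - f 0) \<partial>unif01) \<le> \<eta> * M + (M - norm (f 0)) / \<eta>"
  proof (rule LIMSEQ_le)
    show "(\<lambda>n. \<eta> * (\<integral>t. norm (f (of_real (r n) * ?e t)) \<partial>unif01) +
       ((\<integral>t. norm (f (of_real (r n) * ?e t)) \<partial>unif01) - norm (f 0)) / \<eta>) \<longlonglongrightarrow> \<eta> * M + (M - norm (f 0)) / \<eta>"
      using \<eta> by (intro tendsto_intros l1) auto
  qed (use H1_gap_circle[OF hol r \<eta>] in auto)
qed

section \<open>The Poisson kernel of the half-plane\<close>

text \<open>The Cauchy distribution with scale \<open>\<delta>\<close>, that is, the Poisson kernel of the half-plane at
  distance \<open>\<delta>\<close> from the boundary, written as the image of the uniform distribution on the circle under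
  the Cayley transform. In this form statements about the disc apply to it directly.\<close>
definition poisson :: "real \<Rightarrow> real measure" where
  "poisson \<delta> = distr unif01 borel (\<lambda>s. \<delta> * cot (pi * s))"

lemma measurable_cot_pi [measurable]: "(\<lambda>s. \<delta> * cot (pi * s)) \<in> borel_measurable (borel :: real measure)"
  unfolding cot_def by measurable

lemma sets_poisson [simp, measurable_cong]: "sets (poisson \<delta>) = sets borel"
  and space_poisson [simp]: "space (poisson \<delta>) = UNIV"
  by (simp_all add: poisson_def)

lemma prob_space_poisson: "prob_space (poisson \<delta>)"
  unfolding poisson_def by (rule unif01.prob_space_distr) simp

lemma cayley_circle:
  assumes "s \<in> {0<..<1}"
  shows "(1 + cis (2 * pi * s)) / (1 - cis (2 * pi * s)) = \<i> * of_real (cot (pi * s))"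
    and "cis (2 * pi * s) \<noteq> 1"
proof -
  have s: "sin (pi * s) > 0" by (rule sin_gt_zero) (use assms in auto)
  have w: "cis (2 * pi * s) = cis (pi * s) * cis (pi * s)" by (simp add: cis_mult mult.assoc)
  have i: "cis (pi * s) * cis (- (pi * s)) = 1" by (simp add: cis_mult)
  have "1 - cis (2 * pi * s) = cis (pi * s) * (cis (- (pi * s)) - cis (pi * s))"
    unfolding w right_diff_distrib i ..
  also have "\<dots> = - 2 * \<i> * sin (pi * s) * cis (pi * s)"
    by (simp add: complex_eq_iff)
  finally have 1: "1 - cis (2 * pi * s) = - 2 * \<i> * sin (pi * s) * cis (pi * s)" .
  have "1 + cis (2 * pi * s) = cis (pi * s) * (cis (- (pi * s)) + cis (pi * s))"
    unfolding w distrib_left i ..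
  also have "\<dots> = 2 * cos (pi * s) * cis (pi * s)"
    by (simp add: complex_eq_iff)
  finally have 2: "1 + cis (2 * pi * s) = 2 * cos (pi * s) * cis (pi * s)" .
  show "(1 + cis (2 * pi * s)) / (1 - cis (2 * pi * s)) = \<i> * of_real (cot (pi * s))"
    unfolding 1 2 cot_def using s by (simp add: field_simps)
  show "cis (2 * pi * s) \<noteq> 1"
    using 1 s by auto
qed

text \<open>At \<open>z = cis (2 * pi * s)\<close> the function
  \<open>\<Sum>n\<in>S. c n * exp (- \<delta> * lam n * (1 + z) / (1 - z))\<close> takes the value \<open>q (\<delta> * cot (pi * s))\<close>, and at the
  centre the value \<open>q0\<close>; it is bounded in the disc because \<open>(1 + z) / (1 - z)\<close> has nonnegative real
  part there and the exponents \<open>lam n\<close> are nonnegative.\<close>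
lemma poisson_H1_gap:
  fixes c :: "nat \<Rightarrow> complex" and lam :: "nat \<Rightarrow> real"
  assumes \<delta>: "\<delta> > 0" and \<eta>: "\<eta> > 0" and nonneg: "\<And>n. n \<in> S \<Longrightarrow> lam n \<ge> 0"
  defines "q \<equiv> \<lambda>t. \<Sum>n\<in>S. c n * exp (- (\<i> * of_real (lam n) * of_real t))"
    and "q0 \<equiv> \<Sum>n\<in>S. c n * of_real (exp (- \<delta> * lam n))"
  defines "M \<equiv> (\<integral>t. norm (q t) \<partial>poisson \<delta>)"
  shows "(\<integral>t. q t \<partial>poisson \<delta>) = q0"
    and "(\<integral>t. norm (q t - q0) \<partial>poisson \<delta>) \<le> \<eta> * M + (M - norm q0) / \<eta>"
proof -
  define f where "f z = (\<Sum>n\<in>S. c n * exp (- (of_real (\<delta> * lam n) * ((1 + z) / (1 - z)))))" for z :: complex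
  define g where "g s = q (\<delta> * cot (pi * s))" for s
  have q_meas [measurable]: "q \<in> borel_measurable borel"
    unfolding q_def by (intro borel_measurable_continuous_onI continuous_intros)
  have g_meas [measurable]: "g \<in> borel_measurable borel"
    unfolding g_def by measurable
  have hol: "f holomorphic_on ball 0 1"
    unfolding f_def by (intro holomorphic_intros) auto
  have bd: "norm (f z) \<le> (\<Sum>n\<in>S. norm (c n))" if z: "norm z < 1" for z
  proof -
    have "Re ((1 + z) / (1 - z)) = (1 - (norm z)\<^sup>2) / (norm (1 - z))\<^sup>2"
      unfolding Re_divide cmod_power2 by (simp add: algebra_simps power2_eq_square)
    also have "\<dots> \<ge> 0" using z by (intro divide_nonneg_nonneg) (auto simp: power_le_one)
    finally have re: "Re ((1 + z) / (1 - z)) \<ge> 0" .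
    show ?thesis
      unfolding f_def
    proof (rule sum_norm_le)
      fix n assume n: "n \<in> S"
      have "Re (- (of_real (\<delta> * lam n) * ((1 + z) / (1 - z)))) \<le> 0"
      proof -
        have R: "Re (of_real a * X) = a * Re X" for a X by simp
        show ?thesis
          unfolding uminus_complex.sel R using mult_nonneg_nonneg[OF _ re, of "\<delta> * lam n"] \<delta> nonneg[OF n] by simp
      qed
      then have "norm (exp (- (of_real (\<delta> * lam n) * ((1 + z) / (1 - z))))) \<le> 1"
        unfolding norm_exp_eq_Re by simp
      then show "norm (c n * exp (- (of_real (\<delta> * lam n) * ((1 + z) / (1 - z))))) \<le> norm (c n)"
        unfolding norm_mult by (rule mult_left_le) simp
    qed
  qed
  have f0: "f 0 = q0"
    unfolding f_def q0_def by (simp flip: exp_of_real)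
  have lim: "AE t in unif01. ((\<lambda>r. f (of_real r * cis (2 * pi * t))) \<longlongrightarrow> g t) (at_left (1::real))"
    using AE_unif01
  proof eventually_elim
    fix s :: real assume s: "s \<in> {0<..<1}"
    note cc = cayley_circle[OF s]
    have "((\<lambda>r. f (of_real r * cis (2 * pi * s))) \<longlongrightarrow> f (of_real 1 * cis (2 * pi * s))) (at_left (1::real))"
      unfolding f_def by (intro tendsto_intros) (use cc(2) in auto)
    also have "f (of_real 1 * cis (2 * pi * s)) = g s"
      unfolding f_def g_def q_def of_real_1 mult_1 cc(1) by (simp add: mult_ac)
    finally show "((\<lambda>r. f (of_real r * cis (2 * pi * s))) \<longlongrightarrow> g s) (at_left (1::real))" .
  qed
  note H = H1_gap_radial[OF hol \<eta> bd g_meas lim, unfolded f0]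
  show "(\<integral>t. q t \<partial>poisson \<delta>) = q0"
    unfolding poisson_def by (subst integral_distr) (use H(1) in \<open>auto simp: g_def\<close>)
  have "M = (\<integral>t. norm (g t) \<partial>unif01)"
    unfolding M_def poisson_def by (subst integral_distr) (auto simp: g_def)
  moreover have "(\<integral>t. norm (q t - q0) \<partial>poisson \<delta>) = (\<integral>t. norm (g t - q0) \<partial>unif01)"
    unfolding poisson_def by (subst integral_distr) (auto simp: g_def)
  ultimately show "(\<integral>t. norm (q t - q0) \<partial>poisson \<delta>) \<le> \<eta> * M + (M - norm q0) / \<eta>"
    using H(2) by simp
qed

text \<open>For \<open>x \<ge> 0\<close> this is the mean value property of a single exponential; for \<open>x < 0\<close> conjugate.\<close>
lemma poisson_char:
  assumes \<delta>: "\<delta> > 0"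
  shows "(\<integral>t. exp (- (\<i> * of_real x * of_real t)) \<partial>poisson \<delta>) = of_real (exp (- \<delta> * \<bar>x\<bar>))"
proof -
  have pos: "(\<integral>t. exp (- (\<i> * of_real y * of_real t)) \<partial>poisson \<delta>) = of_real (exp (- \<delta> * y))"
    if "y \<ge> 0" for y
    using poisson_H1_gap(1)[OF \<delta>, of 1 "{0}" "\<lambda>_. y" "\<lambda>_. 1"] that by simp
  show ?thesis
  proof (cases "x \<ge> 0")
    case False
    have "(\<integral>t. exp (- (\<i> * of_real x * of_real t)) \<partial>poisson \<delta>) = (\<integral>t. cnj (exp (- (\<i> * of_real (-x) * of_real t))) \<partial>poisson \<delta>)"
      by (simp add: exp_cnj)
    also have "\<dots> = cnj (\<integral>t. exp (- (\<i> * of_real (-x) * of_real t)) \<partial>poisson \<delta>)"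
      by (rule Bochner_Integration.integral_cnj)
    also have "\<dots> = of_real (exp (- \<delta> * \<bar>x\<bar>))"
      using False by (subst pos) auto
    finally show ?thesis .
  qed (use pos in simp)
qed

section \<open>Bounds in the Lebesgue spaces\<close>

text \<open>A norm bound that treats all exponents alike. It obeys the triangle inequality only up to a
  factor 2, which is enough for boundedness and for convergence to zero.\<close>
definition Lp_le :: "ennreal \<Rightarrow> 'a measure \<Rightarrow> real \<Rightarrow> ('a \<Rightarrow> complex) \<Rightarrow> bool" where
  "Lp_le p M B f \<longleftrightarrow> 0 \<le> B \<and> f \<in> borel_measurable M \<and>
     (if p = \<infinity> then AE x in M. norm (f x) \<le> B
      else integrable M (\<lambda>x. norm (f x) powr enn2real p) \<and>
           (\<integral>x. norm (f x) powr enn2real p \<partial>M) \<le> B powr enn2real p)"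

lemma enn2real_ge_1: "1 \<le> enn2real p" if "1 \<le> p" "p \<noteq> \<infinity>"
proof -
  have "p < top" using that by (simp add: less_top infinity_ennreal_def)
  then have "enn2real 1 \<le> enn2real p" using that(1) by (intro enn2real_mono) auto
  then show ?thesis by simp
qed

lemma Lp_leD: "Lp_le p M B f \<Longrightarrow> f \<in> borel_measurable M" "Lp_le p M B f \<Longrightarrow> 0 \<le> B"
  by (auto simp: Lp_le_def)

lemma Lp_le_AE_cong:
  assumes "Lp_le p M B f" "g \<in> borel_measurable M" "AE x in M. f x = g x"
  shows "Lp_le p M B g"
proof -
  have [measurable]: "f \<in> borel_measurable M" "g \<in> borel_measurable M" using assms by (auto simp: Lp_le_def)
  have "AE x in M. norm (f x) powr enn2real p = norm (g x) powr enn2real p"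
    using assms(3) by eventually_elim simp
  then have "integrable M (\<lambda>x. norm (f x) powr enn2real p) = integrable M (\<lambda>x. norm (g x) powr enn2real p)"
      "(\<integral>x. norm (f x) powr enn2real p \<partial>M) = (\<integral>x. norm (g x) powr enn2real p \<partial>M)"
    by (intro integrable_cong_AE integral_cong_AE; simp)+
  moreover have "AE x in M. norm (g x) \<le> B" if "AE x in M. norm (f x) \<le> B"
    using that assms(3) by eventually_elim simp
  ultimately show ?thesis
    using assms by (auto simp: Lp_le_def)
qed

lemma Lp_le_scale:
  assumes "Lp_le p M B f" "norm c \<le> C"
  shows "Lp_le p M (C * B) (\<lambda>x. c * f x)"
proof -
  have C: "0 \<le> C" using assms(2) norm_ge_zero order_trans by blast
  have B: "0 \<le> B" and [measurable]: "f \<in> borel_measurable M" using assms by (auto simp: Lp_le_def)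
  show ?thesis
  proof (cases "p = \<infinity>")
    case True
    have "AE x in M. norm (f x) \<le> B" using assms True by (auto simp: Lp_le_def)
    then have "AE x in M. norm (c * f x) \<le> C * B"
      by eventually_elim (use assms(2) C in \<open>auto simp: norm_mult intro: mult_mono\<close>)
    then show ?thesis using True B C by (auto simp: Lp_le_def)
  next
    case False
    let ?q = "enn2real p"
    have eq: "norm (c * f x) powr ?q = norm c powr ?q * norm (f x) powr ?q" for x
      by (simp add: norm_mult powr_mult)
    have "norm c powr ?q * (\<integral>x. norm (f x) powr ?q \<partial>M) \<le> C powr ?q * B powr ?q"
      by (rule mult_mono) (use assms False in \<open>auto simp: Lp_le_def intro!: powr_mono2\<close>)
    then show ?thesis
      using assms False B C unfolding Lp_le_def eq by (auto simp: powr_mult)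
  qed
qed

lemma powr_add_le:
  fixes a b q :: real
  assumes "0 \<le> a" "0 \<le> b" "0 \<le> q"
  shows "(a + b) powr q \<le> 2 powr q * (a powr q + b powr q)"
proof -
  have "(a + b) powr q \<le> (2 * max a b) powr q" using assms by (intro powr_mono2) auto
  also have "\<dots> = 2 powr q * max a b powr q" using assms by (simp add: powr_mult)
  also have "\<dots> \<le> 2 powr q * (a powr q + b powr q)" by (intro mult_left_mono) (auto simp: max_def)
  finally show ?thesis .
qed

lemma powr_add_ge:
  fixes a b q :: real
  assumes "0 \<le> a" "0 \<le> b" "1 \<le> q"
  shows "a powr q + b powr q \<le> (a + b) powr q"
proof (cases "a + b = 0")
  case True
  then have "a = 0" "b = 0" using assms by linarith+
  then show ?thesis by simp
next
  case False
  then have s: "a + b > 0" using assms by auto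
  have *: "c powr q \<le> c * (a + b) powr (q - 1)" if "0 \<le> c" "c \<le> a + b" for c
  proof (cases "c = 0")
    case False
    have "c powr q = c * c powr (q - 1)" using that False by (simp add: powr_diff)
    also have "\<dots> \<le> c * (a + b) powr (q - 1)" using that assms by (intro mult_left_mono powr_mono2) auto
    finally show ?thesis .
  qed simp
  have "a powr q + b powr q \<le> a * (a + b) powr (q - 1) + b * (a + b) powr (q - 1)"
    by (intro add_mono *) (use assms in auto)
  also have "\<dots> = (a + b) * (a + b) powr (q - 1)" by (simp add: distrib_right)
  also have "\<dots> = (a + b) powr q" using powr_mult_base[of "a + b" "q - 1"] s by simp
  finally show ?thesis .
qed

lemma Lp_le_add:
  assumes f: "Lp_le p M A f" and g: "Lp_le p M B g" and p: "1 \<le> p"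
  shows "Lp_le p M (2 * (A + B)) (\<lambda>x. f x + g x)"
proof -
  have AB: "0 \<le> A" "0 \<le> B" and [measurable]: "f \<in> borel_measurable M" "g \<in> borel_measurable M"
    using assms by (auto simp: Lp_le_def)
  show ?thesis
  proof (cases "p = \<infinity>")
    case True
    have "AE x in M. norm (f x) \<le> A" "AE x in M. norm (g x) \<le> B" using assms True by (auto simp: Lp_le_def)
    then have "AE x in M. norm (f x + g x) \<le> 2 * (A + B)"
      by eventually_elim (use AB in \<open>auto intro: norm_triangle_mono order_trans[OF norm_triangle_ineq]\<close>)
    then show ?thesis using True AB by (auto simp: Lp_le_def)
  next
    case False
    let ?q = "enn2real p"
    have q: "1 \<le> ?q" using enn2real_ge_1[OF p False] .
    have i: "integrable M (\<lambda>x. norm (f x) powr ?q)" "integrable M (\<lambda>x. norm (g x) powr ?q)"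
      "(\<integral>x. norm (f x) powr ?q \<partial>M) \<le> A powr ?q" "(\<integral>x. norm (g x) powr ?q \<partial>M) \<le> B powr ?q"
      using assms False by (auto simp: Lp_le_def)
    have pt: "norm (f x + g x) powr ?q \<le> 2 powr ?q * (norm (f x) powr ?q + norm (g x) powr ?q)" for x
      using order_trans[OF powr_mono2[OF _ _ norm_triangle_ineq[of "f x" "g x"], of ?q] powr_add_le] q by simp
    have int: "integrable M (\<lambda>x. norm (f x + g x) powr ?q)"
      by (rule Bochner_Integration.integrable_bound[of M "\<lambda>x. 2 powr ?q * (norm (f x) powr ?q + norm (g x) powr ?q)"])
         (use i pt in auto)
    have "(\<integral>x. norm (f x + g x) powr ?q \<partial>M) \<le> (\<integral>x. 2 powr ?q * (norm (f x) powr ?q + norm (g x) powr ?q) \<partial>M)"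
      by (rule integral_mono[OF int]) (use i pt in auto)
    also have "\<dots> \<le> 2 powr ?q * (A powr ?q + B powr ?q)"
      using i by (simp add: add_mono)
    also have "\<dots> \<le> 2 powr ?q * (A + B) powr ?q"
      using powr_add_ge[OF AB q] by simp
    also have "\<dots> = (2 * (A + B)) powr ?q"
      using AB by (simp add: powr_mult del: distrib_left_numeral)
    finally show ?thesis using False AB int by (auto simp: Lp_le_def)
  qed
qed

context prob_space
begin

lemma Lp_le_bounded:
  assumes "f \<in> borel_measurable M" "\<And>x. x \<in> space M \<Longrightarrow> norm (f x) \<le> B"
  shows "Lp_le p M B f"
proof -
  have B: "0 \<le> B" using assms(2) not_empty norm_ge_zero order_trans by blast
  have [measurable]: "f \<in> borel_measurable M" by fact
  have pt: "norm (f x) powr enn2real p \<le> B powr enn2real p" if "x \<in> space M" for x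
    using assms(2)[OF that] by (intro powr_mono2) auto
  have int: "integrable M (\<lambda>x. norm (f x) powr enn2real p)"
    by (rule integrable_const_bound[of _ "B powr enn2real p"]) (use pt in auto)
  have "(\<integral>x. norm (f x) powr enn2real p \<partial>M) \<le> (\<integral>x. B powr enn2real p \<partial>M)"
    by (rule integral_mono[OF int]) (use pt in auto)
  then show ?thesis
    using B int assms by (auto simp: Lp_le_def prob_space)
qed

lemma Lp_le_integrable:
  assumes f: "Lp_le p M B f" and p: "1 \<le> p"
  shows "integrable M f" "(\<integral>x. norm (f x) \<partial>M) \<le> 1 + B + B powr enn2real p"
proof -
  have B: "0 \<le> B" and [measurable]: "f \<in> borel_measurable M" using f by (auto simp: Lp_le_def)
  have "integrable M f \<and> (\<integral>x. norm (f x) \<partial>M) \<le> 1 + B + B powr enn2real p"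
  proof (cases "p = \<infinity>")
    case True
    then have ae: "AE x in M. norm (f x) \<le> B" using f by (auto simp: Lp_le_def)
    then have int: "integrable M f" by (intro integrable_const_bound[of _ B]) auto
    have "(\<integral>x. norm (f x) \<partial>M) \<le> (\<integral>x. B \<partial>M)"
      by (rule integral_mono_AE) (use int ae in auto)
    then show ?thesis using int True by (simp add: prob_space)
  next
    case False
    let ?q = "enn2real p"
    have i: "integrable M (\<lambda>x. norm (f x) powr ?q)" "(\<integral>x. norm (f x) powr ?q \<partial>M) \<le> B powr ?q"
      using f False by (auto simp: Lp_le_def)
    have pt: "norm (f x) \<le> 1 + norm (f x) powr ?q" for x
    proof (cases "norm (f x) \<le> 1")
      case False
      then have "norm (f x) powr 1 \<le> norm (f x) powr ?q"
        using enn2real_ge_1[OF p \<open>p \<noteq> \<infinity>\<close>] by (intro powr_mono) auto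
      then show ?thesis by simp
    qed (auto intro: order_trans)
    have int: "integrable M f"
      by (rule Bochner_Integration.integrable_bound[of M "\<lambda>x. 1 + norm (f x) powr ?q"]) (use i pt in auto)
    have "(\<integral>x. norm (f x) \<partial>M) \<le> (\<integral>x. 1 + norm (f x) powr ?q \<partial>M)"
      by (rule integral_mono) (use int i pt in auto)
    also have "\<dots> \<le> 1 + B powr ?q" using i by (simp add: prob_space)
    finally show ?thesis using int B by simp
  qed
  then show "integrable M f" "(\<integral>x. norm (f x) \<partial>M) \<le> 1 + B + B powr enn2real p" by auto
qed

text \<open>Fatou's lemma along a subsequence that converges almost everywhere.\<close>
lemma Lp_le_L1_limit:
  assumes p: "1 \<le> p" and f: "\<And>k. Lp_le p M B (f k)" and fi: "\<And>k. integrable M (f k)" and g: "integrable M g"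
    and lim: "(\<lambda>k. \<integral>x. norm (f k x - g x) \<partial>M) \<longlonglongrightarrow> 0"
  shows "Lp_le p M B g"
proof -
  have B: "0 \<le> B" using f Lp_leD by blast
  have [measurable]: "f k \<in> borel_measurable M" "g \<in> borel_measurable M" for k using fi g by auto
  obtain r where r: "strict_mono (r :: nat \<Rightarrow> nat)" "AE x in M. (\<lambda>n. f (r n) x - g x) \<longlonglongrightarrow> 0"
    using tendsto_L1_AE_subseq[of M "\<lambda>k x. f k x - g x"] fi g lim by auto
  have conv: "AE x in M. (\<lambda>n. norm (f (r n) x)) \<longlonglongrightarrow> norm (g x)"
    using r(2) by eventually_elim (rule tendsto_norm, erule LIM_zero_cancel)
  show ?thesis
  proof (cases "p = \<infinity>")
    case True
    have "AE x in M. \<forall>n. norm (f n x) \<le> B" using f True by (auto simp: Lp_le_def AE_all_countable)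
    with conv have "AE x in M. norm (g x) \<le> B"
      by eventually_elim (rule LIMSEQ_le_const2, auto)
    then show ?thesis using True B by (auto simp: Lp_le_def)
  next
    case False
    let ?q = "enn2real p"
    have i: "integrable M (\<lambda>x. norm (f k x) powr ?q)" "(\<integral>x. norm (f k x) powr ?q \<partial>M) \<le> B powr ?q" for k
      using f False by (auto simp: Lp_le_def)
    have nn: "(\<integral>\<^sup>+ x. ennreal (norm (f k x) powr ?q) \<partial>M) \<le> ennreal (B powr ?q)" for k
      using i[of k] by (subst nn_integral_eq_integral) (auto intro: ennreal_leI)
    have q: "?q \<noteq> 0" using enn2real_ge_1[OF p False] by simp
      have "AE x in M. (\<lambda>n. ennreal (norm (f (r n) x) powr ?q)) \<longlonglongrightarrow> ennreal (norm (g x) powr ?q)"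
        using conv
      proof eventually_elim
        case (elim x)
        have "(\<lambda>n. norm (f (r n) x) powr ?q) \<longlonglongrightarrow> norm (g x) powr ?q"
          by (rule tendsto_powr'[OF elim tendsto_const]) (use q in \<open>auto simp: less_le\<close>)
        then show ?case by (rule tendsto_ennrealI)
      qed
      then have "(\<integral>\<^sup>+ x. ennreal (norm (g x) powr ?q) \<partial>M) = (\<integral>\<^sup>+ x. liminf (\<lambda>n. ennreal (norm (f (r n) x) powr ?q)) \<partial>M)"
        by (intro nn_integral_cong_AE, eventually_elim) (rule lim_imp_Liminf[symmetric], simp_all)
      also have "\<dots> \<le> liminf (\<lambda>n. \<integral>\<^sup>+ x. ennreal (norm (f (r n) x) powr ?q) \<partial>M)"
        by (rule nn_integral_liminf) auto
      also have "\<dots> \<le> liminf (\<lambda>n. ennreal (B powr ?q))"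
        by (intro Liminf_mono always_eventually allI nn)
      also have "\<dots> = ennreal (B powr ?q)" by (simp add: Liminf_const)
      finally have nn: "(\<integral>\<^sup>+ x. ennreal (norm (g x) powr ?q) \<partial>M) \<le> ennreal (B powr ?q)" .
      then have int: "integrable M (\<lambda>x. norm (g x) powr ?q)"
        by (intro integrableI_bounded) (auto intro: le_less_trans)
      then have "(\<integral>x. norm (g x) powr ?q \<partial>M) \<le> B powr ?q"
        using nn by (subst (asm) nn_integral_eq_integral) (auto simp: ennreal_le_iff)
      then show ?thesis using False B int by (auto simp: Lp_le_def)
  qed
qed

end

lemma Lp_le_imp_in_Lp:
  assumes "Lp_le p M B f"
  shows "in_Lp p M f"
proof (cases "p = \<infinity>")
  case True
  have [measurable]: "f \<in> borel_measurable M" and ae: "AE x in M. norm (f x) \<le> B"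
    using assms True by (auto simp: Lp_le_def)
  have "esssup M (\<lambda>x. ennreal (norm (f x))) \<le> ennreal B"
    by (rule esssup_I) (use ae in \<open>auto elim!: eventually_mono intro: ennreal_leI\<close>)
  then show ?thesis using True by (auto simp: in_Lp_def intro: le_less_trans)
qed (use assms in \<open>auto simp: Lp_le_def in_Lp_def\<close>)

lemma Lp_le_imp_Lp_norm_le:
  assumes "Lp_le p M B f" "1 \<le> p"
  shows "Lp_norm p M f \<le> B"
proof (cases "p = \<infinity>")
  case True
  have B: "0 \<le> B" and [measurable]: "f \<in> borel_measurable M" and ae: "AE x in M. norm (f x) \<le> B"
    using assms True by (auto simp: Lp_le_def)
  have "esssup M (\<lambda>x. ennreal (norm (f x))) \<le> ennreal B"
    by (rule esssup_I) (use ae in \<open>auto elim!: eventually_mono intro: ennreal_leI\<close>)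
  then have "enn2real (esssup M (\<lambda>x. ennreal (norm (f x)))) \<le> enn2real (ennreal B)"
    by (rule enn2real_mono) simp
  then show ?thesis using True B by (simp add: Lp_norm_def)
next
  case False
  let ?q = "enn2real p"
  have q: "1 \<le> ?q" using enn2real_ge_1[OF assms(2) False] .
  have i: "0 \<le> B" "(\<integral>x. norm (f x) powr ?q \<partial>M) \<le> B powr ?q" using assms False by (auto simp: Lp_le_def)
  have "(\<integral>x. norm (f x) powr ?q \<partial>M) powr (1 / ?q) \<le> (B powr ?q) powr (1 / ?q)"
    by (rule powr_mono2) (use i q in auto)
  also have "\<dots> = B" using i q by (simp add: powr_powr)
  finally show ?thesis using False by (simp add: Lp_norm_def)
qed

lemma Lp_norm_nonneg: "0 \<le> Lp_norm p M f"
  by (simp add: Lp_norm_def)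

lemma in_Lp_imp_Lp_le:
  assumes "in_Lp p M f" "Lp_norm p M f \<le> C" "1 \<le> p"
  shows "Lp_le p M C f"
proof (cases "p = \<infinity>")
  case True
  have C: "0 \<le> C" using assms(2) Lp_norm_nonneg[of p M f] by linarith
  have [measurable]: "f \<in> borel_measurable M" and fin: "esssup M (\<lambda>x. ennreal (norm (f x))) < \<infinity>"
    using assms True by (auto simp: in_Lp_def)
  have "enn2real (esssup M (\<lambda>x. ennreal (norm (f x)))) \<le> C" using assms True by (simp add: Lp_norm_def)
  then have le: "esssup M (\<lambda>x. ennreal (norm (f x))) \<le> ennreal C"
    using fin by (metis ennreal_enn2real ennreal_leI infinity_ennreal_def)
  have "AE x in M. ennreal (norm (f x)) \<le> esssup M (\<lambda>x. ennreal (norm (f x)))"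
    by (rule esssup_AE)
  then have "AE x in M. norm (f x) \<le> C"
    by eventually_elim (use le C in \<open>metis ennreal_le_iff order_trans\<close>)
  then show ?thesis using True C by (simp add: Lp_le_def)
next
  case False
  let ?q = "enn2real p"
  have C: "0 \<le> C" using assms(2) Lp_norm_nonneg[of p M f] by linarith
  have q: "1 \<le> ?q" using enn2real_ge_1[OF assms(3) False] .
  have "(\<integral>x. norm (f x) powr ?q \<partial>M) powr (1 / ?q) \<le> C" using assms False by (simp add: Lp_norm_def)
  then have "((\<integral>x. norm (f x) powr ?q \<partial>M) powr (1 / ?q)) powr ?q \<le> C powr ?q"
    using q by (intro powr_mono2) auto
  then have "(\<integral>x. norm (f x) powr ?q \<partial>M) \<le> C powr ?q"
    using q by (simp add: powr_powr)
  then show ?thesis using False C assms by (simp add: Lp_le_def in_Lp_def)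
qed

section \<open>Averages along the flow\<close>

text \<open>A countable base of one factor suffices: an open set is the union over the sets \<open>b\<close> of that base
  of the rectangles \<open>V b \<times> b\<close>. This makes Fubini's theorem available on \<open>G \<times> \<real>\<close> although \<open>G\<close> need not be
  metrizable.\<close>
lemma open_prod_in_sets:
  fixes W :: "('a::topological_space \<times> 'b::second_countable_topology) set"
  assumes "open W"
  shows "W \<in> sets (borel \<Otimes>\<^sub>M borel)"
proof -
  obtain B :: "'b set set" where B: "countable B" "topological_basis B"
    using ex_countable_basis by blast
  define V where "V b = \<Union>{U. open U \<and> U \<times> b \<subseteq> W}" for b
  have "W = (\<Union>b\<in>B. V b \<times> b)"
  proof (intro subset_antisym subsetI)
    fix z assume z: "z \<in> W"
    obtain S T where ST: "open S" "open T" "fst z \<in> S" "snd z \<in> T" "S \<times> T \<subseteq> W"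
      using open_prod_elim[OF assms z] by (metis mem_Times_iff)
    obtain b where b: "b \<in> B" "snd z \<in> b" "b \<subseteq> T"
      using topological_basisE[OF B(2) ST(2,4)] by metis
    have "S \<subseteq> V b" unfolding V_def using ST b by blast
    then show "z \<in> (\<Union>b\<in>B. V b \<times> b)" using ST b by (force simp: mem_Times_iff)
  next
    fix z assume "z \<in> (\<Union>b\<in>B. V b \<times> b)"
    then show "z \<in> W" unfolding V_def by (auto; blast)
  qed
  moreover have "V b \<times> b \<in> sets (borel \<Otimes>\<^sub>M borel)" if "b \<in> B" for b
  proof (rule pair_measureI)
    show "V b \<in> sets borel" unfolding V_def by (intro borel_open open_Union) auto
    show "b \<in> sets borel" using B(2) that by (intro borel_open topological_basis_open)
  qed
  ultimately show ?thesis using sets.countable_UN''[OF B(1), of "\<lambda>b. V b \<times> b"] by simp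
qed

lemma borel_measurable_pair_continuous:
  fixes f :: "('a::topological_space \<times> 'b::second_countable_topology) \<Rightarrow> 'c::topological_space"
  assumes "continuous_on UNIV f"
  shows "f \<in> measurable (borel \<Otimes>\<^sub>M borel) borel"
proof (rule borel_measurableI)
  fix S :: "'c set" assume "open S"
  then have "open (f -` S)" using assms by (simp add: continuous_on_open_vimage)
  then show "f -` S \<inter> space (borel \<Otimes>\<^sub>M borel) \<in> sets (borel \<Otimes>\<^sub>M borel)"
    using open_prod_in_sets[of "f -` S"] by (simp add: space_pair_measure)
qed

lemma convex_on_abs_powr:
  assumes q: "1 \<le> q"
  shows "convex_on UNIV (\<lambda>x::real. \<bar>x\<bar> powr q)"
proof (rule convex_onI)
  fix t x y :: real assume t: "0 < t" "t < 1"
  have small: "(s * c) powr q \<le> s * c powr q" if "0 < s" "s < 1" "0 \<le> c" for s c :: real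
  proof -
    have "s powr q \<le> s powr 1" using that q by (intro powr_mono') auto
    then show ?thesis using that by (simp add: powr_mult mult_right_mono)
  qed
  have *: "((1 - t) * a + t * b) powr q \<le> (1 - t) * a powr q + t * b powr q" if "0 \<le> a" "0 \<le> b" for a b
  proof (cases "a = 0 \<or> b = 0")
    case True
    then show ?thesis using small[of t b] small[of "1 - t" a] t that by auto
  next
    case False
    then show ?thesis
      using convex_onD[OF powr_convex[OF q], of t a b] t that by auto
  qed
  have "\<bar>(1 - t) *\<^sub>R x + t *\<^sub>R y\<bar> powr q \<le> ((1 - t) * \<bar>x\<bar> + t * \<bar>y\<bar>) powr q"
    by (rule powr_mono2) (use t q in \<open>auto simp: abs_mult intro: order_trans[OF abs_triangle_ineq]\<close>)
  also have "\<dots> \<le> (1 - t) * \<bar>x\<bar> powr q + t * \<bar>y\<bar> powr q"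
    by (rule *) auto
  finally show "\<bar>(1 - t) *\<^sub>R x + t *\<^sub>R y\<bar> powr q \<le> (1 - t) * \<bar>x\<bar> powr q + t * \<bar>y\<bar> powr q" .
qed simp

locale haar_flow =
  fixes \<beta> :: "real \<Rightarrow> 'g::{topological_ab_group_add, t2_space}" and m :: "'g measure"
  assumes dirichlet: "dirichlet_group \<beta>" and haar: "normalized_haar m"
begin

lemma sets_m [simp, measurable_cong]: "sets m = sets borel"
  using haar by (simp add: normalized_haar_def)

lemma space_m [simp]: "space m = UNIV"
  using sets_eq_imp_space_eq[OF sets_m] by simp

sublocale prob_space m
  using haar by (simp add: normalized_haar_def)

lemma measure_m_UNIV [simp]: "measure m UNIV = 1"
  using prob_space by simp

lemma compact_UNIV: "compact (UNIV :: 'g set)"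
  and cont_\<beta>: "continuous_on UNIV \<beta>"
  and \<beta>_add: "\<beta> (s + t) = \<beta> s + \<beta> t"
  and dense: "closure (range \<beta>) = UNIV"
  using dirichlet by (auto simp: dirichlet_group_def)

lemma \<beta>_0 [simp]: "\<beta> 0 = 0"
  using \<beta>_add[of 0 0] by simp

lemma \<beta>_minus: "\<beta> (- t) = - \<beta> t"
  using \<beta>_add[of t "-t"] by (simp add: eq_neg_iff_add_eq_0 add.commute)

lemma \<beta>_diff: "\<beta> (s - t) = \<beta> s - \<beta> t"
  using \<beta>_add[of s "-t"] by (simp add: \<beta>_minus)

lemma measurable_translate [measurable]: "(\<lambda>x. x + y) \<in> measurable borel (borel :: 'g measure)"
  by (intro borel_measurable_continuous_onI continuous_intros)

lemma emeasure_translate: "A \<in> sets borel \<Longrightarrow> emeasure m ((+) x ` A) = emeasure m A"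
  using haar unfolding normalized_haar_def by blast

lemma distr_translate: "distr m borel (\<lambda>x. x + y) = m"
proof (rule measure_eqI)
  fix A assume "A \<in> sets (distr m borel (\<lambda>x. x + y))"
  then have A: "A \<in> sets borel" by simp
  have "(\<lambda>x. x + y) -` A = (+) (- y) ` A"
    by (auto simp: image_iff intro!: bexI[of _ "_ + y"])
  then show "emeasure (distr m borel (\<lambda>x. x + y)) A = emeasure m A"
    using emeasure_translate[OF A, of "- y"] A by (subst emeasure_distr) simp_all
qed simp

lemma integral_translate:
  fixes f :: "'g \<Rightarrow> 'b::{banach, second_countable_topology}"
  assumes "f \<in> borel_measurable borel"
  shows "(\<integral>x. f (x + y) \<partial>m) = (\<integral>x. f x \<partial>m)"
  using integral_distr[of "\<lambda>x. x + y" m borel f] assms by (simp add: distr_translate)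

lemma measurable_flow [measurable]: "(\<lambda>(x, t). x + \<beta> t) \<in> measurable (borel \<Otimes>\<^sub>M borel) borel"
proof -
  have "continuous_on UNIV (\<lambda>z::'g \<times> real. fst z + \<beta> (snd z))"
    by (intro continuous_intros continuous_on_compose2[OF cont_\<beta>]) auto
  then show ?thesis
    using borel_measurable_pair_continuous by (auto simp: case_prod_beta')
qed

lemma continuous_integrable:
  fixes f :: "'g \<Rightarrow> 'b::{banach, second_countable_topology}"
  assumes "continuous_on UNIV f"
  shows "integrable m f"
proof -
  have "bounded (range f)" using compact_continuous_image[OF assms compact_UNIV] compact_imp_bounded by blast
  then obtain B where "\<And>x. norm (f x) \<le> B" unfolding bounded_iff by auto
  moreover have "f \<in> borel_measurable borel" using assms by (rule borel_measurable_continuous_onI)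
  ultimately show ?thesis by (intro integrable_const_bound[of _ B]) auto
qed

end

text \<open>A weighted average of translates along the flow. It acts on Fourier coefficients as a
  multiplier and does not increase norms if \<open>\<kappa>\<close> is a probability measure and \<open>\<bar>\<phi>\<bar> \<le> 1\<close>.\<close>
definition flow_avg :: "(real \<Rightarrow> 'g::{topological_ab_group_add, t2_space}) \<Rightarrow> real measure \<Rightarrow> (real \<Rightarrow> complex) \<Rightarrow> ('g \<Rightarrow> complex) \<Rightarrow> 'g \<Rightarrow> complex" where
  "flow_avg \<beta> \<kappa> \<phi> f x = (\<integral>t. \<phi> t * f (x + \<beta> t) \<partial>\<kappa>)"

locale flow_average = haar_flow \<beta> m + kappa: prob_space \<kappa>
  for \<beta> :: "real \<Rightarrow> 'g::{topological_ab_group_add, t2_space}" and m :: "'g measure" and \<kappa> :: "real measure" +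
  fixes \<phi> :: "real \<Rightarrow> complex"
  assumes sets_\<kappa> [simp, measurable_cong]: "sets \<kappa> = sets borel"
    and \<phi>_meas [measurable]: "\<phi> \<in> borel_measurable borel"
    and \<phi>_le: "norm (\<phi> t) \<le> 1"
begin

lemma space_\<kappa> [simp]: "space \<kappa> = UNIV"
  using sets_eq_imp_space_eq[OF sets_\<kappa>] by simp

sublocale pair: pair_prob_space m \<kappa> ..

text \<open>Invariance of Haar measure and Fubini's theorem. All integrability statements about
  \<open>(x, t) \<mapsto> f (x + \<beta> t)\<close> are read off from this identity of distributions.\<close>
lemma distr_flow: "distr (m \<Otimes>\<^sub>M \<kappa>) borel (\<lambda>(x, t). x + \<beta> t) = m"
proof (rule measure_eqI)
  fix A assume "A \<in> sets (distr (m \<Otimes>\<^sub>M \<kappa>) borel (\<lambda>(x, t). x + \<beta> t))"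
  then have A [measurable]: "A \<in> sets borel" by simp
  have V: "(\<lambda>(x, t). x + \<beta> t) -` A \<in> sets (m \<Otimes>\<^sub>M \<kappa>)"
    using measurable_sets[OF measurable_flow A] by (simp add: space_pair_measure cong: sets_pair_measure_cong)
  have "emeasure (distr (m \<Otimes>\<^sub>M \<kappa>) borel (\<lambda>(x, t). x + \<beta> t)) A = emeasure (m \<Otimes>\<^sub>M \<kappa>) ((\<lambda>(x, t). x + \<beta> t) -` A)"
    by (subst emeasure_distr) (auto simp: space_pair_measure)
  also have "\<dots> = (\<integral>\<^sup>+ t. emeasure m ((\<lambda>x. (x, t)) -` (\<lambda>(x, t). x + \<beta> t) -` A) \<partial>\<kappa>)"
    using V by (rule pair.emeasure_pair_measure_alt2)
  also have "\<dots> = (\<integral>\<^sup>+ t. emeasure m A \<partial>\<kappa>)"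
  proof (rule nn_integral_cong)
    fix t
    have "emeasure m A = emeasure (distr m borel (\<lambda>x. x + \<beta> t)) A" by (simp add: distr_translate)
    also have "\<dots> = emeasure m ((\<lambda>x. x + \<beta> t) -` A)" by (subst emeasure_distr) auto
    finally show "emeasure m ((\<lambda>x. (x, t)) -` (\<lambda>(x, t). x + \<beta> t) -` A) = emeasure m A"
      by (simp add: vimage_def)
  qed
  also have "\<dots> = emeasure m A" by (simp add: kappa.emeasure_space_1[simplified])
  finally show "emeasure (distr (m \<Otimes>\<^sub>M \<kappa>) borel (\<lambda>(x, t). x + \<beta> t)) A = emeasure m A" .
qed simp

lemma integrable_flow:
  fixes f :: "'g \<Rightarrow> 'b::{banach, second_countable_topology}"
  assumes "integrable m f"
  shows "integrable (m \<Otimes>\<^sub>M \<kappa>) (\<lambda>(x, t). f (x + \<beta> t))"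
    and "(\<integral>x. (\<integral>t. f (x + \<beta> t) \<partial>\<kappa>) \<partial>m) = (\<integral>x. f x \<partial>m)"
proof -
  have [measurable]: "f \<in> borel_measurable borel" using assms by auto
  show i: "integrable (m \<Otimes>\<^sub>M \<kappa>) (\<lambda>(x, t). f (x + \<beta> t))"
    using integrable_distr_eq[of "\<lambda>(x, t). x + \<beta> t" "m \<Otimes>\<^sub>M \<kappa>" borel f] assms
    unfolding distr_flow by (simp add: case_prod_beta')
  have "(\<integral>x. (\<integral>t. f (x + \<beta> t) \<partial>\<kappa>) \<partial>m) = (\<integral>z. f (fst z + \<beta> (snd z)) \<partial>(m \<Otimes>\<^sub>M \<kappa>))"
    using pair.integral_fst'[OF i] by (simp add: case_prod_beta')
  also have "\<dots> = (\<integral>x. f x \<partial>m)"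
    using integral_distr[of "\<lambda>(x, t). x + \<beta> t" "m \<Otimes>\<^sub>M \<kappa>" borel f] unfolding distr_flow by (simp add: case_prod_beta')
  finally show "(\<integral>x. (\<integral>t. f (x + \<beta> t) \<partial>\<kappa>) \<partial>m) = (\<integral>x. f x \<partial>m)" .
qed

lemma integrable_flow_phi:
  fixes f :: "'g \<Rightarrow> complex"
  assumes "integrable m f"
  shows "integrable (m \<Otimes>\<^sub>M \<kappa>) (\<lambda>(x, t). \<phi> t * f (x + \<beta> t))"
proof (rule Bochner_Integration.integrable_bound[OF integrable_flow(1)[OF assms]])
  have [measurable]: "f \<in> borel_measurable borel" using assms by auto
  show "(\<lambda>(x, t). \<phi> t * f (x + \<beta> t)) \<in> borel_measurable (m \<Otimes>\<^sub>M \<kappa>)" by measurable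
  show "AE z in m \<Otimes>\<^sub>M \<kappa>. norm (case z of (x, t) \<Rightarrow> \<phi> t * f (x + \<beta> t)) \<le> norm (case z of (x, t) \<Rightarrow> f (x + \<beta> t))"
    using \<phi>_le by (intro AE_I2) (auto simp: norm_mult mult_left_le_one_le)
qed

abbreviation avg where "avg \<equiv> flow_avg \<beta> \<kappa> \<phi>"

lemma integrable_avg: "integrable m f \<Longrightarrow> integrable m (avg f)"
  using pair.integrable_fst'[OF integrable_flow_phi] unfolding flow_avg_def[abs_def] by simp

lemma AE_integrable_flow:
  fixes f :: "'g \<Rightarrow> 'b::{banach, second_countable_topology}"
  shows "integrable m f \<Longrightarrow> AE x in m. integrable \<kappa> (\<lambda>t. f (x + \<beta> t))"
  using pair.AE_integrable_fst'[OF integrable_flow(1)] by simp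

lemma norm_avg_le:
  assumes "integrable \<kappa> (\<lambda>t. f (x + \<beta> t))"
  shows "norm (avg f x) \<le> (\<integral>t. norm (f (x + \<beta> t)) \<partial>\<kappa>)"
proof (cases "integrable \<kappa> (\<lambda>t. \<phi> t * f (x + \<beta> t))")
  case True
  then show ?thesis
    unfolding flow_avg_def
    by (intro order_trans[OF integral_norm_bound] integral_mono integrable_norm)
       (use assms \<phi>_le in \<open>auto simp: norm_mult mult_left_le_one_le\<close>)
qed (simp add: flow_avg_def not_integrable_integral_eq)

lemma avg_L1:
  assumes "integrable m f"
  shows "(\<integral>x. norm (avg f x) \<partial>m) \<le> (\<integral>x. norm (f x) \<partial>m)"
proof -
  have n: "integrable m (\<lambda>x. norm (f x))" using assms by simp
  have "(\<integral>x. norm (avg f x) \<partial>m) \<le> (\<integral>x. (\<integral>t. norm (f (x + \<beta> t)) \<partial>\<kappa>) \<partial>m)"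
  proof (rule integral_mono_AE)
    show "integrable m (\<lambda>x. \<integral>t. norm (f (x + \<beta> t)) \<partial>\<kappa>)"
      using pair.integrable_fst'[OF integrable_flow(1)[OF n]] by simp
    show "AE x in m. norm (avg f x) \<le> (\<integral>t. norm (f (x + \<beta> t)) \<partial>\<kappa>)"
      using AE_integrable_flow[OF assms] by eventually_elim (rule norm_avg_le)
  qed (use integrable_avg[OF assms] in simp)
  also have "\<dots> = (\<integral>x. norm (f x) \<partial>m)" by (rule integrable_flow(2)[OF n])
  finally show ?thesis .
qed

lemma avg_diff:
  assumes "integrable m f" "integrable m g"
  shows "AE x in m. avg (\<lambda>x. f x - g x) x = avg f x - avg g x"
  using AE_integrable_flow[OF assms(1)] AE_integrable_flow[OF assms(2)]
proof eventually_elim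
  case (elim x)
  have i: "integrable \<kappa> (\<lambda>t. \<phi> t * h (x + \<beta> t))" if "integrable \<kappa> (\<lambda>t. h (x + \<beta> t))" for h
    by (rule Bochner_Integration.integrable_bound[OF that]) (use \<phi>_le that in \<open>auto simp: norm_mult mult_left_le_one_le\<close>)
  show ?case
    unfolding flow_avg_def using i[OF elim(1)] i[OF elim(2)] by (simp add: right_diff_distrib)
qed

text \<open>Jensen's inequality for \<open>\<kappa>\<close> and the invariance of Haar measure.\<close>
lemma avg_Lp:
  assumes f: "Lp_le p m B f" and p: "1 \<le> p"
  shows "Lp_le p m B (avg f)"
proof -
  have B: "0 \<le> B" using Lp_leD[OF f] by simp
  have fi: "integrable m f" by (rule Lp_le_integrable[OF f p])
  have am: "avg f \<in> borel_measurable m" using integrable_avg[OF fi] by simp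
  have [measurable]: "f \<in> borel_measurable borel" using fi by auto
  show ?thesis
  proof (cases "p = \<infinity>")
    case True
    have ae: "AE x in m. norm (f x) \<le> B" using f True by (simp add: Lp_le_def)
    then have "AE x in distr (m \<Otimes>\<^sub>M \<kappa>) borel (\<lambda>(x, t). x + \<beta> t). norm (f x) \<le> B" unfolding distr_flow .
    then have "AE z in m \<Otimes>\<^sub>M \<kappa>. norm (f (case z of (x, t) \<Rightarrow> x + \<beta> t)) \<le> B"
      by (subst (asm) AE_distr_iff) auto
    then have "AE x in m. AE t in \<kappa>. norm (f (x + \<beta> t)) \<le> B"
      by (auto dest!: pair.AE_pair)
    then have "AE x in m. norm (avg f x) \<le> B"
      using AE_integrable_flow[OF fi]
    proof eventually_elim
      case (elim x)
      have "norm (avg f x) \<le> (\<integral>t. norm (f (x + \<beta> t)) \<partial>\<kappa>)" by (rule norm_avg_le[OF elim(2)])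
      also have "\<dots> \<le> (\<integral>t. B \<partial>\<kappa>)" by (rule integral_mono_AE) (use elim in auto)
      also have "\<dots> = B" using kappa.prob_space by simp
      finally show ?case .
    qed
    then show ?thesis using True B am by (simp add: Lp_le_def)
  next
    case False
    let ?q = "enn2real p"
    have q: "1 \<le> ?q" using enn2real_ge_1[OF p False] .
    have i: "integrable m (\<lambda>x. norm (f x) powr ?q)" "(\<integral>x. norm (f x) powr ?q \<partial>m) \<le> B powr ?q"
      using f False by (auto simp: Lp_le_def)
    have i2: "integrable m (\<lambda>x. \<integral>t. norm (f (x + \<beta> t)) powr ?q \<partial>\<kappa>)"
      using pair.integrable_fst'[OF integrable_flow(1)[OF i(1)]] by simp
    have ae: "AE x in m. norm (avg f x) powr ?q \<le> (\<integral>t. norm (f (x + \<beta> t)) powr ?q \<partial>\<kappa>)"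
      using AE_integrable_flow[OF fi] AE_integrable_flow[OF i(1)]
    proof eventually_elim
      case (elim x)
      have "norm (avg f x) powr ?q \<le> (\<integral>t. norm (f (x + \<beta> t)) \<partial>\<kappa>) powr ?q"
        by (intro powr_mono2 norm_avg_le elim) (use q in auto)
      also have "\<dots> = \<bar>\<integral>t. norm (f (x + \<beta> t)) \<partial>\<kappa>\<bar> powr ?q"
        by simp
      also have "\<dots> \<le> (\<integral>t. \<bar>norm (f (x + \<beta> t))\<bar> powr ?q \<partial>\<kappa>)"
        by (rule kappa.jensens_inequality[where I = UNIV]) (use elim convex_on_abs_powr[OF q] in auto)
      finally show ?case by simp
    qed
    have i3: "integrable m (\<lambda>x. norm (avg f x) powr ?q)"
      by (rule Bochner_Integration.integrable_bound[OF i2]) (use am ae in \<open>auto elim!: eventually_mono\<close>)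
    have "(\<integral>x. norm (avg f x) powr ?q \<partial>m) \<le> (\<integral>x. (\<integral>t. norm (f (x + \<beta> t)) powr ?q \<partial>\<kappa>) \<partial>m)"
      by (rule integral_mono_AE[OF i3 i2 ae])
    also have "\<dots> = (\<integral>x. norm (f x) powr ?q \<partial>m)" by (rule integrable_flow(2)[OF i(1)])
    finally show ?thesis using False B am i3 i(2) by (simp add: Lp_le_def)
  qed
qed

end

lemma (in haar_flow) fourier_coeff_translate:
  assumes \<gamma>: "group_character \<gamma>" and f: "f \<in> borel_measurable borel"
  shows "(\<integral>x. f (x + y) * cnj (\<gamma> x) \<partial>m) = \<gamma> y * fourier_coeff m f \<gamma>"
proof -
  have c: "continuous_on UNIV \<gamma>" and n: "norm (\<gamma> z) = 1" and mul: "\<gamma> (x + z) = \<gamma> x * \<gamma> z" for x z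
    using \<gamma> by (auto simp: group_character_def)
  have [measurable]: "(\<lambda>x. cnj (\<gamma> x)) \<in> borel_measurable borel"
    by (intro borel_measurable_continuous_onI continuous_intros c)
  have 1: "\<gamma> y * cnj (\<gamma> y) = 1" using n[of y] by (simp flip: complex_norm_square)
  have "f (x + y) * cnj (\<gamma> x) = \<gamma> y * (f (x + y) * cnj (\<gamma> (x + y)))" for x
    unfolding mul using 1 by (simp add: algebra_simps)
  then have "(\<integral>x. f (x + y) * cnj (\<gamma> x) \<partial>m) = \<gamma> y * (\<integral>x. f (x + y) * cnj (\<gamma> (x + y)) \<partial>m)"
    by (simp only: integral_mult_right_zero)
  also have "(\<integral>x. f (x + y) * cnj (\<gamma> (x + y)) \<partial>m) = fourier_coeff m f \<gamma>"
    unfolding fourier_coeff_def by (rule integral_translate[of "\<lambda>x. f x * cnj (\<gamma> x)"]) (use f in measurable)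
  finally show ?thesis .
qed

lemma (in flow_average) fourier_coeff_avg:
  assumes f: "integrable m f" and \<gamma>: "group_character \<gamma>"
  shows "fourier_coeff m (avg f) \<gamma> = fourier_coeff m f \<gamma> * (\<integral>t. \<phi> t * \<gamma> (\<beta> t) \<partial>\<kappa>)"
proof -
  have c: "continuous_on UNIV \<gamma>" and n: "norm (\<gamma> z) = 1" for z
    using \<gamma> by (auto simp: group_character_def)
  have [measurable]: "(\<lambda>x. cnj (\<gamma> x)) \<in> borel_measurable borel"
    by (intro borel_measurable_continuous_onI continuous_intros c)
  have [measurable]: "f \<in> borel_measurable borel" using f by auto
  have i: "integrable (m \<Otimes>\<^sub>M \<kappa>) (\<lambda>(x, t). \<phi> t * f (x + \<beta> t) * cnj (\<gamma> x))"
    by (rule Bochner_Integration.integrable_bound[OF integrable_flow_phi[OF f]])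
       (auto simp: norm_mult n intro!: AE_I2)
  have "fourier_coeff m (avg f) \<gamma> = (\<integral>x. (\<integral>t. \<phi> t * f (x + \<beta> t) * cnj (\<gamma> x) \<partial>\<kappa>) \<partial>m)"
    unfolding fourier_coeff_def flow_avg_def by simp
  also have "\<dots> = (\<integral>t. (\<integral>x. \<phi> t * f (x + \<beta> t) * cnj (\<gamma> x) \<partial>m) \<partial>\<kappa>)"
    using pair.Fubini_integral[OF i] by simp
  also have "\<dots> = (\<integral>t. \<phi> t * \<gamma> (\<beta> t) * fourier_coeff m f \<gamma> \<partial>\<kappa>)"
    by (simp add: mult.assoc fourier_coeff_translate[OF \<gamma>])
  also have "\<dots> = fourier_coeff m f \<gamma> * (\<integral>t. \<phi> t * \<gamma> (\<beta> t) \<partial>\<kappa>)"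
    by (simp add: mult.commute)
  finally show ?thesis .
qed

section \<open>Integrals with a continuous parameter\<close>

context haar_flow
begin

text \<open>Compactness of the group makes continuity in the first variable uniform in the second.\<close>
lemma uniform_nhd:
  fixes F :: "('a::t2_space \<times> 'g) \<Rightarrow> complex"
  assumes "continuous_on UNIV F" "e > 0"
  obtains X where "x0 \<in> X" "open X" "\<And>x y. x \<in> X \<Longrightarrow> norm (F (x, y) - F (x0, y)) \<le> e"
proof -
  have "continuous_on (UNIV \<times> UNIV) F" using assms by simp
  from continuous_on_prod_compactE[OF this compact_UNIV UNIV_I assms(2), of x0]
  obtain X where "x0 \<in> X" "open X" "\<forall>x\<in>X \<inter> UNIV. \<forall>t\<in>UNIV. dist (F (x, t)) (F (x0, t)) \<le> e"
    by metis
  then show ?thesis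
    by (intro that[of X]) (simp_all add: dist_norm)
qed

lemma integrable_mult_continuous:
  fixes f g :: "'g \<Rightarrow> complex"
  assumes "integrable m f" "continuous_on UNIV g"
  shows "integrable m (\<lambda>y. f y * g y)"
proof -
  have "bounded (range g)" using compact_continuous_image[OF assms(2) compact_UNIV] compact_imp_bounded by blast
  then obtain B where B: "\<And>x. norm (g x) \<le> B" unfolding bounded_iff by auto
  have [measurable]: "g \<in> borel_measurable borel" "f \<in> borel_measurable borel"
    using assms by (auto intro: borel_measurable_continuous_onI)
  have "integrable m (\<lambda>y. of_real B * f y)" using assms by simp
  then show ?thesis
    by (rule Bochner_Integration.integrable_bound)
       (use B in \<open>auto simp: norm_mult mult.commute[of "norm (f _)"] intro!: mult_right_mono order_trans[OF _ abs_ge_self]\<close>)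
qed

lemma weighted_integral_diff_le:
  fixes G H :: "'g \<Rightarrow> complex"
  assumes f: "integrable m f" and G: "continuous_on UNIV G" and H: "continuous_on UNIV H"
    and e: "\<And>y. norm (G y - H y) \<le> e"
  shows "norm ((\<integral>y. f y * G y \<partial>m) - (\<integral>y. f y * H y \<partial>m)) \<le> e * (\<integral>y. norm (f y) \<partial>m)"
proof -
  have "(\<integral>y. f y * G y \<partial>m) - (\<integral>y. f y * H y \<partial>m) = (\<integral>y. f y * (G y - H y) \<partial>m)"
    using integrable_mult_continuous[OF f G] integrable_mult_continuous[OF f H] by (simp add: right_diff_distrib)
  also have "norm \<dots> \<le> (\<integral>y. norm (f y * (G y - H y)) \<partial>m)" by (rule integral_norm_bound)
  also have "\<dots> \<le> (\<integral>y. e * norm (f y) \<partial>m)"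
  proof (rule integral_mono)
    show "integrable m (\<lambda>y. norm (f y * (G y - H y)))"
      by (intro integrable_norm integrable_mult_continuous f continuous_intros G H)
    show "norm (f y * (G y - H y)) \<le> e * norm (f y)" for y
      using mult_left_mono[OF e norm_ge_zero[of "f y"], of y] by (simp add: norm_mult mult.commute)
  qed (use f in simp)
  finally show ?thesis by simp
qed

lemma continuous_param_integral:
  fixes F :: "('a::t2_space \<times> 'g) \<Rightarrow> complex"
  assumes f: "integrable m f" and F: "continuous_on UNIV F"
  shows "continuous_on UNIV (\<lambda>x. \<integral>y. f y * F (x, y) \<partial>m)"
proof (rule continuous_at_imp_continuous_on, rule ballI)
  fix x0 :: 'a
  have c: "continuous_on UNIV (\<lambda>y. F (x, y))" for x
    by (rule continuous_on_compose2[OF F]) (auto intro!: continuous_intros)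
  show "isCont (\<lambda>x. \<integral>y. f y * F (x, y) \<partial>m) x0"
    unfolding isCont_def tendsto_iff
  proof (intro allI impI)
    fix e :: real assume e: "e > 0"
    define I where "I = (\<integral>y. norm (f y) \<partial>m)"
    have I: "0 \<le> I" by (simp add: I_def)
    obtain X where X: "x0 \<in> X" "open X" "\<And>x y. x \<in> X \<Longrightarrow> norm (F (x, y) - F (x0, y)) \<le> e / (I + 1)"
      using uniform_nhd[OF F, of "e / (I + 1)" x0] e I by auto
    have "dist (\<integral>y. f y * F (x, y) \<partial>m) (\<integral>y. f y * F (x0, y) \<partial>m) < e" if "x \<in> X" for x
    proof -
      have "dist (\<integral>y. f y * F (x, y) \<partial>m) (\<integral>y. f y * F (x0, y) \<partial>m) \<le> e / (I + 1) * I"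
        unfolding dist_norm I_def
        by (rule weighted_integral_diff_le[OF f c c]) (use X(3)[OF that] in \<open>simp add: I_def\<close>)
      also have "\<dots> < e" using e I by (simp add: field_simps)
      finally show ?thesis .
    qed
    then show "\<forall>\<^sub>F x in at x0. dist (\<integral>y. f y * F (x, y) \<partial>m) (\<integral>y. f y * F (x0, y) \<partial>m) < e"
      unfolding eventually_at_topological using X(1,2) by blast
  qed
qed

text \<open>The Borel sets of \<open>G \<times> G\<close> may form a larger algebra than the product of the Borel algebras, so that
  Fubini's theorem does not apply to a general continuous \<open>F\<close>. Instead the outer integral is replaced by a
  Riemann sum over a finite Borel partition on whose cells \<open>F (x, y)\<close> varies little in \<open>x\<close>,
  uniformly in \<open>y\<close>.\<close>
lemma swap_param_integral:
  fixes F :: "('g \<times> 'g) \<Rightarrow> complex"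
  assumes f: "integrable m f" and F: "continuous_on UNIV F"
  shows "(\<integral>x. (\<integral>y. f y * F (x, y) \<partial>m) \<partial>m) = (\<integral>y. f y * (\<integral>x. F (x, y) \<partial>m) \<partial>m)"
proof -
  define I where "I = (\<integral>y. norm (f y) \<partial>m)"
  have I: "0 \<le> I" by (simp add: I_def)
  have cx: "continuous_on UNIV (\<lambda>x. F (x, y))" for y
    by (rule continuous_on_compose2[OF F]) (auto intro!: continuous_intros)
  have cy: "continuous_on UNIV (\<lambda>y. F (x, y))" for x
    by (rule continuous_on_compose2[OF F]) (auto intro!: continuous_intros)
  have c1: "continuous_on UNIV (\<lambda>x. \<integral>y. f y * F (x, y) \<partial>m)"
    by (rule continuous_param_integral[OF f F])
  have c2: "continuous_on UNIV (\<lambda>y. \<integral>x. F (x, y) \<partial>m)"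
  proof -
    have "continuous_on UNIV (\<lambda>z. F (snd z, fst z))"
      by (rule continuous_on_compose2[OF F]) (auto intro!: continuous_intros)
    from continuous_param_integral[of "\<lambda>_. 1", OF _ this] show ?thesis by simp
  qed
  let ?L = "(\<integral>x. (\<integral>y. f y * F (x, y) \<partial>m) \<partial>m)" and ?R = "(\<integral>y. f y * (\<integral>x. F (x, y) \<partial>m) \<partial>m)"
  have bound: "norm (?L - ?R) \<le> 2 * e * I" if e: "e > 0" for e
  proof -
    have "\<exists>X. x0 \<in> X \<and> open X \<and> (\<forall>x\<in>X. \<forall>y. norm (F (x, y) - F (x0, y)) \<le> e)" for x0
      using uniform_nhd[OF F e, of x0] by metis
    then obtain X where X: "\<And>x0. x0 \<in> X x0" "\<And>x0. open (X x0)" "\<And>x0 x y. x \<in> X x0 \<Longrightarrow> norm (F (x, y) - F (x0, y)) \<le> e"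
      by metis
    obtain C where C: "finite C" "UNIV \<subseteq> (\<Union>c\<in>C. X c)"
    proof (rule compactE_image[OF compact_UNIV, of UNIV X])
      show "UNIV \<subseteq> (\<Union>c\<in>UNIV. X c)" using X(1) by blast
    qed (use X(2) in auto)
    obtain cs where cs: "set cs = C" using C(1) finite_list by metis
    \<comment> \<open>The index of the first member of the cover that contains \<open>x\<close>; its level sets form the partition.\<close>
    define pos where "pos x = (LEAST i. i < length cs \<and> x \<in> X (cs ! i))" for x
    have ex: "\<exists>i. i < length cs \<and> x \<in> X (cs ! i)" for x
      using C(2) cs by (metis UNIV_I UN_E in_set_conv_nth subsetD)
    have pos: "pos x < length cs" "x \<in> X (cs ! pos x)" for x
      using LeastI_ex[OF ex[of x]] by (auto simp: pos_def)
    define P where "P i = {x. pos x = i}" for i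
    have pos_meas: "pos \<in> measurable borel (count_space UNIV)"
      unfolding pos_def
    proof (rule measurable_Least)
      fix i
      have "open {x. i < length cs \<and> x \<in> X (cs ! i)}"
        using X(2)[of "cs ! i"] by (cases "i < length cs") simp_all
      then show "(\<lambda>x. i < length cs \<and> x \<in> X (cs ! i)) \<in> measurable borel (count_space UNIV)"
        by (simp add: pred_def borel_open)
    qed
    have Pm [measurable]: "P i \<in> sets borel" for i
      using measurable_sets[OF pos_meas, of "{i}"] by (simp add: P_def vimage_def)
    define w where "w i = complex_of_real (measure m (P i))" for i
    define n where "n = length cs"
    have P1: "(\<Sum>i<n. indicator (P i) x *\<^sub>R g (cs ! i)) = g (cs ! pos x)" for g :: "'g \<Rightarrow> complex" and x
    proof -
      have "(\<Sum>i<n. indicator (P i) x *\<^sub>R g (cs ! i)) = (\<Sum>i<n. if i = pos x then g (cs ! i) else 0)"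
        by (intro sum.cong) (auto simp: P_def)
      also have "\<dots> = g (cs ! pos x)" using pos[of x] by (simp add: n_def)
      finally show ?thesis .
    qed
    have riemann: "norm ((\<integral>x. g x \<partial>m) - (\<Sum>i<n. w i * g (cs ! i))) \<le> e'"
      if g: "continuous_on UNIV g" and osc: "\<And>x x0. x \<in> X x0 \<Longrightarrow> norm (g x - g x0) \<le> e'" for g e'
    proof -
      have i: "integrable m (\<lambda>x. indicator (P i) x *\<^sub>R g (cs ! i))" for i
        by (intro integrable_scaleR_left integrable_real_indicator) (auto simp: less_top[symmetric])
      have "(\<integral>x. (\<Sum>i<n. indicator (P i) x *\<^sub>R g (cs ! i)) \<partial>m) = (\<Sum>i<n. w i * g (cs ! i))"
      proof (subst Bochner_Integration.integral_sum)
        have "(\<integral>x. indicator (P i) x *\<^sub>R g (cs ! i) \<partial>m) = w i * g (cs ! i)" for i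
          by (subst integral_scaleR_left) (auto simp: w_def scaleR_conv_of_real less_top[symmetric])
        then show "(\<Sum>i<n. \<integral>x. indicator (P i) x *\<^sub>R g (cs ! i) \<partial>m) = (\<Sum>i<n. w i * g (cs ! i))" by simp
      qed (rule i)
      then have "(\<integral>x. g x \<partial>m) - (\<Sum>i<n. w i * g (cs ! i)) = (\<integral>x. g x - (\<Sum>i<n. indicator (P i) x *\<^sub>R g (cs ! i)) \<partial>m)"
        by (subst Bochner_Integration.integral_diff[OF continuous_integrable[OF g] Bochner_Integration.integrable_sum[OF i]]) simp
      also have "norm \<dots> \<le> (\<integral>x. norm (g x - (\<Sum>i<n. indicator (P i) x *\<^sub>R g (cs ! i))) \<partial>m)"
        by (rule integral_norm_bound)
      also have "\<dots> \<le> (\<integral>x. e' \<partial>m)"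
      proof (rule integral_mono)
        show "integrable m (\<lambda>x. norm (g x - (\<Sum>i<n. indicator (P i) x *\<^sub>R g (cs ! i))))"
          by (intro integrable_norm Bochner_Integration.integrable_diff Bochner_Integration.integrable_sum i continuous_integrable g)
        show "norm (g x - (\<Sum>i<n. indicator (P i) x *\<^sub>R g (cs ! i))) \<le> e'" for x
          unfolding P1 by (rule osc) (rule pos)
      qed simp
      finally show ?thesis by simp
    qed
    have iy: "integrable m (\<lambda>y. f y * F (x, y))" for x by (rule integrable_mult_continuous[OF f cy])
    have 1: "norm (?L - (\<Sum>i<n. w i * (\<integral>y. f y * F (cs ! i, y) \<partial>m))) \<le> e * I"
    proof (rule riemann[OF c1])
      fix x x0 assume "x \<in> X x0"
      then show "norm ((\<integral>y. f y * F (x, y) \<partial>m) - (\<integral>y. f y * F (x0, y) \<partial>m)) \<le> e * I"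
        unfolding I_def by (intro weighted_integral_diff_le[OF f] cy X(3))
    qed
    have cS: "continuous_on UNIV (\<lambda>y. \<Sum>i<n. w i * F (cs ! i, y))"
      by (intro continuous_intros cy)
    have "(\<Sum>i<n. w i * (\<integral>y. f y * F (cs ! i, y) \<partial>m)) = (\<integral>y. (\<Sum>i<n. w i * (f y * F (cs ! i, y))) \<partial>m)"
      using iy by (subst Bochner_Integration.integral_sum) auto
    also have "\<dots> = (\<integral>y. f y * (\<Sum>i<n. w i * F (cs ! i, y)) \<partial>m)"
      by (simp add: sum_distrib_left mult_ac)
    finally have 2: "(\<Sum>i<n. w i * (\<integral>y. f y * F (cs ! i, y) \<partial>m)) = (\<integral>y. f y * (\<Sum>i<n. w i * F (cs ! i, y)) \<partial>m)" .
    have 3: "norm ((\<integral>y. f y * (\<integral>x. F (x, y) \<partial>m) \<partial>m) - (\<integral>y. f y * (\<Sum>i<n. w i * F (cs ! i, y)) \<partial>m)) \<le> e * I"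
      unfolding I_def by (rule weighted_integral_diff_le[OF f c2 cS]) (rule riemann[OF cx X(3)])
    have "?L - ?R = (?L - (\<Sum>i<n. w i * (\<integral>y. f y * F (cs ! i, y) \<partial>m))) - (?R - (\<integral>y. f y * (\<Sum>i<n. w i * F (cs ! i, y)) \<partial>m))"
      unfolding 2 by simp
    also have "norm \<dots> \<le> e * I + e * I"
      by (rule order_trans[OF norm_triangle_ineq4 add_mono[OF 1 3]])
    finally show ?thesis by (simp add: mult_ac)
  qed
  have "norm (?L - ?R) \<le> 0"
  proof (rule field_le_epsilon)
    fix e :: real assume e: "e > 0"
    have "norm (?L - ?R) \<le> 2 * (e / (2 * (I + 1))) * I" using bound[of "e / (2 * (I + 1))"] e I by simp
    also have "\<dots> \<le> e" using e I by (simp add: field_simps)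
    finally show "norm (?L - ?R) \<le> 0 + e" by simp
  qed
  then show ?thesis by simp
qed

end

section \<open>Concentration of positive definite sequences\<close>

lemma sum_roots_of_unity:
  fixes d :: int
  assumes "\<bar>d\<bar> < int L"
  shows "(\<Sum>l<L. cis (2 * pi * real l * of_int d / real L)) = (if d = 0 then of_nat L else 0)"
proof (cases "d = 0")
  case False
  have L: "L > 0" using assms by auto
  define w where "w = cis (2 * pi * of_int d / real L)"
  have pw: "cis (2 * pi * real l * of_int d / real L) = w ^ l" for l
    by (simp add: w_def Complex.DeMoivre mult_ac)
  have "w ^ L = cis (2 * pi * of_int d)" using L by (simp add: w_def Complex.DeMoivre)
  also have "\<dots> = 1" by (simp add: cis_multiple_2pi)
  finally have wL: "w ^ L = 1" .
  have "w \<noteq> 1"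
  proof
    assume "w = 1"
    then have "cos (2 * pi * of_int d / real L) = 1" by (simp add: w_def complex_eq_iff)
    then obtain k :: int where "2 * pi * of_int d / real L = of_int k * (2 * pi)"
      using cos_one_2pi_int by auto
    then have "real_of_int d = of_int k * real L" using L by (simp add: field_simps)
    then have "d = k * int L" by (metis of_int_eq_iff of_int_mult of_int_of_nat_eq)
    then show False using assms False by (simp add: abs_mult)
  qed
  then have "(\<Sum>l<L. w ^ l) = 0" using wL by (simp add: geometric_sum)
  then show ?thesis using False by (simp add: pw)
qed simp

lemma count_differences:
  fixes d :: int
  assumes "\<bar>d\<bar> \<le> int N"
  shows "real N \<le> (\<Sum>i<2*N. \<Sum>i'<2*N. if int i - int i' = d then 1 else 0 :: real)"
proof -
  define S where "S = {(i, i'). i < 2*N \<and> i' < 2*N \<and> int i - int i' = d}"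
  define f where "f i = (if d \<ge> 0 then (i + nat d, i) else (i, i + nat (- d)))" for i :: nat
  have "f ` {..<N} \<subseteq> S" using assms by (auto simp: f_def S_def)
  moreover have "inj_on f {..<N}" by (auto simp: f_def inj_on_def)
  moreover have fS: "finite S" by (rule finite_subset[of _ "{..<2*N} \<times> {..<2*N}"]) (auto simp: S_def)
  ultimately have "N \<le> card S" by (metis card_inj_on_le card_lessThan)
  moreover have "(\<Sum>i<2*N. \<Sum>i'<2*N. if int i - int i' = d then 1 else 0) = (\<Sum>z\<in>{..<2*N} \<times> {..<2*N}. if z \<in> S then 1 else 0 :: real)"
    unfolding sum.cartesian_product by (intro sum.cong) (auto simp: S_def split: if_splits)
  moreover have "\<dots> = real (card S)"
  proof -
    have "({..<2*N} \<times> {..<2*N}) \<inter> S = S" by (auto simp: S_def)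
    then show ?thesis by (simp add: sum.If_cases)
  qed
  ultimately show ?thesis by simp
qed

lemma sum_swap5:
  "(\<Sum>l\<in>L. \<Sum>j\<in>A. \<Sum>j'\<in>B. \<Sum>i\<in>C. \<Sum>i'\<in>D. F l j j' i i') =
   (\<Sum>j\<in>A. \<Sum>j'\<in>B. \<Sum>i\<in>C. \<Sum>i'\<in>D. \<Sum>l\<in>L. F l j j' i i')"
  by (simp only: sum.swap[where A = L])

text \<open>Let \<open>A\<close> be the positive definite form \<open>Q\<close> at the weights \<open>p j * z ^ j\<close>, and \<open>B\<close> the form at the weights
  \<open>z ^ j\<close> with \<open>j < 2 * n\<close>, as functions of the root of unity \<open>z\<close>. Discrete orthogonality gives the mean
  of \<open>B\<close> as \<open>2 * n * k0\<close>, and the mean of \<open>A * B\<close> as a sum of \<open>p j * p j' * \<bar>K (j - j')\<bar>\<^sup>2\<close> over all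
  \<open>j\<close>, \<open>j'\<close>, each counted at least \<open>n\<close> times because every difference \<open>j - j'\<close> occurs at least \<open>n\<close> times
  among the indices of \<open>B\<close>. As \<open>B \<ge> 0\<close>, the function \<open>A\<close> cannot be small at all roots. This replaces
  the representation of \<open>K\<close> by a spectral measure.\<close>
lemma exists_root_of_unity_large:
  fixes K :: "int \<Rightarrow> complex" and p :: "nat \<Rightarrow> real"
  defines "Q \<equiv> \<lambda>(w :: nat \<Rightarrow> complex) n. \<Sum>j<n. \<Sum>j'<n. w j * cnj (w j') * K (int j - int j')"
  assumes pos: "\<And>w n. \<exists>r\<ge>0. Q w n = complex_of_real r"
    and K0: "K 0 = of_real k0" "k0 > 0"
    and p: "\<And>j. p j \<ge> 0" and n: "n > 0"
    and S: "(\<Sum>j<n. \<Sum>j'<n. p j * p j' * (norm (K (int j - int j')))\<^sup>2) \<ge> s"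
  shows "\<exists>z. norm z = 1 \<and> Re (Q (\<lambda>j. of_real (p j) * z ^ j) n) \<ge> s / (2 * k0)"
proof (rule ccontr)
  assume "\<not> ?thesis"
  then have neg: "Re (Q (\<lambda>j. of_real (p j) * z ^ j) n) < s / (2 * k0)" if "norm z = 1" for z
    using that by force
  \<comment> \<open>All differences \<open>(j - j') - (i - i')\<close> are less than \<open>3 * n\<close> in absolute value, so distinct ones are not confused.\<close>
  define L where "L = 3 * n"
  define e where "e l = cis (2 * pi * real l / real L)" for l
  have ne: "norm (e l) = 1" for l by (simp add: e_def)
  have epow: "e l ^ j = cis (2 * pi * real l * of_int (int j) / real L)" for l j
    by (simp add: e_def Complex.DeMoivre mult_ac)
  define A where "A l = Q (\<lambda>j. of_real (p j) * e l ^ j) n" for l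
  define B where "B l = Q (\<lambda>j. e l ^ j) (2 * n)" for l
  have B_real: "cnj (B l) = B l" "Re (B l) \<ge> 0" and A_real: "A l = of_real (Re (A l))" "Re (A l) \<ge> 0" for l
    using pos[of "\<lambda>j. e l ^ j" "2*n"] pos[of "\<lambda>j. of_real (p j) * e l ^ j" n] by (auto simp: A_def B_def)
  have "(\<Sum>l<L. B l) = (\<Sum>i<2*n. \<Sum>i'<2*n. K (int i - int i') * (\<Sum>l<L. cis (2 * pi * real l * of_int (int i - int i') / real L)))"
  proof -
    have "(\<Sum>l<L. B l) = (\<Sum>l<L. \<Sum>i<2*n. \<Sum>i'<2*n. K (int i - int i') * cis (2 * pi * real l * of_int (int i - int i') / real L))"
      unfolding B_def Q_def
      by (intro sum.cong refl) (simp add: epow cis_cnj cis_mult algebra_simps diff_divide_distrib)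
    also have "\<dots> = (\<Sum>i<2*n. \<Sum>l<L. \<Sum>i'<2*n. K (int i - int i') * cis (2 * pi * real l * of_int (int i - int i') / real L))"
      by (rule sum.swap)
    also have "\<dots> = (\<Sum>i<2*n. \<Sum>i'<2*n. \<Sum>l<L. K (int i - int i') * cis (2 * pi * real l * of_int (int i - int i') / real L))"
      by (intro sum.cong refl sum.swap)
    finally show ?thesis by (simp add: sum_distrib_left)
  qed
  also have "\<dots> = (\<Sum>i<2*n. \<Sum>i'<2*n. K (int i - int i') * (if int i - int i' = 0 then of_nat L else 0))"
    by (intro sum.cong refl arg_cong2[where f="(*)"] sum_roots_of_unity) (auto simp: L_def)
  also have "\<dots> = (\<Sum>i<2*n. of_real k0 * of_nat L)"
  proof (intro sum.cong refl)
    fix i assume "i \<in> {..<2*n}"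
    then show "(\<Sum>i'<2*n. K (int i - int i') * (if int i - int i' = 0 then of_nat L else 0)) = of_real k0 * of_nat L"
      using K0 by (subst sum.remove[of _ i]) (auto intro!: sum.neutral)
  qed
  also have "\<dots> = of_real (2 * n * k0 * L)" by simp
  finally have "Re (\<Sum>l<L. B l) = 2 * n * k0 * L" by simp
  then have sumB: "(\<Sum>l<L. Re (B l)) = 2 * n * k0 * L" by simp
  have swap4: "(\<Sum>l<L. A l * cnj (B l)) = (\<Sum>j<n. \<Sum>j'<n. \<Sum>i<2*n. \<Sum>i'<2*n.
      of_real (p j * p j') * K (int j - int j') * cnj (K (int i - int i')) *
      (\<Sum>l<L. cis (2 * pi * real l * of_int ((int j - int j') - (int i - int i')) / real L)))"
  proof -
    have "A l * cnj (B l) = (\<Sum>j<n. \<Sum>j'<n. \<Sum>i<2*n. \<Sum>i'<2*n.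
        of_real (p j * p j') * K (int j - int j') * cnj (K (int i - int i')) *
        cis (2 * pi * real l * of_int ((int j - int j') - (int i - int i')) / real L))" for l
    proof -
      have c: "e l ^ j * cnj (e l ^ j') * (cnj (e l ^ i) * e l ^ i') = cis (2 * pi * real l * of_int ((int j - int j') - (int i - int i')) / real L)" for j j' i i'
        unfolding epow cis_cnj cis_mult by (simp add: algebra_simps diff_divide_distrib add_divide_distrib)
      have "A l * cnj (B l) = (\<Sum>j<n. \<Sum>j'<n. \<Sum>i<2*n. \<Sum>i'<2*n. (of_real (p j) * e l ^ j * cnj (of_real (p j') * e l ^ j') * K (int j - int j')) *
          cnj (e l ^ i * cnj (e l ^ i') * K (int i - int i')))"
        unfolding A_def B_def Q_def by (simp only: cnj_sum sum_distrib_right) (simp only: sum_distrib_left)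
      also have "\<dots> = (\<Sum>j<n. \<Sum>j'<n. \<Sum>i<2*n. \<Sum>i'<2*n. of_real (p j * p j') * K (int j - int j') * cnj (K (int i - int i')) *
          (e l ^ j * cnj (e l ^ j') * (cnj (e l ^ i) * e l ^ i')))"
        by (intro sum.cong refl) (simp add: mult_ac)
      finally show ?thesis unfolding c .
    qed
    then have "(\<Sum>l<L. A l * cnj (B l)) = (\<Sum>l<L. \<Sum>j<n. \<Sum>j'<n. \<Sum>i<2*n. \<Sum>i'<2*n.
        of_real (p j * p j') * K (int j - int j') * cnj (K (int i - int i')) *
        cis (2 * pi * real l * of_int ((int j - int j') - (int i - int i')) / real L))" by simp
    also have "\<dots> = (\<Sum>j<n. \<Sum>j'<n. \<Sum>i<2*n. \<Sum>i'<2*n. \<Sum>l<L.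
        of_real (p j * p j') * K (int j - int j') * cnj (K (int i - int i')) *
        cis (2 * pi * real l * of_int ((int j - int j') - (int i - int i')) / real L))"
      by (rule sum_swap5)
    finally show ?thesis by (simp add: sum_distrib_left)
  qed
  also have "\<dots> = (\<Sum>j<n. \<Sum>j'<n. \<Sum>i<2*n. \<Sum>i'<2*n.
      of_real (p j * p j' * (norm (K (int j - int j')))\<^sup>2 * L * (if int i - int i' = int j - int j' then 1 else 0)))"
  proof (intro sum.cong refl)
    fix j j' i i' assume "j \<in> {..<n}" "j' \<in> {..<n}" "i \<in> {..<2*n}" "i' \<in> {..<2*n}"
    then have "\<bar>(int j - int j') - (int i - int i')\<bar> < int L" by (auto simp: L_def)
    from sum_roots_of_unity[OF this]
    show "of_real (p j * p j') * K (int j - int j') * cnj (K (int i - int i')) *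
      (\<Sum>l<L. cis (2 * pi * real l * of_int ((int j - int j') - (int i - int i')) / real L)) =
      of_real (p j * p j' * (norm (K (int j - int j')))\<^sup>2 * L * (if int i - int i' = int j - int j' then 1 else 0))"
      by (simp add: complex_norm_square[symmetric] mult.assoc)
  qed
  finally have AB: "(\<Sum>l<L. A l * cnj (B l)) = of_real (\<Sum>j<n. \<Sum>j'<n. \<Sum>i<2*n. \<Sum>i'<2*n.
      p j * p j' * (norm (K (int j - int j')))\<^sup>2 * L * (if int i - int i' = int j - int j' then 1 else 0))"
    by simp
  have "L * n * s \<le> L * n * (\<Sum>j<n. \<Sum>j'<n. p j * p j' * (norm (K (int j - int j')))\<^sup>2)"
    using S by (intro mult_left_mono) auto
  also have "\<dots> = (\<Sum>j<n. \<Sum>j'<n. p j * p j' * (norm (K (int j - int j')))\<^sup>2 * L * n)"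
    by (simp add: sum_distrib_left mult_ac)
  also have "\<dots> \<le> (\<Sum>j<n. \<Sum>j'<n. p j * p j' * (norm (K (int j - int j')))\<^sup>2 * L * (\<Sum>i<2*n. \<Sum>i'<2*n. if int i - int i' = int j - int j' then 1 else 0))"
    by (intro sum_mono mult_left_mono count_differences) (use p in auto)
  also have "\<dots> = Re (\<Sum>l<L. A l * cnj (B l))"
    unfolding AB by (simp add: sum_distrib_left)
  also have "\<dots> = (\<Sum>l<L. Re (A l) * Re (B l))"
  proof -
    have "Im (A l) = 0" for l using A_real(1)[of l] by (metis Im_complex_of_real)
    then show ?thesis by simp
  qed
  also have "\<dots> < (\<Sum>l<L. s / (2 * k0) * Re (B l))"
  proof (rule sum_strict_mono_ex1)
    have "\<exists>l<L. Re (B l) \<noteq> 0"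
    proof (rule ccontr)
      assume "\<not> (\<exists>l<L. Re (B l) \<noteq> 0)"
      then have "(\<Sum>l<L. Re (B l)) = 0" by simp
      then show False using sumB K0 n by (simp add: L_def)
    qed
    then obtain l where "l < L" "Re (B l) > 0" using B_real(2) by (metis less_eq_real_def)
    then show "\<exists>l\<in>{..<L}. Re (A l) * Re (B l) < s / (2 * k0) * Re (B l)"
      using mult_strict_right_mono[OF neg[OF ne[of l]], of "Re (B l)"] unfolding A_def
      by (intro bexI[of _ l]) simp_all
    show "\<forall>l\<in>{..<L}. Re (A l) * Re (B l) \<le> s / (2 * k0) * Re (B l)"
      using mult_right_mono[OF less_imp_le[OF neg[OF ne]] B_real(2)] unfolding A_def by blast
  qed simp
  also have "\<dots> = s / (2 * k0) * (2 * n * k0 * L)" by (simp only: sum_distrib_left[symmetric] sumB)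
  also have "\<dots> = L * n * s" using K0 by simp
  finally show False by simp
qed

context haar_flow
begin

definition corr :: "('g \<Rightarrow> complex) \<Rightarrow> ('g \<Rightarrow> complex) \<Rightarrow> 'g \<Rightarrow> complex" where
  "corr g f x = (\<integral>y. g (y + x) * cnj (f y) \<partial>m)"

lemma continuous_translate:
  fixes g :: "'g \<Rightarrow> 'b::topological_space"
  shows "continuous_on UNIV g \<Longrightarrow> continuous_on UNIV (\<lambda>y. g (y + x))"
  by (rule continuous_on_compose2[of UNIV g]) (auto intro!: continuous_intros)

lemma continuous_corr:
  assumes g: "continuous_on UNIV g" and f: "integrable m f"
  shows "continuous_on UNIV (corr g f)"
proof -
  have "continuous_on UNIV (\<lambda>z::'g \<times> 'g. g (snd z + fst z))"
    by (rule continuous_on_compose2[OF g]) (auto intro!: continuous_intros)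
  from continuous_param_integral[OF _ this, of "\<lambda>y. cnj (f y)"] f
  show ?thesis unfolding corr_def by (simp add: mult.commute)
qed

lemma integrable_corr:
  assumes g: "continuous_on UNIV g" and f: "integrable m f"
  shows "integrable m (\<lambda>y. g (y + x) * cnj (f y))"
  using integrable_mult_continuous[of "\<lambda>y. cnj (f y)" "\<lambda>y. g (y + x)"] continuous_translate[OF g] f
  by (simp add: mult.commute)

lemma energy_expansion:
  fixes S :: "nat set" and f :: "'g \<Rightarrow> complex"
  assumes f: "continuous_on UNIV f"
  shows "complex_of_real (\<integral>x. (norm (\<Sum>j\<in>S. w j * f (x + \<beta> (real j * \<tau>))))\<^sup>2 \<partial>m) =
    (\<Sum>j\<in>S. \<Sum>j'\<in>S. w j * cnj (w j') * corr f f (\<beta> (of_int (int j - int j') * \<tau>)))"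
proof -
  note ct = continuous_translate[OF f]
  have fm [measurable]: "f \<in> borel_measurable borel" using f by (rule borel_measurable_continuous_onI)
  have t: "(\<integral>x. f (x + \<beta> (real j * \<tau>)) * cnj (f (x + \<beta> (real j' * \<tau>))) \<partial>m) = corr f f (\<beta> (of_int (int j - int j') * \<tau>))" for j j'
  proof -
    have "x + \<beta> (real j * \<tau>) = x + \<beta> (real j' * \<tau>) + \<beta> (of_int (int j - int j') * \<tau>)" for x
      by (simp add: add.assoc left_diff_distrib flip: \<beta>_add)
    then have "(\<integral>x. f (x + \<beta> (real j * \<tau>)) * cnj (f (x + \<beta> (real j' * \<tau>))) \<partial>m) =
      (\<integral>x. f (x + \<beta> (real j' * \<tau>) + \<beta> (of_int (int j - int j') * \<tau>)) * cnj (f (x + \<beta> (real j' * \<tau>))) \<partial>m)"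
      by presburger
    also have "\<dots> = corr f f (\<beta> (of_int (int j - int j') * \<tau>))"
      unfolding corr_def
      by (rule integral_translate[of "\<lambda>x. f (x + \<beta> (of_int (int j - int j') * \<tau>)) * cnj (f x)"])
         (intro borel_measurable_continuous_onI continuous_intros ct f)
    finally show ?thesis .
  qed
  have "complex_of_real (\<integral>x. (norm (\<Sum>j\<in>S. w j * f (x + \<beta> (real j * \<tau>))))\<^sup>2 \<partial>m) =
     (\<integral>x. complex_of_real ((norm (\<Sum>j\<in>S. w j * f (x + \<beta> (real j * \<tau>))))\<^sup>2) \<partial>m)"
    by (rule integral_complex_of_real[symmetric])
  also have "\<dots> = (\<integral>x. (\<Sum>j\<in>S. \<Sum>j'\<in>S. w j * cnj (w j') * (f (x + \<beta> (real j * \<tau>)) * cnj (f (x + \<beta> (real j' * \<tau>))))) \<partial>m)"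
    unfolding complex_norm_square by (simp add: sum_product mult_ac)
  also have "\<dots> = (\<Sum>j\<in>S. \<Sum>j'\<in>S. w j * cnj (w j') * (\<integral>x. f (x + \<beta> (real j * \<tau>)) * cnj (f (x + \<beta> (real j' * \<tau>))) \<partial>m))"
    by (subst Bochner_Integration.integral_sum | intro Bochner_Integration.integrable_sum continuous_integrable continuous_intros ct | simp)+
  finally show ?thesis unfolding t .
qed

lemma corr_0: "corr f f 0 = of_real (\<integral>y. (norm (f y))\<^sup>2 \<partial>m)"
  unfolding corr_def by (simp add: complex_norm_square[symmetric] del: of_real_power)

text \<open>The autocorrelation \<open>k\<close> of \<open>f\<close> exceeds half of its value at 0 on the differences of points of one cell
  of a finite cover of the group. Under any weights \<open>p\<close>, two independent indices lie in the same cell with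
  probability at least \<open>1 / card C\<close>, by the Cauchy-Schwarz inequality. So the sum in the preceding lemma has a
  lower bound that depends on \<open>f\<close> only: not on the step \<open>\<tau>\<close>, the number \<open>n\<close>, or the weights.\<close>
lemma exists_frequency:
  fixes f :: "'g \<Rightarrow> complex"
  assumes f: "continuous_on UNIV f" and k0: "(\<integral>y. (norm (f y))\<^sup>2 \<partial>m) > 0"
  shows "\<exists>c>0. \<forall>\<tau> n p. (\<forall>j. p j \<ge> 0) \<and> (\<Sum>j<n. p j) = 1 \<longrightarrow>
    (\<exists>z. norm z = 1 \<and> (\<integral>x. (norm (\<Sum>j<n. of_real (p j) * z ^ j * f (x + \<beta> (real j * \<tau>))))\<^sup>2 \<partial>m) \<ge> c)"
proof -
  define k where "k = corr f f"
  define k0 where "k0 = (\<integral>y. (norm (f y))\<^sup>2 \<partial>m)"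
  have k0_pos: "k0 > 0" using k0 by (simp add: k0_def)
  have k_0: "k 0 = of_real k0" by (simp add: k_def k0_def corr_0)
  have ck: "continuous_on UNIV k" unfolding k_def by (intro continuous_corr f continuous_integrable)
  have "\<exists>U. x \<in> U \<and> open U \<and> (\<forall>a\<in>U. \<forall>b\<in>U. norm (k (a - b)) > k0 / 2)" for x
  proof -
    have c: "continuous_on UNIV (\<lambda>z::'g \<times> 'g. norm (k (fst z - snd z)))"
      by (intro continuous_on_norm continuous_on_compose2[OF ck]) (auto intro!: continuous_intros)
    have "open ((\<lambda>z::'g \<times> 'g. norm (k (fst z - snd z))) -` {k0 / 2<..})"
      using c by (simp add: continuous_on_open_vimage)
    moreover have "(x, x) \<in> (\<lambda>z::'g \<times> 'g. norm (k (fst z - snd z))) -` {k0 / 2<..}"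
      using k0_pos by (simp add: k_0)
    ultimately obtain A B where "open A" "open B" "x \<in> A" "x \<in> B"
      "A \<times> B \<subseteq> (\<lambda>z::'g \<times> 'g. norm (k (fst z - snd z))) -` {k0 / 2<..}"
      by (rule open_prod_elim) (metis mem_Sigma_iff)
    then show ?thesis
      by (intro exI[of _ "A \<inter> B"]) (auto simp: open_Int)
  qed
  then obtain U where U: "\<And>x. x \<in> U x" "\<And>x. open (U x)" "\<And>x a b. a \<in> U x \<Longrightarrow> b \<in> U x \<Longrightarrow> norm (k (a - b)) > k0 / 2"
    by metis
  obtain C where C: "finite C" "UNIV \<subseteq> (\<Union>c\<in>C. U c)"
  proof (rule compactE_image[OF compact_UNIV, of UNIV U])
    show "UNIV \<subseteq> (\<Union>c\<in>UNIV. U c)" using U(1) by blast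
  qed (use U(2) in auto)
  then obtain cell where cell: "\<And>x. cell x \<in> C" "\<And>x. x \<in> U (cell x)"
    by (metis UNIV_I UN_E subsetD)
  have Cpos: "card C > 0" using C(1) cell(1) by (auto simp: card_gt_0_iff)
  define c where "c = (k0 / 2)\<^sup>2 / card C / (2 * k0)"
  have "c > 0" using k0_pos Cpos by (simp add: c_def)
  moreover have "\<exists>z. norm z = 1 \<and> (\<integral>x. (norm (\<Sum>j<n. of_real (p j) * z ^ j * f (x + \<beta> (real j * \<tau>))))\<^sup>2 \<partial>m) \<ge> c"
    if p: "\<And>j. p j \<ge> 0" "(\<Sum>j<n. p j) = 1" for \<tau> n p
  proof -
    define K where "K d = k (\<beta> (of_int d * \<tau>))" for d :: int
    define Q where "Q = (\<lambda>w n. \<Sum>j<n. \<Sum>j'<n. w j * cnj (w j') * K (int j - int j'))"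
    have Qeq: "Q w n = of_real (\<integral>x. (norm (\<Sum>j<n. w j * f (x + \<beta> (real j * \<tau>))))\<^sup>2 \<partial>m)" for w n
      unfolding Q_def K_def k_def energy_expansion[OF f] ..
    have n: "n > 0" using p(2) by (cases n) auto
    define q where "q x = (\<Sum>j | j < n \<and> cell (\<beta> (real j * \<tau>)) = x. p j)" for x
    have "(\<Sum>x\<in>C. q x) = (\<Sum>j<n. p j)"
      unfolding q_def using sum.group[of "{..<n}" C "\<lambda>j. cell (\<beta> (real j * \<tau>))" p] C(1) cell(1) by auto
    then have "1 = (\<Sum>x\<in>C. q x)\<^sup>2" using p by simp
    also have "\<dots> \<le> (\<Sum>x\<in>C. (q x)\<^sup>2) * card C" by (rule sum_squared_le_sum_of_squares)
    finally have qq: "1 / card C \<le> (\<Sum>x\<in>C. (q x)\<^sup>2)" using Cpos by (simp add: field_simps)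
    have "(k0 / 2)\<^sup>2 / card C \<le> (k0 / 2)\<^sup>2 * (\<Sum>x\<in>C. (q x)\<^sup>2)"
      using mult_left_mono[OF qq, of "(k0/2)\<^sup>2"] by simp
    also have "(\<Sum>x\<in>C. (q x)\<^sup>2) = (\<Sum>j<n. \<Sum>j'<n. if cell (\<beta> (real j' * \<tau>)) = cell (\<beta> (real j * \<tau>)) then p j * p j' else 0)"
    proof -
      have "(\<Sum>x\<in>C. (q x)\<^sup>2) = (\<Sum>x\<in>C. \<Sum>j | j \<in> {..<n} \<and> cell (\<beta> (real j * \<tau>)) = x. p j * q (cell (\<beta> (real j * \<tau>))))"
        unfolding power2_eq_square by (intro sum.cong refl) (simp add: q_def sum_distrib_right)
      also have "\<dots> = (\<Sum>j<n. p j * q (cell (\<beta> (real j * \<tau>))))"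
        using sum.group[of "{..<n}" C "\<lambda>j. cell (\<beta> (real j * \<tau>))" "\<lambda>j. p j * q (cell (\<beta> (real j * \<tau>)))"] C(1) cell(1) by auto
      also have "\<dots> = (\<Sum>j<n. \<Sum>j'<n. if cell (\<beta> (real j' * \<tau>)) = cell (\<beta> (real j * \<tau>)) then p j * p j' else 0)"
        by (intro sum.cong refl) (simp add: q_def sum_distrib_left sum.inter_filter[symmetric] Collect_conj_eq lessThan_def)
      finally show ?thesis .
    qed
    also have "(k0 / 2)\<^sup>2 * \<dots> \<le> (\<Sum>j<n. \<Sum>j'<n. p j * p j' * (norm (K (int j - int j')))\<^sup>2)"
      unfolding sum_distrib_left
    proof (intro sum_mono)
      fix j j'
      show "(k0 / 2)\<^sup>2 * (if cell (\<beta> (real j' * \<tau>)) = cell (\<beta> (real j * \<tau>)) then p j * p j' else 0) \<le> p j * p j' * (norm (K (int j - int j')))\<^sup>2"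
      proof (cases "cell (\<beta> (real j' * \<tau>)) = cell (\<beta> (real j * \<tau>))")
        case True
        have "norm (k (\<beta> (real j * \<tau>) - \<beta> (real j' * \<tau>))) > k0 / 2"
          using U(3)[of "\<beta> (real j * \<tau>)" "cell (\<beta> (real j * \<tau>))" "\<beta> (real j' * \<tau>)"] cell(2) True by metis
        then have "(k0 / 2)\<^sup>2 \<le> (norm (K (int j - int j')))\<^sup>2"
          using k0_pos by (intro power_mono) (auto simp: K_def left_diff_distrib \<beta>_diff)
        then show ?thesis using True p by (simp add: mult.commute mult_left_mono)
      qed (use p in auto)
    qed
    finally have S: "(k0 / 2)\<^sup>2 / card C \<le> (\<Sum>j<n. \<Sum>j'<n. p j * p j' * (norm (K (int j - int j')))\<^sup>2)" .
    have "\<exists>z. norm z = 1 \<and> Re (Q (\<lambda>j. of_real (p j) * z ^ j) n) \<ge> (k0 / 2)\<^sup>2 / card C / (2 * k0)"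
      unfolding Q_def
    proof (rule exists_root_of_unity_large)
      show "\<exists>r\<ge>0. (\<Sum>j<n. \<Sum>j'<n. w j * cnj (w j') * K (int j - int j')) = complex_of_real r" for w n
        using Qeq[of w n] unfolding Q_def by (intro exI[of _ "\<integral>x. (norm (\<Sum>j<n. w j * f (x + \<beta> (real j * \<tau>))))\<^sup>2 \<partial>m"]) simp
    qed (use S k0_pos k_0 p n in \<open>auto simp: K_def\<close>)
    then show ?thesis unfolding Qeq c_def by simp
  qed
  ultimately show ?thesis by blast
qed

end

section \<open>Powers of an averaging operator\<close>

context haar_flow
begin

text \<open>The mean of the identity and the unitary operator \<open>g \<mapsto> z * g (x + \<beta> \<tau>)\<close>. Its powers concentrate on
  the fixed vectors of that operator, the eigenfunctions of translation by \<open>\<beta> \<tau>\<close>.\<close>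
definition bin :: "complex \<Rightarrow> real \<Rightarrow> ('g \<Rightarrow> complex) \<Rightarrow> 'g \<Rightarrow> complex" where
  "bin z \<tau> g x = (g x + z * g (x + \<beta> \<tau>)) / 2"

lemma continuous_bin: "continuous_on UNIV g \<Longrightarrow> continuous_on UNIV (bin z \<tau> g)"
  unfolding bin_def[abs_def] by (intro continuous_intros continuous_translate) auto

lemma continuous_bin_pow: "continuous_on UNIV g \<Longrightarrow> continuous_on UNIV ((bin z \<tau> ^^ n) g)"
  by (induction n) (auto intro: continuous_bin)

lemma bin_commute: "bin z \<tau> (bin z' \<tau>' g) = bin z' \<tau>' (bin z \<tau> g)"
  by (rule ext) (simp add: bin_def field_simps add_ac)

lemma bin_pow_commute: "bin z \<tau> ((bin z' \<tau>' ^^ n) g) = (bin z' \<tau>' ^^ n) (bin z \<tau> g)"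
  by (induction n) (simp_all add: bin_commute[of z \<tau> z' \<tau>'])

text \<open>The weights are those of the binomial distribution; it matters that they depend on \<open>n\<close> only.\<close>
lemma bin_pow_expansion:
  "\<exists>p. (\<forall>j. p j \<ge> 0) \<and> (\<Sum>j<Suc n. p j) = (1::real) \<and>
     (\<forall>z \<tau> g x. (bin z \<tau> ^^ n) g x = (\<Sum>j<Suc n. of_real (p j) * z ^ j * g (x + \<beta> (real j * \<tau>))))"
proof (induction n)
  case 0
  show ?case by (intro exI[of _ "\<lambda>_. 1"]) simp
next
  case (Suc n)
  then obtain p where P: "(\<forall>j. p j \<ge> 0) \<and> (\<Sum>j<Suc n. p j) = (1::real) \<and>
     (\<forall>z \<tau> g x. (bin z \<tau> ^^ n) g x = (\<Sum>j<Suc n. of_real (p j) * z ^ j * g (x + \<beta> (real j * \<tau>))))"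
    by (rule exE)
  have p: "\<And>j. p j \<ge> 0" "(\<Sum>j<Suc n. p j) = (1::real)"
    "\<And>z \<tau> g x. (bin z \<tau> ^^ n) g x = (\<Sum>j<Suc n. of_real (p j) * z ^ j * g (x + \<beta> (real j * \<tau>)))"
    using P by (simp_all only:)
  define q where "q j = ((if j < Suc n then p j else 0) + (if j = 0 then 0 else p (j - 1))) / 2" for j
  have split: "(\<Sum>j<Suc (Suc n). of_real (q j) * F j) = ((\<Sum>j<Suc n. of_real (p j) * F j) + (\<Sum>j<Suc n. of_real (p j) * F (Suc j))) / 2"
    for F :: "nat \<Rightarrow> complex"
  proof -
    have "(\<Sum>j<Suc (Suc n). of_real (q j) * F j) = ((\<Sum>j<Suc (Suc n). of_real (if j < Suc n then p j else 0) * F j) +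
      (\<Sum>j<Suc (Suc n). of_real (if j = 0 then 0 else p (j - 1)) * F j)) / 2"
      by (simp only: sum.distrib[symmetric] sum_divide_distrib) (simp add: q_def add_divide_distrib distrib_right)
    also have "(\<Sum>j<Suc (Suc n). of_real (if j < Suc n then p j else 0) * F j) = (\<Sum>j<Suc n. of_real (p j) * F j)"
      by (subst sum.lessThan_Suc) simp
    also have "(\<Sum>j<Suc (Suc n). of_real (if j = 0 then 0 else p (j - 1)) * F j) = (\<Sum>j<Suc n. of_real (p j) * F (Suc j))"
      by (subst sum.lessThan_Suc_shift) simp
    finally show ?thesis .
  qed
  have "complex_of_real (\<Sum>j<Suc (Suc n). q j) = 1"
    using split[of "\<lambda>_. 1"] p(2) by (simp del: sum.lessThan_Suc flip: of_real_sum)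
  then have "(\<Sum>j<Suc (Suc n). q j) = 1" by (simp only: of_real_eq_1_iff)
  moreover have "q j \<ge> 0" for j using p(1) by (auto simp: q_def)
  moreover have "(bin z \<tau> ^^ Suc n) g x = (\<Sum>j<Suc (Suc n). of_real (q j) * z ^ j * g (x + \<beta> (real j * \<tau>)))" for z \<tau> g x
  proof -
    have sh: "x + \<beta> \<tau> + \<beta> (real j * \<tau>) = x + \<beta> (real (Suc j) * \<tau>)" for j
      by (simp add: add.assoc distrib_right flip: \<beta>_add)
    have "(bin z \<tau> ^^ Suc n) g x = ((bin z \<tau> ^^ n) g x + z * (bin z \<tau> ^^ n) g (x + \<beta> \<tau>)) / 2"
      by (simp add: bin_def)
    also have "z * (bin z \<tau> ^^ n) g (x + \<beta> \<tau>) = (\<Sum>j<Suc n. of_real (p j) * (z ^ Suc j * g (x + \<beta> (real (Suc j) * \<tau>))))"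
      unfolding p(3) sh sum_distrib_left by (intro sum.cong) (simp_all add: mult_ac)
    also have "(bin z \<tau> ^^ n) g x = (\<Sum>j<Suc n. of_real (p j) * (z ^ j * g (x + \<beta> (real j * \<tau>))))"
      unfolding p(3) by (simp add: mult_ac)
    finally show ?thesis
      using split[of "\<lambda>j. z ^ j * g (x + \<beta> (real j * \<tau>))"] by (simp only: mult.assoc)
  qed
  ultimately show ?case by blast
qed

definition energy :: "('g \<Rightarrow> complex) \<Rightarrow> real" where
  "energy g = (\<integral>x. (norm (g x))\<^sup>2 \<partial>m)"

definition ip :: "('g \<Rightarrow> complex) \<Rightarrow> ('g \<Rightarrow> complex) \<Rightarrow> complex" where
  "ip g h = (\<integral>x. g x * cnj (h x) \<partial>m)"

lemma ip_self: "ip g g = of_real (energy g)"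
  unfolding ip_def energy_def complex_norm_square[symmetric] by (rule integral_complex_of_real)

lemma energy_bin_le:
  assumes g: "continuous_on UNIV g" and z: "norm z = 1"
  shows "energy (bin z \<tau> g) \<le> energy g"
proof -
  have ct: "continuous_on UNIV (\<lambda>x. g (x + \<beta> \<tau>))" by (rule continuous_translate[OF g])
  have pt: "(norm (bin z \<tau> g x))\<^sup>2 \<le> (norm (g x))\<^sup>2 / 2 + (norm (g (x + \<beta> \<tau>)))\<^sup>2 / 2" for x
  proof -
    have "norm (bin z \<tau> g x) \<le> (norm (g x) + norm (g (x + \<beta> \<tau>))) / 2"
      using norm_triangle_ineq[of "g x" "z * g (x + \<beta> \<tau>)"] z by (simp add: bin_def norm_mult norm_divide)
    then have "(norm (bin z \<tau> g x))\<^sup>2 \<le> ((norm (g x) + norm (g (x + \<beta> \<tau>))) / 2)\<^sup>2"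
      by (intro power_mono) auto
    also have "\<dots> \<le> (norm (g x))\<^sup>2 / 2 + (norm (g (x + \<beta> \<tau>)))\<^sup>2 / 2"
      using sum_squares_bound[of "norm (g x)" "norm (g (x + \<beta> \<tau>))"] by (simp add: power2_eq_square field_simps)
    finally show ?thesis .
  qed
  have tr: "(\<integral>x. (norm (g (x + \<beta> \<tau>)))\<^sup>2 \<partial>m) = energy g"
    unfolding energy_def
    by (rule integral_translate[of "\<lambda>x. (norm (g x))\<^sup>2"]) (intro borel_measurable_continuous_onI continuous_intros g)
  have "energy (bin z \<tau> g) \<le> (\<integral>x. (norm (g x))\<^sup>2 / 2 + (norm (g (x + \<beta> \<tau>)))\<^sup>2 / 2 \<partial>m)"
    unfolding energy_def
    by (intro integral_mono pt continuous_integrable continuous_intros g ct continuous_bin) auto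
  also have "\<dots> = energy g / 2 + energy g / 2"
    by (subst Bochner_Integration.integral_add)
       (auto intro!: continuous_integrable continuous_intros g ct simp: tr energy_def[symmetric])
  finally show ?thesis by simp
qed

lemma energy_bin_pow_antimono:
  assumes g: "continuous_on UNIV g" and z: "norm z = 1" and "n \<le> n'"
  shows "energy ((bin z \<tau> ^^ n') g) \<le> energy ((bin z \<tau> ^^ n) g)"
  using \<open>n \<le> n'\<close>
proof (induction n' rule: dec_induct)
  case (step k)
  have "energy ((bin z \<tau> ^^ Suc k) g) \<le> energy ((bin z \<tau> ^^ k) g)"
    using energy_bin_le[OF continuous_bin_pow[OF g] z] by simp
  then show ?case using step by simp
qed simp

lemma ip_bin_adjoint:
  assumes g: "continuous_on UNIV g" and h: "continuous_on UNIV h"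
  shows "ip (bin z \<tau> g) h = ip g (bin (cnj z) (- \<tau>) h)"
proof -
  note ct = continuous_translate[OF g] continuous_translate[OF h]
  have ct': "continuous_on UNIV (\<lambda>x. h (x - \<beta> \<tau>))" using ct(2)[of "- \<beta> \<tau>"] by simp
  have "(\<lambda>x. g x * cnj (h (x - \<beta> \<tau>))) \<in> borel_measurable borel"
    by (intro borel_measurable_continuous_onI continuous_intros ct' g)
  from integral_translate[OF this, of "\<beta> \<tau>"]
  have tr: "(\<integral>x. g (x + \<beta> \<tau>) * cnj (h x) \<partial>m) = (\<integral>x. g x * cnj (h (x - \<beta> \<tau>)) \<partial>m)"
    by simp
  have "ip (bin z \<tau> g) h = (\<integral>x. g x * cnj (h x) / 2 + z / 2 * (g (x + \<beta> \<tau>) * cnj (h x)) \<partial>m)"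
    unfolding ip_def bin_def by (simp add: field_simps)
  also have "\<dots> = (\<integral>x. g x * cnj (h x) / 2 \<partial>m) + z / 2 * (\<integral>x. g (x + \<beta> \<tau>) * cnj (h x) \<partial>m)"
    by (subst Bochner_Integration.integral_add) (auto intro!: continuous_integrable continuous_intros g h ct)
  also have "\<dots> = (\<integral>x. g x * cnj (h x) / 2 \<partial>m) + (\<integral>x. z / 2 * (g x * cnj (h (x - \<beta> \<tau>))) \<partial>m)"
    unfolding tr by simp
  also have "\<dots> = (\<integral>x. g x * cnj (h x) / 2 + z / 2 * (g x * cnj (h (x - \<beta> \<tau>))) \<partial>m)"
    by (subst Bochner_Integration.integral_add) (auto intro!: continuous_integrable continuous_intros g h ct')
  also have "\<dots> = ip g (bin (cnj z) (- \<tau>) h)"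
    unfolding ip_def bin_def by (simp add: field_simps \<beta>_minus)
  finally show ?thesis .
qed

lemma ip_bin_pow_adjoint:
  assumes g: "continuous_on UNIV g" and h: "continuous_on UNIV h"
  shows "ip ((bin z \<tau> ^^ n) g) h = ip g ((bin (cnj z) (- \<tau>) ^^ n) h)"
  using h
proof (induction n arbitrary: h)
  case (Suc n)
  have "ip ((bin z \<tau> ^^ Suc n) g) h = ip ((bin z \<tau> ^^ n) g) (bin (cnj z) (- \<tau>) h)"
    using ip_bin_adjoint[OF continuous_bin_pow[OF g] Suc.prems] by simp
  also have "\<dots> = ip g ((bin (cnj z) (- \<tau>) ^^ n) (bin (cnj z) (- \<tau>) h))"
    by (rule Suc.IH[OF continuous_bin[OF Suc.prems]])
  finally show ?case by (simp add: funpow_swap1)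
qed simp

text \<open>The adjoint of \<open>bin z \<tau>\<close> is \<open>bin (cnj z) (- \<tau>)\<close>, so this is the positive operator $(B^n)^* B^n$.\<close>
definition bsq :: "complex \<Rightarrow> real \<Rightarrow> nat \<Rightarrow> ('g \<Rightarrow> complex) \<Rightarrow> 'g \<Rightarrow> complex" where
  "bsq z \<tau> n g = (bin (cnj z) (- \<tau>) ^^ n) ((bin z \<tau> ^^ n) g)"

lemma continuous_bsq: "continuous_on UNIV g \<Longrightarrow> continuous_on UNIV (bsq z \<tau> n g)"
  unfolding bsq_def by (intro continuous_bin_pow)

lemma bin_pow_pow_commute: "(bin z \<tau> ^^ n) ((bin z' \<tau>' ^^ k) g) = (bin z' \<tau>' ^^ k) ((bin z \<tau> ^^ n) g)"
  by (induction n) (simp_all add: bin_pow_commute[where z = z and \<tau> = \<tau> and z' = z' and \<tau>' = \<tau>'])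

lemma bsq_Suc: "bsq z \<tau> (Suc n) g = bin (cnj z) (- \<tau>) (bin z \<tau> (bsq z \<tau> n g))"
  unfolding bsq_def by (simp add: bin_pow_commute[where z = z and \<tau> = \<tau> and z' = "cnj z" and \<tau>' = "- \<tau>", symmetric])

lemma ip_bsq_bsq:
  assumes g: "continuous_on UNIV g"
  shows "ip (bsq z \<tau> n g) (bsq z \<tau> k g) = of_real (energy ((bin z \<tau> ^^ (n + k)) g))"
proof -
  let ?B = "bin z \<tau>" and ?A = "bin (cnj z) (- \<tau>)"
  note c = continuous_bin_pow
  have "ip (bsq z \<tau> n g) (bsq z \<tau> k g) = ip ((?A ^^ n) ((?B ^^ n) g)) ((?A ^^ k) ((?B ^^ k) g))"
    by (simp add: bsq_def)
  also have "\<dots> = ip ((?B ^^ k) ((?A ^^ n) ((?B ^^ n) g))) ((?B ^^ k) g)"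
    by (rule ip_bin_pow_adjoint[symmetric]) (intro c g)+
  also have "\<dots> = ip ((?A ^^ n) ((?B ^^ k) ((?B ^^ n) g))) ((?B ^^ k) g)"
    by (simp only: bin_pow_pow_commute[where z = z and \<tau> = \<tau> and z' = "cnj z" and \<tau>' = "- \<tau>"])
  also have "\<dots> = ip ((?B ^^ k) ((?B ^^ n) g)) ((?B ^^ n) ((?B ^^ k) g))"
    using ip_bin_pow_adjoint[where g = "(?B ^^ k) ((?B ^^ n) g)" and h = "(?B ^^ k) g" and z = "cnj z" and \<tau> = "- \<tau>" and n = n] g
    by (simp add: c)
  also have "(?B ^^ n) ((?B ^^ k) g) = (?B ^^ (n + k)) g" by (simp add: funpow_add)
  also have "(?B ^^ k) ((?B ^^ n) g) = (?B ^^ (n + k)) g" by (simp add: funpow_add add.commute[of n])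
  finally show ?thesis by (simp add: ip_self)
qed

lemma ip_diff_self:
  assumes g: "continuous_on UNIV g" and h: "continuous_on UNIV h"
  shows "energy (\<lambda>x. g x - h x) = energy g + energy h - 2 * Re (ip g h)"
proof -
  have "(norm (g x - h x))\<^sup>2 = (norm (g x))\<^sup>2 + (norm (h x))\<^sup>2 - 2 * Re (g x * cnj (h x))" for x
    unfolding cmod_power2 by (simp add: power2_eq_square algebra_simps)
  then have "energy (\<lambda>x. g x - h x) = (\<integral>x. (norm (g x))\<^sup>2 + (norm (h x))\<^sup>2 - 2 * Re (g x * cnj (h x)) \<partial>m)"
    by (simp add: energy_def)
  also have "\<dots> = energy g + energy h - 2 * (\<integral>x. Re (g x * cnj (h x)) \<partial>m)"
  proof -
    have i: "integrable m (\<lambda>x. (norm (g x))\<^sup>2)" "integrable m (\<lambda>x. (norm (h x))\<^sup>2)"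
      "integrable m (\<lambda>x. Re (g x * cnj (h x)))"
      by (intro continuous_integrable continuous_intros g h)+
    show ?thesis unfolding energy_def using i by (simp del: times_complex.simps)
  qed
  also have "(\<integral>x. Re (g x * cnj (h x)) \<partial>m) = Re (ip g h)"
    unfolding ip_def by (intro integral_Re continuous_integrable continuous_intros g h)
  finally show ?thesis .
qed

text \<open>Since the operators commute, the distance between two members of the sequence \<open>bsq z \<tau> n g\<close> is
  expressed by the decreasing sequence of energies, so that the sequence is Cauchy in mean square.\<close>
lemma energy_bsq_diff:
  assumes g: "continuous_on UNIV g"
  shows "energy (\<lambda>x. bsq z \<tau> n g x - bsq z \<tau> k g x) =
    energy ((bin z \<tau> ^^ (2 * n)) g) + energy ((bin z \<tau> ^^ (2 * k)) g) - 2 * energy ((bin z \<tau> ^^ (n + k)) g)"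
proof -
  have e: "energy (bsq z \<tau> n g) = energy ((bin z \<tau> ^^ (2 * n)) g)" for n
    using ip_bsq_bsq[OF g, of z \<tau> n n] by (simp add: ip_self mult_2)
  show ?thesis
    unfolding ip_diff_self[OF continuous_bsq[OF g] continuous_bsq[OF g]] ip_bsq_bsq[OF g] e by simp
qed

lemma corr_bin:
  assumes g: "continuous_on UNIV g" and f: "integrable m f"
  shows "corr (bin z \<tau> g) f = bin z \<tau> (corr g f)"
proof
  fix x
  have "corr (bin z \<tau> g) f x = (\<integral>y. g (y + x) * cnj (f y) / 2 + z / 2 * (g (y + (x + \<beta> \<tau>)) * cnj (f y)) \<partial>m)"
    unfolding corr_def bin_def by (simp add: field_simps add.assoc)
  also have "\<dots> = (\<integral>y. g (y + x) * cnj (f y) / 2 \<partial>m) + (\<integral>y. z / 2 * (g (y + (x + \<beta> \<tau>)) * cnj (f y)) \<partial>m)"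
    by (intro Bochner_Integration.integral_add integrable_divide integrable_mult_right integrable_corr[OF g f])
  also have "\<dots> = bin z \<tau> (corr g f) x"
    unfolding bin_def corr_def by (simp add: add_divide_distrib)
  finally show "corr (bin z \<tau> g) f x = bin z \<tau> (corr g f) x" .
qed

lemma corr_bsq:
  assumes g: "continuous_on UNIV g" and f: "integrable m f"
  shows "corr (bsq z \<tau> n g) f = bsq z \<tau> n (corr g f)"
proof (induction n)
  case (Suc n)
  then show ?case
    unfolding bsq_Suc by (simp add: corr_bin[OF continuous_bin[OF continuous_bsq[OF g]] f] corr_bin[OF continuous_bsq[OF g] f])
qed (simp add: bsq_def)

text \<open>Young's inequality; correlation with \<open>f\<close> turns convergence in mean square into uniform
  convergence.\<close>
lemma corr_diff_le:
  assumes g: "continuous_on UNIV g" and h: "continuous_on UNIV h" and f: "continuous_on UNIV f" and t: "t > 0"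
  shows "norm (corr g f x - corr h f x) \<le> (t * energy (\<lambda>x. g x - h x) + energy f / t) / 2"
proof -
  note ct = continuous_translate[OF g] continuous_translate[OF h]
  have fi: "integrable m f" by (rule continuous_integrable[OF f])
  have "corr g f x - corr h f x = (\<integral>y. (g (y + x) - h (y + x)) * cnj (f y) \<partial>m)"
    unfolding corr_def using integrable_corr[OF g fi] integrable_corr[OF h fi] by (simp add: left_diff_distrib)
  also have "norm \<dots> \<le> (\<integral>y. norm ((g (y + x) - h (y + x)) * cnj (f y)) \<partial>m)"
    by (rule integral_norm_bound)
  also have "\<dots> \<le> (\<integral>y. t / 2 * (norm (g (y + x) - h (y + x)))\<^sup>2 + 1 / (2 * t) * (norm (f y))\<^sup>2 \<partial>m)"
  proof (rule integral_mono)
    show "norm ((g (y + x) - h (y + x)) * cnj (f y)) \<le> t / 2 * (norm (g (y + x) - h (y + x)))\<^sup>2 + 1 / (2 * t) * (norm (f y))\<^sup>2" for y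
    proof -
      have "0 \<le> (t * a - b)\<^sup>2 / (2 * t)" for a b using t by simp
      then have "a * b \<le> t / 2 * a\<^sup>2 + 1 / (2 * t) * b\<^sup>2" for a b
        using t by (simp add: power2_eq_square field_simps)
      then show ?thesis by (simp add: norm_mult)
    qed
  qed (intro continuous_integrable continuous_intros ct f)+
  also have "\<dots> = t / 2 * (\<integral>y. (norm (g (y + x) - h (y + x)))\<^sup>2 \<partial>m) + 1 / (2 * t) * energy f"
  proof -
    have "integrable m (\<lambda>y. (norm (g (y + x) - h (y + x)))\<^sup>2)" "integrable m (\<lambda>y. (norm (f y))\<^sup>2)"
      by (intro continuous_integrable continuous_intros ct f)+
    then show ?thesis unfolding energy_def by simp
  qed
  also have "(\<integral>y. (norm (g (y + x) - h (y + x)))\<^sup>2 \<partial>m) = energy (\<lambda>x. g x - h x)"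
    unfolding energy_def
    by (rule integral_translate[of "\<lambda>y. (norm (g y - h y))\<^sup>2"]) (intro borel_measurable_continuous_onI continuous_intros g h)
  finally show ?thesis by (simp add: field_simps)
qed

end

section \<open>Characters from eigenfunctions\<close>

context haar_flow
begin

text \<open>The functions \<open>bsq z \<tau> n (corr f f)\<close> are the correlations of \<open>bsq z \<tau> n f\<close> with \<open>f\<close>, hence uniformly Cauchy,
  and at 0 they take the values \<open>energy ((bin z \<tau> ^^ n) f)\<close>, which stay above \<open>c\<close>. The limit is fixed by $B^* B$,
  which says that \<open>h\<close> is an arithmetic progression along each orbit of the unitary operator; being bounded, the
  progression is constant.\<close>
lemma limit_eigenfunction:
  assumes f: "continuous_on UNIV f" and z: "norm z = 1" and c: "c > 0"
    and ec: "\<And>n. energy ((bin z \<tau> ^^ n) f) \<ge> c"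
  obtains h where "uniform_limit UNIV (\<lambda>n. bsq z \<tau> n (corr f f)) h sequentially"
    "continuous_on UNIV h" "Re (h 0) \<ge> c" "\<And>x. z * h (x + \<beta> \<tau>) = h x"
proof -
  define \<alpha> where "\<alpha> n = energy ((bin z \<tau> ^^ n) f)" for n
  define hn where "hn n = bsq z \<tau> n (corr f f)" for n
  have fi: "integrable m f" by (rule continuous_integrable[OF f])
  have hn_corr: "hn n = corr (bsq z \<tau> n f) f" for n
    unfolding hn_def corr_bsq[OF f fi] ..
  have "decseq \<alpha>"
    unfolding decseq_def \<alpha>_def using energy_bin_pow_antimono[OF f z] by blast
  moreover have "\<forall>n. 0 \<le> \<alpha> n"
    using c ec by (auto simp: \<alpha>_def intro: order_trans[of 0 c])
  ultimately obtain A where A: "\<alpha> \<longlonglongrightarrow> A"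
    using decseq_convergent by metis
  have E: "energy f > 0" using ec[of 0] c by simp
  have cauchy: "uniformly_Cauchy_on UNIV hn"
    unfolding uniformly_Cauchy_on_def
  proof (intro allI impI)
    fix e :: real assume e: "e > 0"
    \<comment> \<open>This weight makes the second term in \<open>corr_diff_le\<close> equal to \<open>e / 4\<close>.\<close>
    define t where "t = 2 * energy f / e"
    have t: "t > 0" using E e by (simp add: t_def)
    have "e / (8 * t) > 0" using e t by simp
    then obtain N where N: "\<And>n. n \<ge> N \<Longrightarrow> \<bar>\<alpha> n - A\<bar> < e / (8 * t)"
      using LIMSEQ_D[OF A, of "e / (8 * t)"] by auto
    have "dist (hn n x) (hn k x) < e" if "n \<ge> N" "k \<ge> N" for n k x
    proof -
      define D where "D = \<alpha> (2 * n) + \<alpha> (2 * k) - 2 * \<alpha> (n + k)"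
      have "D = energy (\<lambda>x. bsq z \<tau> n f x - bsq z \<tau> k f x)"
        unfolding energy_bsq_diff[OF f] by (simp add: D_def \<alpha>_def)
      then have 1: "dist (hn n x) (hn k x) \<le> (t * D + energy f / t) / 2"
        unfolding hn_corr dist_norm using corr_diff_le[OF continuous_bsq[OF f] continuous_bsq[OF f] f t] by simp
      have "D < 4 * (e / (8 * t))"
        using N[of "2 * n"] N[of "2 * k"] N[of "n + k"] that by (simp add: D_def)
      then have "t * D < t * (4 * (e / (8 * t)))" using t by (rule mult_strict_left_mono)
      also have "\<dots> = e / 2" using t by simp
      finally have "t * D < e / 2" .
      moreover have "energy f / t = e / 2" using E e by (simp add: t_def)
      ultimately show ?thesis using 1 e by simp
    qed
    then show "\<exists>M. \<forall>x\<in>UNIV. \<forall>n\<ge>M. \<forall>k\<ge>M. dist (hn n x) (hn k x) < e" by blast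
  qed
  then obtain h where h: "uniform_limit UNIV hn h sequentially"
    using Cauchy_uniformly_convergent uniformly_convergent_on_def by blast
  have hn_cont: "continuous_on UNIV (hn n)" for n
    unfolding hn_def by (intro continuous_bsq continuous_corr f fi)
  have h_cont: "continuous_on UNIV h"
    by (rule uniform_limit_theorem[OF _ h]) (auto simp: hn_cont)
  have ptw: "(\<lambda>n. hn n x) \<longlonglongrightarrow> h x" for x
    using tendsto_uniform_limitI[OF h] by simp
  have hn0: "hn n 0 = of_real (\<alpha> n)" for n
  proof -
    have "hn n 0 = ip (bsq z \<tau> n f) (bsq z \<tau> 0 f)" unfolding hn_corr corr_def ip_def by (simp add: bsq_def)
    then show ?thesis unfolding ip_bsq_bsq[OF f] by (simp add: \<alpha>_def)
  qed
  have "Re (h 0) \<ge> c"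
  proof (rule LIMSEQ_le_const)
    show "(\<lambda>n. Re (hn n 0)) \<longlonglongrightarrow> Re (h 0)" by (intro tendsto_intros ptw)
  qed (use ec hn0 in \<open>auto simp: \<alpha>_def\<close>)
  have fixpt: "h x = bin (cnj z) (- \<tau>) (bin z \<tau> h) x" for x
  proof (rule LIMSEQ_unique)
    show "(\<lambda>n. hn (Suc n) x) \<longlonglongrightarrow> h x" using ptw by (rule LIMSEQ_Suc)
    show "(\<lambda>n. hn (Suc n) x) \<longlonglongrightarrow> bin (cnj z) (- \<tau>) (bin z \<tau> h) x"
      unfolding hn_def bsq_Suc unfolding bin_def
      by (intro tendsto_intros ptw[unfolded hn_def]) auto
  qed
  have zz: "cnj z * z = 1" using z by (simp add: mult.commute flip: complex_norm_square)
  have second: "2 * h x = z * h (x + \<beta> \<tau>) + cnj z * h (x - \<beta> \<tau>)" for x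
  proof -
    have "cnj z * ((h (x - \<beta> \<tau>) + z * h x) / 2) = (cnj z * h (x - \<beta> \<tau>) + (cnj z * z) * h x) / 2"
      by (simp add: distrib_left mult.assoc)
    moreover have "h x = ((h x + z * h (x + \<beta> \<tau>)) / 2 + cnj z * ((h (x - \<beta> \<tau>) + z * h x) / 2)) / 2"
      by (rule trans[OF fixpt]) (simp add: bin_def \<beta>_minus)
    ultimately have "h x = ((h x + z * h (x + \<beta> \<tau>)) / 2 + (cnj z * h (x - \<beta> \<tau>) + h x) / 2) / 2"
      unfolding zz by simp
    then show ?thesis
      by (simp only: add_divide_distrib[symmetric] divide_divide_eq_left) (simp add: eq_divide_eq)
  qed
  \<comment> \<open>The increment of the progression \<open>z ^ n * h (x + \<beta> (real n * \<tau>))\<close>.\<close>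
  define d where "d x = z * h (x + \<beta> \<tau>) - h x" for x
  have dz: "z * d (x + \<beta> \<tau>) = d x" for x
  proof -
    have "d (x + \<beta> \<tau>) = h (x + \<beta> \<tau>) - cnj z * h x"
      using second[of "x + \<beta> \<tau>"] by (simp add: d_def algebra_simps)
    then have "z * d (x + \<beta> \<tau>) = z * (h (x + \<beta> \<tau>) - cnj z * h x)" by simp
    also have "\<dots> = z * h (x + \<beta> \<tau>) - (cnj z * z) * h x" by (simp add: right_diff_distrib mult_ac)
    finally have "z * d (x + \<beta> \<tau>) = z * h (x + \<beta> \<tau>) - (cnj z * z) * h x" .
    then show ?thesis unfolding zz by (simp add: d_def)
  qed
  have growth: "z ^ n * h (x + \<beta> (real n * \<tau>)) = h x + of_nat n * d x \<and> z ^ n * d (x + \<beta> (real n * \<tau>)) = d x" for n x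
  proof (induction n)
    case (Suc n)
    define y where "y = x + \<beta> (real n * \<tau>)"
    have y: "x + \<beta> (real (Suc n) * \<tau>) = y + \<beta> \<tau>"
      by (simp add: y_def add.assoc distrib_right add.commute flip: \<beta>_add)
    have 1: "z ^ Suc n * h (y + \<beta> \<tau>) = z ^ n * h y + z ^ n * d y" by (simp add: d_def algebra_simps)
    have 2: "z ^ Suc n * d (y + \<beta> \<tau>) = z ^ n * d y" using dz[of y] by (metis mult.assoc power_Suc2)
    have 3: "z ^ n * h y = h x + of_nat n * d x" "z ^ n * d y = d x" using Suc by (simp_all add: y_def)
    show ?case unfolding y 1 2 3 by (simp add: algebra_simps)
  qed simp
  have "bounded (range h)" using compact_continuous_image[OF h_cont compact_UNIV] compact_imp_bounded by blast
  then obtain K where K: "\<And>x. norm (h x) \<le> K" unfolding bounded_iff by auto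
  have "d x = 0" for x
  proof (rule ccontr)
    assume "d x \<noteq> 0"
    then obtain n where n: "real n * norm (d x) > 2 * K"
      using ex_less_of_nat_mult[of "norm (d x)" "2 * K"] by auto
    have "of_nat n * d x = z ^ n * h (x + \<beta> (real n * \<tau>)) - h x" using growth[of n x] by simp
    then have "real n * norm (d x) = norm (z ^ n * h (x + \<beta> (real n * \<tau>)) - h x)"
      by (metis norm_mult norm_of_nat)
    also have "\<dots> \<le> norm (z ^ n * h (x + \<beta> (real n * \<tau>))) + norm (h x)" by (rule norm_triangle_ineq4)
    also have "\<dots> \<le> K + K" using K z by (intro add_mono) (auto simp: norm_mult norm_power)
    finally show False using n by simp
  qed
  then have "z * h (x + \<beta> \<tau>) = h x" for x by (simp add: d_def)
  with h h_cont \<open>Re (h 0) \<ge> c\<close> that show ?thesis unfolding hn_def by blast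
qed

lemma norm_cis_minus_one_mono:
  assumes "\<bar>\<theta>\<bar> \<le> pi" "0 \<le> s" "s \<le> 1"
  shows "norm (cis (\<theta> * s) - 1) \<le> norm (cis \<theta> - 1)"
proof -
  have sq: "(norm (cis \<phi> - 1))\<^sup>2 = 2 - 2 * cos \<phi>" for \<phi>
    using sin_cos_squared_add[of \<phi>] unfolding cmod_power2 by (simp add: power2_eq_square algebra_simps)
  have "cos \<bar>\<theta>\<bar> \<le> cos \<bar>\<theta> * s\<bar>"
    using assms by (intro cos_monotone_0_pi_le) (auto simp: abs_mult mult_left_le)
  then have "(norm (cis (\<theta> * s) - 1))\<^sup>2 \<le> (norm (cis \<theta> - 1))\<^sup>2" unfolding sq by simp
  then show ?thesis by (rule power2_le_imp_le) simp
qed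

lemma character_from_density:
  assumes c: "continuous_on UNIV \<gamma>" and ne: "\<And>t. norm (\<gamma> (\<beta> t)) = 1"
    and mul: "\<And>x t. \<gamma> (x + \<beta> t) = \<gamma> x * \<gamma> (\<beta> t)"
  shows "group_character \<gamma>"
proof -
  have "norm (\<gamma> x) = 1" for x
  proof -
    have "closed {x. norm (\<gamma> x) = 1}" by (intro closed_Collect_eq continuous_intros c)
    moreover have "range \<beta> \<subseteq> {x. norm (\<gamma> x) = 1}" using ne by auto
    ultimately have "closure (range \<beta>) \<subseteq> {x. norm (\<gamma> x) = 1}" by (rule closure_minimal[rotated])
    then show ?thesis using dense by auto
  qed
  moreover have "\<gamma> (x + y) = \<gamma> x * \<gamma> y" for x y
  proof -
    have "continuous_on UNIV (\<lambda>y. \<gamma> (x + y))"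
      by (rule continuous_on_compose2[OF c]) (auto intro!: continuous_intros)
    then have "closed {y. \<gamma> (x + y) = \<gamma> x * \<gamma> y}" by (intro closed_Collect_eq continuous_intros c)
    moreover have "range \<beta> \<subseteq> {y. \<gamma> (x + y) = \<gamma> x * \<gamma> y}" using mul by auto
    ultimately have "closure (range \<beta>) \<subseteq> {y. \<gamma> (x + y) = \<gamma> x * \<gamma> y}" by (rule closure_minimal[rotated])
    then show ?thesis using dense by auto
  qed
  ultimately show ?thesis using c by (simp add: group_character_def)
qed

lemma dirichlet_rescale:
  assumes "\<tau> \<noteq> 0"
  shows "haar_flow (\<lambda>s. \<beta> (\<tau> * s)) m"
proof
  have "range (\<lambda>s. \<beta> (\<tau> * s)) = range \<beta>"
  proof (intro subset_antisym subsetI)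
    fix x assume "x \<in> range \<beta>"
    then obtain t where "x = \<beta> t" by auto
    then have "x = \<beta> (\<tau> * (t / \<tau>))" using assms by simp
    then show "x \<in> range (\<lambda>s. \<beta> (\<tau> * s))" by blast
  qed auto
  moreover have "continuous_on UNIV (\<lambda>s. \<beta> (\<tau> * s))"
    by (rule continuous_on_compose2[OF cont_\<beta>]) (auto intro!: continuous_intros)
  ultimately show "dirichlet_group (\<lambda>s. \<beta> (\<tau> * s))"
    unfolding dirichlet_group_def using compact_UNIV dense by (simp add: distrib_left \<beta>_add)
qed (rule haar)

lemma periodic_integral_shift:
  fixes F :: "real \<Rightarrow> complex"
  assumes c: "continuous_on UNIV F" and per: "\<And>s. F (s + 1) = F s" and r: "0 \<le> r" "r \<le> 1"
  shows "integral {0..1} (\<lambda>s. F (s + r)) = integral {0..1} F"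
proof -
  have cs: "continuous_on S F" for S by (rule continuous_on_subset[OF c]) simp
  have i: "F integrable_on {a..b}" for a b by (intro integrable_continuous_real cs)
  have "integral {0..1} (\<lambda>s. F (s + r)) = integral {r..1 + r} F"
    using integral_shift[OF cs, of 0 1 r] by (simp add: o_def add.commute)
  also have "\<dots> = integral {r..1} F + integral {1..1 + r} F"
    by (rule Henstock_Kurzweil_Integration.integral_combine[symmetric, OF _ _ i]) (use r in auto)
  also have "integral {1..1 + r} F = integral {0..r} F"
    using integral_shift[OF cs, of 0 r 1] by (simp add: o_def per add.commute)
  also have "integral {r..1} F + integral {0..r} F = integral {0..1} F"
    using Henstock_Kurzweil_Integration.integral_combine[of 0 r 1 F] r i by (simp add: add.commute)
  finally show ?thesis .
qed

text \<open>The hypothesis concerns translation by the single element \<open>\<beta> \<tau>\<close>. The integrand of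
  \<open>H x = integral {0..1} (\<lambda>s. cis (\<theta> * s) * h (x + \<beta> (\<tau> * s)))\<close> is 1-periodic, so \<open>H\<close> is an eigenfunction of the
  whole flow and, as the flow is dense, a multiple of a character; slow variation of \<open>h\<close> near 0 forces
  \<open>\<theta>\<close> to be small and prevents cancellation in \<open>H 0\<close>. The character has a nonzero coefficient in \<open>H\<close>, which is an
  average of translates of \<open>h\<close>.\<close>
lemma character_of_eigenfunction:
  assumes h: "continuous_on UNIV h" and \<tau>: "\<tau> \<noteq> 0" and \<theta>: "\<bar>\<theta>\<bar> \<le> pi"
    and eig: "\<And>x. cis \<theta> * h (x + \<beta> \<tau>) = h x"
    and h0: "h 0 \<noteq> 0" and slow: "\<And>s. 0 \<le> s \<Longrightarrow> s \<le> 1 \<Longrightarrow> norm (h (\<beta> (\<tau> * s)) - h 0) \<le> norm (h 0) / 3"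
  shows "\<exists>\<gamma>. group_character \<gamma> \<and> fourier_coeff m h \<gamma> \<noteq> 0"
proof -
  define b where "b s = \<beta> (\<tau> * s)" for s
  have hf: "haar_flow b m" using dirichlet_rescale[OF \<tau>] by (simp add: b_def[abs_def])
  interpret F: flow_average b m unif01 "\<lambda>s. cis (\<theta> * s)"
    by (intro flow_average.intro hf prob_space_unif01 flow_average_axioms.intro)
       (auto intro!: borel_measurable_continuous_onI continuous_intros)
  define H where "H = F.avg h"
  have b_add: "b (s + t) = b s + b t" for s t by (rule F.\<beta>_add)
  have cF: "continuous_on UNIV (\<lambda>s. cis (\<theta> * s) * h (x + b s))" for x
    by (intro continuous_intros continuous_on_compose2[OF h] continuous_on_compose2[OF F.cont_\<beta>]) auto
  have H_eq: "H x = (\<integral>s. cis (\<theta> * s) * h (x + b s) \<partial>unif01)" for x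
    by (simp add: H_def flow_avg_def)
  have H_int: "H x = integral {0..1} (\<lambda>s. cis (\<theta> * s) * h (x + b s))" for x
    unfolding H_eq by (rule integral_unif01[OF cF])
  have b1: "b 1 = \<beta> \<tau>" by (simp add: b_def)
  have per: "cis (\<theta> * (s + 1)) * h (x + b (s + 1)) = cis (\<theta> * s) * h (x + b s)" for s x
  proof -
    have "cis (\<theta> * (s + 1)) * h (x + b (s + 1)) = cis (\<theta> * s) * (cis \<theta> * h ((x + b s) + \<beta> \<tau>))"
      by (simp add: b_add b1 distrib_left add.assoc flip: cis_mult)
    then show ?thesis unfolding eig .
  qed
  define E where "E r \<longleftrightarrow> (\<forall>x. cis (\<theta> * r) * H (x + b r) = H x)" for r
  have E01: "E r" if "0 \<le> r" "r \<le> 1" for r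
    unfolding E_def
  proof
    fix x
    have "cis (\<theta> * r) * H (x + b r) = integral {0..1} (\<lambda>s. cis (\<theta> * r) * (cis (\<theta> * s) * h (x + b r + b s)))"
      unfolding H_int by (rule integral_mult_right[symmetric])
    also have "\<dots> = integral {0..1} (\<lambda>s. cis (\<theta> * (s + r)) * h (x + b (s + r)))"
      by (intro arg_cong[of _ _ "integral {0..1}"] ext) (simp add: b_add distrib_left add_ac flip: cis_mult)
    also have "\<dots> = H x"
      unfolding H_int using periodic_integral_shift[OF cF per that] .
    finally show "cis (\<theta> * r) * H (x + b r) = H x" .
  qed
  have E_mult: "E (real n * r)" if "E r" for n r
  proof (induction n)
    case 0 show ?case by (simp add: E_def)
  next
    case (Suc n)
    show ?case unfolding E_def
    proof
      fix x
      have "cis (\<theta> * (real (Suc n) * r)) * H (x + b (real (Suc n) * r)) =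
        cis (\<theta> * (real n * r)) * (cis (\<theta> * r) * H ((x + b (real n * r)) + b r))"
        by (simp add: distrib_left distrib_right b_add add_ac mult_ac flip: cis_mult)
      also have "\<dots> = H x" using that Suc unfolding E_def by simp
      finally show "cis (\<theta> * (real (Suc n) * r)) * H (x + b (real (Suc n) * r)) = H x" .
    qed
  qed
  have E_nonneg: "E r" if "r \<ge> 0" for r
  proof -
    define n where "n = Suc (nat \<lceil>r\<rceil>)"
    have n: "n > 0" "r \<le> real n" by (auto simp: n_def) linarith
    then have "E (real n * (r / real n))" using that by (intro E_mult E01) (auto simp: field_simps)
    then show ?thesis using n by simp
  qed
  have Eall: "cis (\<theta> * r) * H (x + b r) = H x" for r x
  proof (cases "r \<ge> 0")
    case False
    then have "cis (\<theta> * (- r)) * H ((x + b r) + b (- r)) = H (x + b r)" using E_nonneg[of "- r"] unfolding E_def by simp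
    then have "cis (\<theta> * r) * (cis (\<theta> * (- r)) * H x) = cis (\<theta> * r) * H (x + b r)" by (simp add: F.\<beta>_minus)
    moreover have "cis (\<theta> * r) * (cis (\<theta> * (- r)) * H x) = H x" by (simp add: cis_mult flip: mult.assoc)
    ultimately show ?thesis by simp
  qed (use E_nonneg E_def in blast)
  have H0: "H 0 \<noteq> 0"
  proof -
    have c1: "norm (cis \<theta> - 1) \<le> 1 / 3"
    proof -
      have "h 0 = cis \<theta> * h (\<beta> (\<tau> * 1))" using eig[of 0] by simp
      then have "h (\<beta> (\<tau> * 1)) - h 0 = (1 - cis \<theta>) * h (\<beta> (\<tau> * 1))" by (simp add: algebra_simps)
      moreover have "norm (h (\<beta> (\<tau> * 1))) = norm (h 0)" using arg_cong[OF \<open>h 0 = _\<close>, of norm] by (simp add: norm_mult)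
      ultimately have "norm (1 - cis \<theta>) * norm (h 0) \<le> norm (h 0) / 3" using slow[of 1] by (simp add: norm_mult)
      then show ?thesis using h0 by (simp add: norm_minus_commute field_simps)
    qed
    have pt: "norm (cis (\<theta> * s) * h (0 + b s) - h 0) \<le> 2 / 3 * norm (h 0)" if "s \<in> {0<..<1}" for s
    proof -
      have "cis (\<theta> * s) * h (0 + b s) - h 0 = cis (\<theta> * s) * (h (b s) - h 0) + (cis (\<theta> * s) - 1) * h 0"
        by (simp add: algebra_simps)
      also have "norm \<dots> \<le> norm (h (b s) - h 0) + norm (cis (\<theta> * s) - 1) * norm (h 0)"
        using norm_triangle_ineq by (metis (no_types, lifting) mult_1 norm_cis norm_mult)
      also have "\<dots> \<le> norm (h 0) / 3 + 1 / 3 * norm (h 0)"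
        using slow[of s] that norm_cis_minus_one_mono[OF \<theta>, of s] c1
        by (intro add_mono mult_right_mono) (auto simp: b_def)
      finally show ?thesis by simp
    qed
    have i: "integrable unif01 (\<lambda>s. cis (\<theta> * s) * h (0 + b s))" by (rule unif01_integrable_cont[OF cF])
    have "H 0 - h 0 = (\<integral>s. cis (\<theta> * s) * h (0 + b s) - h 0 \<partial>unif01)"
      unfolding H_eq using i by simp
    also have "norm \<dots> \<le> (\<integral>s. norm (cis (\<theta> * s) * h (0 + b s) - h 0) \<partial>unif01)" by (rule integral_norm_bound)
    also have "\<dots> \<le> (\<integral>s. 2 / 3 * norm (h 0) \<partial>unif01)"
    proof (rule integral_mono_AE)
      show "AE s in unif01. norm (cis (\<theta> * s) * h (0 + b s) - h 0) \<le> 2 / 3 * norm (h 0)"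
        using AE_unif01 by eventually_elim (rule pt)
    qed (use i in auto)
    finally have "norm (H 0 - h 0) \<le> 2 / 3 * norm (h 0)" by simp
    then show ?thesis using h0 by (auto simp: norm_minus_commute)
  qed
  have H_cont: "continuous_on UNIV H"
  proof (rule continuous_at_imp_continuous_on, rule ballI)
    fix x0
    have ch: "continuous_on UNIV (\<lambda>z::'g \<times> 'g. h (fst z + snd z))"
      by (rule continuous_on_compose2[OF h]) (auto intro!: continuous_intros)
    show "isCont H x0"
      unfolding isCont_def tendsto_iff
    proof (intro allI impI)
      fix e :: real assume e: "e > 0"
      obtain X where X: "x0 \<in> X" "open X" "\<And>x y. x \<in> X \<Longrightarrow> norm (h (x + y) - h (x0 + y)) \<le> e / 2"
        using uniform_nhd[OF ch, of "e / 2" x0] e by (metis fst_conv snd_conv half_gt_zero)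
      have "dist (H x) (H x0) < e" if x: "x \<in> X" for x
      proof -
        have "H x - H x0 = (\<integral>s. cis (\<theta> * s) * h (x + b s) - cis (\<theta> * s) * h (x0 + b s) \<partial>unif01)"
          unfolding H_eq by (rule Bochner_Integration.integral_diff[symmetric]) (rule unif01_integrable_cont[OF cF])+
        also have "norm \<dots> \<le> (\<integral>s. norm (cis (\<theta> * s) * h (x + b s) - cis (\<theta> * s) * h (x0 + b s)) \<partial>unif01)"
          by (rule integral_norm_bound)
        also have "\<dots> \<le> (\<integral>s. e / 2 \<partial>unif01)"
        proof (rule integral_mono)
          show "integrable unif01 (\<lambda>s. norm (cis (\<theta> * s) * h (x + b s) - cis (\<theta> * s) * h (x0 + b s)))"
            by (intro integrable_norm Bochner_Integration.integrable_diff unif01_integrable_cont[OF cF])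
          show "norm (cis (\<theta> * s) * h (x + b s) - cis (\<theta> * s) * h (x0 + b s)) \<le> e / 2" for s
            using X(3)[OF x, of "b s"] by (simp add: norm_mult flip: right_diff_distrib)
        qed simp
        finally show ?thesis using e by (simp add: dist_norm)
      qed
      then show "\<forall>\<^sub>F x in at x0. dist (H x) (H x0) < e"
        unfolding eventually_at_topological using X(1,2) by blast
    qed
  qed
  define \<gamma> where "\<gamma> x = H x / H 0" for x
  have Hb: "H (x + b r) = cis (- (\<theta> * r)) * H x" for x r
  proof -
    have "cis (- (\<theta> * r)) * H x = cis (- (\<theta> * r)) * (cis (\<theta> * r) * H (x + b r))" unfolding Eall ..
    also have "\<dots> = H (x + b r)" by (simp add: cis_mult flip: mult.assoc)
    finally show ?thesis by simp
  qed
  have \<gamma>b: "\<gamma> (b r) = cis (- (\<theta> * r))" for r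
    using Hb[of 0 r] H0 by (simp add: \<gamma>_def)
  have \<gamma>: "group_character \<gamma>"
  proof (rule F.character_from_density)
    show "continuous_on UNIV \<gamma>" unfolding \<gamma>_def[abs_def] by (intro continuous_intros H_cont) (simp add: H0)
    show "norm (\<gamma> (b t)) = 1" for t by (simp add: \<gamma>b)
    show "\<gamma> (x + b t) = \<gamma> x * \<gamma> (b t)" for x t unfolding \<gamma>b by (simp add: \<gamma>_def Hb)
  qed
  have \<gamma>n: "\<gamma> x * cnj (\<gamma> x) = 1" for x
    using \<gamma> by (simp add: group_character_def flip: complex_norm_square)
  have "fourier_coeff m H \<gamma> = (\<integral>x. H 0 * (\<gamma> x * cnj (\<gamma> x)) \<partial>m)"
    unfolding fourier_coeff_def using H0 by (intro Bochner_Integration.integral_cong) (auto simp: \<gamma>_def)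
  also have "\<dots> = H 0" unfolding \<gamma>n by simp
  finally have "fourier_coeff m H \<gamma> \<noteq> 0" using H0 by simp
  moreover have "fourier_coeff m H \<gamma> = fourier_coeff m h \<gamma> * (\<integral>s. cis (\<theta> * s) * \<gamma> (b s) \<partial>unif01)"
    unfolding H_def by (rule F.fourier_coeff_avg[OF continuous_integrable[OF h] \<gamma>])
  ultimately have "fourier_coeff m h \<gamma> \<noteq> 0" by auto
  with \<gamma> show ?thesis by blast
qed

end

section \<open>Fourier coefficients determine a function\<close>

context haar_flow
begin

lemma fourier_corr:
  assumes g: "continuous_on UNIV g" and f: "integrable m f" and \<gamma>: "group_character \<gamma>"
  shows "fourier_coeff m (corr g f) \<gamma> = fourier_coeff m g \<gamma> * cnj (fourier_coeff m f \<gamma>)"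
proof -
  have c\<gamma>: "continuous_on UNIV \<gamma>" using \<gamma> by (simp add: group_character_def)
  have gm: "g \<in> borel_measurable borel" using g by (rule borel_measurable_continuous_onI)
  have cF: "continuous_on UNIV (\<lambda>z::'g \<times> 'g. g (snd z + fst z) * cnj (\<gamma> (fst z)))"
    by (intro continuous_intros continuous_on_compose2[OF g] continuous_on_compose2[OF c\<gamma>]) auto
  have "fourier_coeff m (corr g f) \<gamma> = (\<integral>x. (\<integral>y. cnj (f y) * (g (y + x) * cnj (\<gamma> x)) \<partial>m) \<partial>m)"
    unfolding fourier_coeff_def corr_def
    by (subst integral_mult_left_zero[symmetric]) (simp add: mult_ac)
  also have "\<dots> = (\<integral>y. cnj (f y) * (\<integral>x. g (y + x) * cnj (\<gamma> x) \<partial>m) \<partial>m)"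
    using swap_param_integral[of "\<lambda>y. cnj (f y)", OF _ cF] f by simp
  also have "\<dots> = (\<integral>y. fourier_coeff m g \<gamma> * cnj (f y * cnj (\<gamma> y)) \<partial>m)"
    using fourier_coeff_translate[OF \<gamma> gm] by (simp add: add.commute mult_ac)
  also have "\<dots> = fourier_coeff m g \<gamma> * cnj (fourier_coeff m f \<gamma>)"
    unfolding fourier_coeff_def by (simp only: integral_mult_right_zero Bochner_Integration.integral_cnj)
  finally show ?thesis .
qed

lemma fourier_bin:
  assumes g: "continuous_on UNIV g" and \<gamma>: "group_character \<gamma>"
  shows "fourier_coeff m (bin z \<tau> g) \<gamma> = (1 + z * \<gamma> (\<beta> \<tau>)) / 2 * fourier_coeff m g \<gamma>"
proof -
  have c\<gamma>: "continuous_on UNIV \<gamma>" using \<gamma> by (simp add: group_character_def)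
  note ct = continuous_translate[OF g]
  have i: "integrable m (\<lambda>x. g x * cnj (\<gamma> x) / 2)" "integrable m (\<lambda>x. z / 2 * (g (x + \<beta> \<tau>) * cnj (\<gamma> x)))"
    by (auto intro!: continuous_integrable continuous_intros g c\<gamma> ct)
  have "fourier_coeff m (bin z \<tau> g) \<gamma> = (\<integral>x. g x * cnj (\<gamma> x) / 2 + z / 2 * (g (x + \<beta> \<tau>) * cnj (\<gamma> x)) \<partial>m)"
    unfolding fourier_coeff_def bin_def by (simp add: field_simps)
  also have "\<dots> = fourier_coeff m g \<gamma> / 2 + z / 2 * (\<gamma> (\<beta> \<tau>) * fourier_coeff m g \<gamma>)"
    unfolding Bochner_Integration.integral_add[OF i]
    by (simp add: fourier_coeff_translate[OF \<gamma> borel_measurable_continuous_onI[OF g]])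
       (simp add: fourier_coeff_def)
  finally show ?thesis by (simp add: field_simps)
qed

lemma fourier_bsq_eq_0:
  assumes g: "continuous_on UNIV g" and \<gamma>: "group_character \<gamma>" and "fourier_coeff m g \<gamma> = 0"
  shows "fourier_coeff m (bsq z \<tau> n g) \<gamma> = 0"
proof (induction n)
  case (Suc n)
  then show ?case
    unfolding bsq_Suc
    by (simp add: fourier_bin[OF continuous_bin[OF continuous_bsq[OF g]] \<gamma>] fourier_bin[OF continuous_bsq[OF g] \<gamma>])
qed (simp add: bsq_def assms)

lemma slow_bin:
  assumes "\<And>x. norm (g (x + y) - g x) \<le> e" "norm z = 1"
  shows "norm (bin z \<tau> g (x + y) - bin z \<tau> g x) \<le> e"
proof -
  have "bin z \<tau> g (x + y) - bin z \<tau> g x = ((g (x + y) - g x) + z * (g ((x + \<beta> \<tau>) + y) - g (x + \<beta> \<tau>))) / 2"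
    by (simp add: bin_def field_simps add_ac)
  also have "norm \<dots> \<le> (norm (g (x + y) - g x) + norm (g ((x + \<beta> \<tau>) + y) - g (x + \<beta> \<tau>))) / 2"
    using norm_triangle_ineq[of "g (x + y) - g x" "z * (g ((x + \<beta> \<tau>) + y) - g (x + \<beta> \<tau>))"] assms(2)
    by (simp add: norm_mult norm_divide)
  also have "\<dots> \<le> (e + e) / 2" using assms(1)[of x] assms(1)[of "x + \<beta> \<tau>"] by simp
  finally show ?thesis by simp
qed

lemma slow_bsq:
  assumes "\<And>x. norm (g (x + y) - g x) \<le> e" "norm z = 1"
  shows "norm (bsq z \<tau> n g (x + y) - bsq z \<tau> n g x) \<le> e"
proof (induction n arbitrary: x)
  case (Suc n)
  show ?case unfolding bsq_Suc by (intro slow_bin Suc) (use assms in auto)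
qed (use assms in \<open>simp add: bsq_def\<close>)

lemma fourier_coeff_uniform_limit:
  assumes h: "uniform_limit UNIV hn h sequentially" and hn: "\<And>n. continuous_on UNIV (hn n)"
    and hc: "continuous_on UNIV h" and \<gamma>: "group_character \<gamma>" and 0: "\<And>n. fourier_coeff m (hn n) \<gamma> = 0"
  shows "fourier_coeff m h \<gamma> = 0"
proof -
  have c\<gamma>: "continuous_on UNIV \<gamma>" and n\<gamma>: "norm (\<gamma> x) = 1" for x using \<gamma> by (auto simp: group_character_def)
  have i: "integrable m (\<lambda>x. cnj (\<gamma> x))" by (intro continuous_integrable continuous_intros c\<gamma>)
  have small: "norm (fourier_coeff m h \<gamma>) \<le> e" if e: "e > 0" for e
  proof -
    obtain n where n: "\<And>x. norm (hn n x - h x) \<le> e"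
      using uniform_limitD[OF h e] by (auto simp: dist_norm eventually_sequentially) (meson less_imp_le order_refl)
    have "norm ((\<integral>y. cnj (\<gamma> y) * hn n y \<partial>m) - (\<integral>y. cnj (\<gamma> y) * h y \<partial>m)) \<le> e * (\<integral>y. norm (cnj (\<gamma> y)) \<partial>m)"
      by (rule weighted_integral_diff_le[OF i hn hc n])
    then show ?thesis using 0[of n] by (simp add: fourier_coeff_def mult.commute n\<gamma>)
  qed
  have "norm (fourier_coeff m h \<gamma>) \<le> 0" by (rule field_le_epsilon) (use small in simp)
  then show ?thesis by simp
qed

text \<open>For every \<open>n\<close> there is a unimodular \<open>zs n\<close> for which the \<open>n\<close>-th power of the averaging operator keeps energy at
  least \<open>c\<close>. Since these energies decrease in the power, a limit point \<open>z\<close> of \<open>zs\<close> works for all powers at once, and the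
  limit eigenfunction at \<open>z\<close> yields the character. The step \<open>\<tau>\<close> can be chosen after \<open>c\<close>, so small that \<open>corr f f\<close>
  hardly changes along the flow during time \<open>\<tau>\<close>; averaging preserves this.\<close>
lemma exists_character:
  assumes f: "continuous_on UNIV f" and pos: "energy f > 0"
  shows "\<exists>\<gamma>. group_character \<gamma> \<and> fourier_coeff m f \<gamma> \<noteq> 0"
proof -
  define k where "k = corr f f"
  have fi: "integrable m f" by (rule continuous_integrable[OF f])
  have kc: "continuous_on UNIV k" unfolding k_def by (rule continuous_corr[OF f fi])
  obtain c where c: "c > 0" and freq: "\<And>\<tau> n p. (\<forall>j. p j \<ge> 0) \<and> (\<Sum>j<n. p j) = 1 \<Longrightarrow>
    \<exists>z. norm z = 1 \<and> (\<integral>x. (norm (\<Sum>j<n. of_real (p j) * z ^ j * f (x + \<beta> (real j * \<tau>))))\<^sup>2 \<partial>m) \<ge> c"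
    using exists_frequency[OF f] pos unfolding energy_def by blast
  have ck: "continuous_on UNIV (\<lambda>z::real \<times> 'g. k (snd z + \<beta> (fst z)))"
    by (intro continuous_on_compose2[OF kc] continuous_intros continuous_on_compose2[OF cont_\<beta>]) auto
  have "c / 3 > 0" using c by simp
  then obtain X where X: "0 \<in> X" "open X" "\<And>s x. s \<in> X \<Longrightarrow> norm (k (x + \<beta> s) - k x) \<le> c / 3"
    using uniform_nhd[OF ck, of "c / 3" 0] by auto
  obtain \<epsilon> where \<epsilon>: "\<epsilon> > 0" "ball 0 \<epsilon> \<subseteq> X" using X(1,2) openE by blast
  define \<tau> where "\<tau> = \<epsilon> / 2"
  have \<tau>: "\<tau> > 0" using \<epsilon> by (simp add: \<tau>_def)
  have slow: "norm (k (x + \<beta> (\<tau> * s)) - k x) \<le> c / 3" if "0 \<le> s" "s \<le> 1" for s x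
  proof (rule X(3))
    have "\<tau> * s \<le> \<tau>" using \<tau> that by (simp add: mult_left_le)
    then show "\<tau> * s \<in> X" using \<epsilon> \<tau> that by (intro subsetD[OF \<epsilon>(2)]) (auto simp: \<tau>_def dist_norm)
  qed
  have "\<exists>z. norm z = 1 \<and> energy ((bin z \<tau> ^^ n) f) \<ge> c" for n
  proof -
    obtain p where P: "(\<forall>j. p j \<ge> 0) \<and> (\<Sum>j<Suc n. p j) = (1::real) \<and>
     (\<forall>z \<tau> g x. (bin z \<tau> ^^ n) g x = (\<Sum>j<Suc n. of_real (p j) * z ^ j * g (x + \<beta> (real j * \<tau>))))"
      using bin_pow_expansion[of n] by (rule exE)
    then have e: "energy ((bin z \<tau> ^^ n) f) = (\<integral>x. (norm (\<Sum>j<Suc n. of_real (p j) * z ^ j * f (x + \<beta> (real j * \<tau>))))\<^sup>2 \<partial>m)" for z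
      unfolding energy_def by (simp only:)
    show ?thesis unfolding e using freq[of p "Suc n" \<tau>] P by blast
  qed
  then obtain zs where zs: "\<And>n. norm (zs n) = 1" "\<And>n. energy ((bin (zs n) \<tau> ^^ n) f) \<ge> c" by metis
  have "seq_compact (sphere 0 1 :: complex set)" by (simp add: compact_imp_seq_compact)
  then obtain z r where z: "z \<in> sphere 0 1" and r: "strict_mono (r :: nat \<Rightarrow> nat)" and lim: "(zs \<circ> r) \<longlonglongrightarrow> z"
    using zs(1) by (metis seq_compactE mem_sphere_0)
  have z1: "norm z = 1" using z by simp
  have ec: "energy ((bin z \<tau> ^^ n) f) \<ge> c" for n
  proof (rule LIMSEQ_le_const)
    obtain p where P: "(\<forall>j. p j \<ge> 0) \<and> (\<Sum>j<Suc n. p j) = (1::real) \<and>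
     (\<forall>z \<tau> g x. (bin z \<tau> ^^ n) g x = (\<Sum>j<Suc n. of_real (p j) * z ^ j * g (x + \<beta> (real j * \<tau>))))"
      using bin_pow_expansion[of n] by (rule exE)
    have e: "complex_of_real (energy ((bin w \<tau> ^^ n) f)) = (\<Sum>j\<in>{..<Suc n}. \<Sum>j'\<in>{..<Suc n}.
        (of_real (p j) * w ^ j) * cnj (of_real (p j') * w ^ j') * corr f f (\<beta> (of_int (int j - int j') * \<tau>)))" for w
    proof -
      have "energy ((bin w \<tau> ^^ n) f) = (\<integral>x. (norm (\<Sum>j\<in>{..<Suc n}. (of_real (p j) * w ^ j) * f (x + \<beta> (real j * \<tau>))))\<^sup>2 \<partial>m)"
        unfolding energy_def using P by (simp only:)
      then show ?thesis using energy_expansion[OF f, of "\<lambda>j. of_real (p j) * w ^ j" \<tau> "{..<Suc n}"] by simp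
    qed
    have lim': "(\<lambda>l. zs (r l)) \<longlonglongrightarrow> z" using lim by (simp add: o_def)
    have "(\<lambda>l. complex_of_real (energy ((bin (zs (r l)) \<tau> ^^ n) f))) \<longlonglongrightarrow> complex_of_real (energy ((bin z \<tau> ^^ n) f))"
      unfolding e by (intro tendsto_intros lim')
    then show "(\<lambda>l. energy ((bin (zs (r l)) \<tau> ^^ n) f)) \<longlonglongrightarrow> energy ((bin z \<tau> ^^ n) f)"
      by (simp only: tendsto_of_real_iff)
    have "c \<le> energy ((bin (zs (r l)) \<tau> ^^ n) f)" if "l \<ge> n" for l
    proof -
      have "n \<le> r l" using that seq_suble[OF r, of l] by linarith
      from energy_bin_pow_antimono[OF f zs(1) this, of "r l" \<tau>] show ?thesis using zs(2)[of "r l"] by linarith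
    qed
    then show "\<exists>N. \<forall>l\<ge>N. c \<le> energy ((bin (zs (r l)) \<tau> ^^ n) f)" by blast
  qed
  obtain h where h: "uniform_limit UNIV (\<lambda>n. bsq z \<tau> n (corr f f)) h sequentially"
    "continuous_on UNIV h" "Re (h 0) \<ge> c" "\<And>x. z * h (x + \<beta> \<tau>) = h x"
    using limit_eigenfunction[OF f z1 c ec] by metis
  define \<theta> where "\<theta> = Arg z"
  have "z \<noteq> 0" using z1 by auto
  then have z\<theta>: "z = cis \<theta>" using z1 cis_Arg[of z] by (simp add: \<theta>_def sgn_div_norm)
  have \<theta>: "\<bar>\<theta>\<bar> \<le> pi" using Arg_bounded[of z] by (auto simp: \<theta>_def abs_le_iff)
  have "c \<le> norm (h 0)" using h(3) complex_Re_le_cmod[of "h 0"] by linarith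
  have "\<exists>\<gamma>. group_character \<gamma> \<and> fourier_coeff m h \<gamma> \<noteq> 0"
  proof (rule character_of_eigenfunction[OF h(2) _ \<theta>])
    show "cis \<theta> * h (x + \<beta> \<tau>) = h x" for x using h(4) z\<theta> by simp
    show "h 0 \<noteq> 0" using \<open>c \<le> norm (h 0)\<close> c by auto
    show "norm (h (\<beta> (\<tau> * s)) - h 0) \<le> norm (h 0) / 3" if s: "0 \<le> s" "s \<le> 1" for s
    proof -
      have ptw: "(\<lambda>n. bsq z \<tau> n k x) \<longlonglongrightarrow> h x" for x
        using tendsto_uniform_limitI[OF h(1), of x] by (simp add: k_def)
      have "norm (h (0 + \<beta> (\<tau> * s)) - h 0) \<le> c / 3"
      proof (rule LIMSEQ_le_const2)
        show "(\<lambda>n. norm (bsq z \<tau> n k (0 + \<beta> (\<tau> * s)) - bsq z \<tau> n k 0)) \<longlonglongrightarrow> norm (h (0 + \<beta> (\<tau> * s)) - h 0)"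
          by (intro tendsto_intros ptw)
        show "\<exists>N. \<forall>n\<ge>N. norm (bsq z \<tau> n k (0 + \<beta> (\<tau> * s)) - bsq z \<tau> n k 0) \<le> c / 3"
          using slow_bsq[of k "\<beta> (\<tau> * s)", OF slow[OF s] z1] by blast
      qed
      then show ?thesis using \<open>c \<le> norm (h 0)\<close> by simp
    qed
  qed (use \<tau> in simp)
  then obtain \<gamma> where \<gamma>: "group_character \<gamma>" "fourier_coeff m h \<gamma> \<noteq> 0" by blast
  have "fourier_coeff m k \<gamma> \<noteq> 0"
  proof
    assume "fourier_coeff m k \<gamma> = 0"
    then have "fourier_coeff m (bsq z \<tau> n k) \<gamma> = 0" for n by (rule fourier_bsq_eq_0[OF kc \<gamma>(1)])
    then have "fourier_coeff m h \<gamma> = 0"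
      by (intro fourier_coeff_uniform_limit[OF h(1)[folded k_def] continuous_bsq[OF kc] h(2) \<gamma>(1)])
    with \<gamma>(2) show False by simp
  qed
  then have "fourier_coeff m f \<gamma> \<noteq> 0" unfolding k_def fourier_corr[OF f fi \<gamma>(1)] by auto
  with \<gamma>(1) show ?thesis by blast
qed

text \<open>Finitely many translates of \<open>U\<close> cover the group.\<close>
lemma emeasure_open_pos:
  assumes U: "open U" "U \<noteq> {}"
  shows "emeasure m U > 0"
proof (rule ccontr)
  assume "\<not> emeasure m U > 0"
  then have 0: "emeasure m U = 0" by simp
  obtain u where u: "u \<in> U" using U by auto
  define T where "T y = (+) y ` U" for y
  have T_eq: "T y = (\<lambda>x. x - y) -` U" for y by (force simp: T_def image_iff)
  have oT: "open (T y)" for y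
    unfolding T_eq using U(1) by (intro open_vimage continuous_intros)
  have cov: "UNIV \<subseteq> (\<Union>y\<in>UNIV. T y)"
  proof
    fix x show "x \<in> (\<Union>y\<in>UNIV. T y)" using u by (intro UN_I[of "x - u"]) (auto simp: T_eq)
  qed
  obtain C where C: "finite C" "UNIV \<subseteq> (\<Union>y\<in>C. T y)"
    by (rule compactE_image[OF compact_UNIV, of UNIV T]) (use oT cov in auto)
  have "1 = emeasure m UNIV" using emeasure_space_1 by simp
  also have "\<dots> \<le> emeasure m (\<Union>y\<in>C. T y)" by (rule emeasure_mono) (use C oT in auto)
  also have "\<dots> \<le> (\<Sum>y\<in>C. emeasure m (T y))" by (rule emeasure_subadditive_finite) (use C oT in auto)
  also have "\<dots> = 0" using U 0 by (simp add: T_def emeasure_translate)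
  finally show False by simp
qed

lemma energy_eq_0:
  assumes g: "continuous_on UNIV g" and "energy g = 0"
  shows "g x = 0"
proof (rule ccontr)
  assume x: "g x \<noteq> 0"
  have "integrable m (\<lambda>x. (norm (g x))\<^sup>2)" by (intro continuous_integrable continuous_intros g)
  then have "AE x in m. (norm (g x))\<^sup>2 = 0"
    using assms(2) by (simp add: energy_def integral_nonneg_eq_0_iff_AE)
  then have ae: "AE x in m. g x = 0" by simp
  have o: "open {x. g x \<noteq> 0}" by (intro open_Collect_neq continuous_intros g)
  have "emeasure m {x. g x \<noteq> 0} = 0"
    using ae o by (subst (asm) AE_iff_measurable[of "{x. g x \<noteq> 0}"]) auto
  then show False using emeasure_open_pos[OF o] x by auto
qed

text \<open>The Fourier coefficients of \<open>corr g f\<close> are products of those of \<open>g\<close> and of the conjugates of those of \<open>f\<close>, so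
  the continuous function \<open>corr g f\<close> vanishes; the integral is its value at 0.\<close>
lemma fourier_eq_0_imp_orthogonal:
  assumes f: "integrable m f" and 0: "\<And>\<gamma>. group_character \<gamma> \<Longrightarrow> fourier_coeff m f \<gamma> = 0"
    and g: "continuous_on UNIV g"
  shows "(\<integral>y. g y * cnj (f y) \<partial>m) = 0"
proof -
  have c: "continuous_on UNIV (corr g f)" by (rule continuous_corr[OF g f])
  have "\<not> energy (corr g f) > 0"
    using exists_character[OF c] by (auto simp: fourier_corr[OF g f] 0)
  moreover have "energy (corr g f) \<ge> 0" by (simp add: energy_def)
  ultimately have "corr g f 0 = 0" using energy_eq_0[OF c] by simp
  then show ?thesis by (simp add: corr_def)
qed

lemma outer_open:
  assumes "A \<in> sets borel" "e > 0"
  obtains U where "open U" "A \<subseteq> U" "measure m U < measure m A + e"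
proof -
  have "emeasure m A = (INF U\<in>{U. open U \<and> A \<subseteq> U}. emeasure m U)"
    using haar assms(1) unfolding normalized_haar_def by blast
  moreover have "emeasure m A < ennreal (measure m A + e)"
    using assms(2) by (simp add: emeasure_eq_measure ennreal_less_iff)
  ultimately have "(INF U\<in>{U. open U \<and> A \<subseteq> U}. emeasure m U) < ennreal (measure m A + e)"
    by (rule subst)
  then obtain U where "open U" "A \<subseteq> U" "emeasure m U < ennreal (measure m A + e)"
    unfolding INF_less_iff by blast
  then show ?thesis by (intro that[of U]) (auto simp: emeasure_eq_measure ennreal_less_iff)
qed

lemma inner_compact:
  assumes "A \<in> sets borel" "e > 0"
  obtains K where "compact K" "K \<subseteq> A" "measure m A < measure m K + e"
proof (cases "measure m A < e")
  case True
  then show ?thesis by (intro that[of "{}"]) auto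
next
  case False
  have "emeasure m A = (SUP K\<in>{K. compact K \<and> K \<subseteq> A}. emeasure m K)"
    using haar assms(1) unfolding normalized_haar_def by blast
  moreover have "ennreal (measure m A - e) < emeasure m A"
    using assms(2) False by (simp add: emeasure_eq_measure ennreal_less_iff)
  ultimately have "ennreal (measure m A - e) < (SUP K\<in>{K. compact K \<and> K \<subseteq> A}. emeasure m K)"
    by (rule subst)
  then obtain K where "compact K" "K \<subseteq> A" "ennreal (measure m A - e) < emeasure m K"
    unfolding less_SUP_iff by blast
  then show ?thesis using False by (intro that[of K]) (auto simp: emeasure_eq_measure ennreal_less_iff)
qed

lemma urysohn:
  assumes "compact K" "open U" "K \<subseteq> U"
  obtains g :: "'g \<Rightarrow> real" where "continuous_on UNIV g" "\<And>x. 0 \<le> g x" "\<And>x. g x \<le> 1"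
    "\<And>x. x \<in> K \<Longrightarrow> g x = 1" "\<And>x. x \<notin> U \<Longrightarrow> g x = 0"
proof -
  have "Hausdorff_space (euclidean :: 'g topology)"
    unfolding Hausdorff_space_def by (auto simp: disjnt_def dest!: hausdorff)
  then have "normal_space (euclidean :: 'g topology)"
    using compact_UNIV by (intro compact_Hausdorff_or_regular_imp_normal_space) (auto simp: compact_space_def)
  moreover have "closedin euclidean (- U)" "closedin euclidean K"
    using assms by (auto simp flip: closed_closedin intro: compact_imp_closed)
  moreover have "disjnt (- U) K" using assms by (auto simp: disjnt_def)
  ultimately obtain g where g: "continuous_map euclidean (top_of_set {0..1::real}) g" "g ` (- U) \<subseteq> {0}" "g ` K \<subseteq> {1}"
    by (rule Urysohn_lemma[of _ _ _ 0 1]) auto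
  then have "continuous_on UNIV g" "g ` UNIV \<subseteq> {0..1}"
    by (auto simp: continuous_map_in_subtopology)
  then have "continuous_on UNIV g" "g x \<in> {0..1}" for x by blast+
  then show ?thesis using g by (intro that[of g]) auto
qed

text \<open>By outer regularity the indicator of \<open>K\<close> is, almost everywhere, a limit of continuous functions
  with values in the unit interval.\<close>
lemma integral_compact_eq_0:
  assumes f: "integrable m f" and orth: "\<And>g. continuous_on UNIV g \<Longrightarrow> (\<integral>y. g y * f y \<partial>m) = 0"
    and K: "compact K"
  shows "(\<integral>y. indicator K y * f y \<partial>m) = (0::complex)"
proof -
  have Kb: "K \<in> sets borel" using K by (intro borel_closed compact_imp_closed)
  have [measurable]: "f \<in> borel_measurable borel" using f by auto
  have "\<exists>U. open U \<and> K \<subseteq> U \<and> measure m U < measure m K + 1 / real (Suc n)" for n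
    by (rule outer_open[OF Kb, of "1 / real (Suc n)"]) auto
  then obtain U where U: "\<And>n. open (U n)" "\<And>n. K \<subseteq> U n" "\<And>n. measure m (U n) < measure m K + 1 / real (Suc n)" by metis
  define V where "V n = (\<Inter>i\<le>n. U i)" for n
  have V: "open (V n)" "K \<subseteq> V n" for n using U by (auto simp: V_def)
  have "\<exists>g :: 'g \<Rightarrow> real. continuous_on UNIV g \<and> (\<forall>x. 0 \<le> g x \<and> g x \<le> 1) \<and> (\<forall>x\<in>K. g x = 1) \<and> (\<forall>x. x \<notin> V n \<longrightarrow> g x = 0)" for n
    by (rule urysohn[OF K V]) blast
  then obtain g :: "nat \<Rightarrow> 'g \<Rightarrow> real" where g: "\<And>n. continuous_on UNIV (g n)" "\<And>n x. 0 \<le> g n x" "\<And>n x. g n x \<le> 1"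
    "\<And>n x. x \<in> K \<Longrightarrow> g n x = 1" "\<And>n x. x \<notin> V n \<Longrightarrow> g n x = 0" by metis
  have [measurable]: "g n \<in> borel_measurable borel" for n by (rule borel_measurable_continuous_onI[OF g(1)])
  define N where "N = (\<Inter>n. U n) - K"
  have UNb: "(\<Inter>n. U n) \<in> sets borel" using U(1) by (intro sets.countable_INT) auto
  have Nb: "N \<in> sets borel" unfolding N_def using UNb Kb by (rule sets.Diff)
  have "measure m N \<le> 1 / real (Suc n)" for n
  proof -
    have "measure m N = measure m (\<Inter>n. U n) - measure m K"
      unfolding N_def using UNb Kb U(2) by (intro finite_measure_Diff) auto
    also have "measure m (\<Inter>n. U n) \<le> measure m (U n)"
      using U(1) by (intro finite_measure_mono) auto
    finally show ?thesis using U(3)[of n] by simp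
  qed
  then have "measure m N \<le> 0" 
    by (intro LIMSEQ_le_const[OF LIMSEQ_Suc[OF lim_1_over_n]]) auto
  then have N0: "emeasure m N = 0" by (simp add: emeasure_eq_measure measure_le_0_iff)
  have ae: "AE x in m. x \<notin> N"
    by (rule AE_I[of _ _ N]) (use N0 Nb in auto)
  have "(\<lambda>n. \<integral>y. of_real (g n y) * f y \<partial>m) \<longlonglongrightarrow> (\<integral>y. indicator K y * f y \<partial>m)"
  proof (rule integral_dominated_convergence[where w = "\<lambda>y. norm (f y)"])
    show "AE y in m. (\<lambda>n. of_real (g n y) * f y) \<longlonglongrightarrow> indicator K y * f y"
      using ae
    proof eventually_elim
      fix y assume y: "y \<notin> N"
      show "(\<lambda>n. of_real (g n y) * f y) \<longlonglongrightarrow> indicator K y * f y"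
      proof (cases "y \<in> K")
        case False
        then obtain n0 where "y \<notin> U n0" using y by (auto simp: N_def)
        then have "y \<notin> V n" if "n \<ge> n0" for n using that by (auto simp: V_def)
        then have "eventually (\<lambda>n. of_real (g n y) * f y = indicator K y * f y) sequentially"
          using g(5) False by (intro eventually_sequentiallyI[of n0]) auto
        then show ?thesis by (rule tendsto_eventually)
      qed (use g(4) in simp)
    qed
    show "AE y in m. norm (of_real (g n y) * f y) \<le> norm (f y)" for n
      using g(2,3) by (intro AE_I2) (auto simp: norm_mult intro: mult_left_le_one_le)
  qed (use f Kb in auto)
  moreover have "(\<integral>y. of_real (g n y) * f y \<partial>m) = 0" for n
    by (intro orth continuous_intros g)
  ultimately show ?thesis using LIMSEQ_unique[OF _ tendsto_const] by simp
qed

text \<open>Inner regularity reduces Borel sets to compact sets.\<close>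
lemma integral_borel_eq_0:
  assumes f: "integrable m f" and orth: "\<And>g. continuous_on UNIV g \<Longrightarrow> (\<integral>y. g y * f y \<partial>m) = 0"
    and A: "A \<in> sets borel"
  shows "(\<integral>y. indicator A y * f y \<partial>m) = (0::complex)"
proof -
  have [measurable]: "f \<in> borel_measurable borel" using f by auto
  have "\<exists>K. compact K \<and> K \<subseteq> A \<and> measure m A < measure m K + 1 / real (Suc n)" for n
    by (rule inner_compact[OF A, of "1 / real (Suc n)"]) auto
  then obtain K where K: "\<And>n. compact (K n)" "\<And>n. K n \<subseteq> A" "\<And>n. measure m A < measure m (K n) + 1 / real (Suc n)" by metis
  define L where "L n = (\<Union>i\<le>n. K i)" for n
  have L: "compact (L n)" "L n \<subseteq> A" for n using K by (auto simp: L_def)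
  have Kb: "K n \<in> sets borel" "L n \<in> sets borel" for n using K(1) L(1) by (auto intro: borel_closed compact_imp_closed)
  define N where "N = A - (\<Union>n. K n)"
  have UNb: "(\<Union>n. K n) \<in> sets borel" using Kb by auto
  have Nb: "N \<in> sets borel" unfolding N_def using A UNb by (rule sets.Diff)
  have "measure m N \<le> 1 / real (Suc n)" for n
  proof -
    have "measure m N = measure m A - measure m (\<Union>n. K n)"
      unfolding N_def using UNb A K(2) by (intro finite_measure_Diff) auto
    moreover have "measure m (K n) \<le> measure m (\<Union>n. K n)"
      using UNb by (intro finite_measure_mono) auto
    ultimately show ?thesis using K(3)[of n] by simp
  qed
  then have "measure m N \<le> 0" 
    by (intro LIMSEQ_le_const[OF LIMSEQ_Suc[OF lim_1_over_n]]) auto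
  then have N0: "emeasure m N = 0" by (simp add: emeasure_eq_measure measure_le_0_iff)
  have ae: "AE x in m. x \<notin> N"
    by (rule AE_I[of _ _ N]) (use N0 Nb in auto)
  have "(\<lambda>n. \<integral>y. indicator (L n) y * f y \<partial>m) \<longlonglongrightarrow> (\<integral>y. indicator A y * f y \<partial>m)"
  proof (rule integral_dominated_convergence[where w = "\<lambda>y. norm (f y)"])
    show "AE y in m. (\<lambda>n. indicator (L n) y * f y) \<longlonglongrightarrow> indicator A y * f y"
      using ae
    proof eventually_elim
      fix y assume y: "y \<notin> N"
      show "(\<lambda>n. indicator (L n) y * f y) \<longlonglongrightarrow> indicator A y * f y"
      proof (cases "y \<in> A")
        case True
        then obtain n0 where n0: "y \<in> K n0" using y by (auto simp: N_def)
        have "eventually (\<lambda>n. indicator (L n) y * f y = indicator A y * f y) sequentially"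
          using True n0 by (intro eventually_sequentiallyI[of n0]) (auto simp: L_def indicator_def)
        then show ?thesis by (rule tendsto_eventually)
      next
        case False
        then have "indicator (L n) y = (0 :: complex)" for n using L(2)[of n] by (auto simp: indicator_def)
        then show ?thesis using False by simp
      qed
    qed
    show "AE y in m. norm (indicator (L n) y * f y) \<le> norm (f y)" for n
      by (intro AE_I2) (auto simp: norm_mult indicator_def)
  qed (use f A Kb in auto)
  moreover have "(\<integral>y. indicator (L n) y * f y \<partial>m) = 0" for n
    by (rule integral_compact_eq_0[OF f orth L(1)])
  ultimately show ?thesis using LIMSEQ_unique[OF _ tendsto_const] by simp
qed

text \<open>An integrable function is determined by its Fourier coefficients. In particular the norm of a
  Dirichlet series does not depend on the representing function.\<close>
theorem fourier_uniqueness: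
  assumes f: "integrable m f" and 0: "\<And>\<gamma>. group_character \<gamma> \<Longrightarrow> fourier_coeff m f \<gamma> = 0"
  shows "AE x in m. f x = 0"
proof -
  define F where "F x = cnj (f x)" for x
  have F: "integrable m F" unfolding F_def using f by simp
  have orth: "(\<integral>y. g y * F y \<partial>m) = 0" if "continuous_on UNIV g" for g
    unfolding F_def by (rule fourier_eq_0_imp_orthogonal[OF f 0 that])
  have zero: "(\<integral>y. indicator A y * F y \<partial>m) = 0" if "A \<in> sets m" for A
    using integral_borel_eq_0[OF F orth] that by simp
  have int: "integrable m (\<lambda>y. indicator A y * F y)" if "A \<in> sets m" for A
    using integrable_mult_indicator[OF that F] by (simp add: scaleR_conv_of_real of_real_indicator)
  have "AE x in m. Re (F x) = 0"
  proof (rule density_unique_real)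
    fix A assume A: "A \<in> sets m"
    have "(\<integral>x\<in>A. Re (F x) \<partial>m) = (\<integral>y. Re (indicator A y * F y) \<partial>m)"
      unfolding set_lebesgue_integral_def by (intro Bochner_Integration.integral_cong) (auto simp: indicator_def)
    also have "\<dots> = 0" unfolding integral_Re[OF int[OF A]] zero[OF A] by simp
    finally show "(\<integral>x\<in>A. Re (F x) \<partial>m) = (\<integral>x\<in>A. 0 \<partial>m)" by (simp add: set_lebesgue_integral_def)
  qed (use F in auto)
  moreover have "AE x in m. Im (F x) = 0"
  proof (rule density_unique_real)
    fix A assume A: "A \<in> sets m"
    have "(\<integral>x\<in>A. Im (F x) \<partial>m) = (\<integral>y. Im (indicator A y * F y) \<partial>m)"
      unfolding set_lebesgue_integral_def by (intro Bochner_Integration.integral_cong) (auto simp: indicator_def)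
    also have "\<dots> = 0" unfolding integral_Im[OF int[OF A]] zero[OF A] by simp
    finally show "(\<integral>x\<in>A. Im (F x) \<partial>m) = (\<integral>x\<in>A. 0 \<partial>m)" by (simp add: set_lebesgue_integral_def)
  qed (use F in auto)
  ultimately show ?thesis
    by eventually_elim (simp add: F_def complex_eq_iff)
qed

end

section \<open>Functions with a Dirichlet series\<close>

text \<open>An almost everywhere convergent subsequence provides the limit, and Fatou's lemma the convergence in
  mean.\<close>
lemma L1_complete:
  fixes f :: "nat \<Rightarrow> 'a \<Rightarrow> complex"
  assumes f: "\<And>k. integrable M (f k)"
    and cauchy: "\<And>e. e > 0 \<Longrightarrow> \<exists>N. \<forall>i\<ge>N. \<forall>j\<ge>N. (\<integral>x. norm (f i x - f j x) \<partial>M) < e"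
  obtains g where "integrable M g" "(\<lambda>k. \<integral>x. norm (f k x - g x) \<partial>M) \<longlonglongrightarrow> 0"
proof -
  have [measurable]: "f k \<in> borel_measurable M" for k using f by auto
  obtain r where r: "strict_mono (r :: nat \<Rightarrow> nat)" "AE x in M. Cauchy (\<lambda>i. f (r i) x)"
    using cauchy_L1_AE_cauchy_subseq[OF f cauchy] by metis
  define g where "g x = lim (\<lambda>i. f (r i) x)" for x
  have [measurable]: "g \<in> borel_measurable M" unfolding g_def by measurable
  have conv: "AE x in M. (\<lambda>i. f (r i) x) \<longlonglongrightarrow> g x"
    using r(2) by eventually_elim (simp add: g_def Cauchy_convergent_iff convergent_LIMSEQ_iff)
  have nn: "(\<integral>\<^sup>+ x. ennreal (norm (f k x - g x)) \<partial>M) \<le> ennreal e"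
    if N: "\<forall>i\<ge>N. \<forall>j\<ge>N. (\<integral>x. norm (f i x - f j x) \<partial>M) < e" and k: "k \<ge> N" for e N k
  proof -
    have "(\<integral>\<^sup>+ x. ennreal (norm (f k x - g x)) \<partial>M) = (\<integral>\<^sup>+ x. liminf (\<lambda>i. ennreal (norm (f k x - f (r i) x))) \<partial>M)"
    proof (rule nn_integral_cong_AE)
      show "AE x in M. ennreal (norm (f k x - g x)) = liminf (\<lambda>i. ennreal (norm (f k x - f (r i) x)))"
        using conv
      proof eventually_elim
        case (elim x)
        have "(\<lambda>i. ennreal (norm (f k x - f (r i) x))) \<longlonglongrightarrow> ennreal (norm (f k x - g x))"
          by (intro tendsto_intros elim)
        then show ?case by (intro lim_imp_Liminf[symmetric]) simp_all
      qed
    qed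
    also have "\<dots> \<le> liminf (\<lambda>i. \<integral>\<^sup>+ x. ennreal (norm (f k x - f (r i) x)) \<partial>M)"
      by (rule nn_integral_liminf) simp
    also have "\<dots> \<le> liminf (\<lambda>i. ennreal e)"
    proof (rule Liminf_mono, rule eventually_sequentiallyI)
      fix i assume "N \<le> i"
      then have "N \<le> r i" using seq_suble[OF r(1), of i] by linarith
      then have "(\<integral>x. norm (f k x - f (r i) x) \<partial>M) \<le> e" using N k by (meson less_imp_le)
      moreover have "(\<integral>\<^sup>+ x. ennreal (norm (f k x - f (r i) x)) \<partial>M) = ennreal (\<integral>x. norm (f k x - f (r i) x) \<partial>M)"
        by (rule nn_integral_eq_integral) (use f in auto)
      ultimately show "(\<integral>\<^sup>+ x. ennreal (norm (f k x - f (r i) x)) \<partial>M) \<le> ennreal e"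
        by (simp add: ennreal_leI)
    qed
    finally show ?thesis by (simp add: Liminf_const)
  qed
  obtain N1 where "\<forall>i\<ge>N1. \<forall>j\<ge>N1. (\<integral>x. norm (f i x - f j x) \<partial>M) < 1" using cauchy[of 1] by auto
  from nn[OF this order_refl] have "integrable M (\<lambda>x. f N1 x - g x)"
    by (intro integrableI_bounded) (auto intro: le_less_trans)
  from Bochner_Integration.integrable_diff[OF f[of N1] this] have gi: "integrable M g" by simp
  have "(\<lambda>k. \<integral>x. norm (f k x - g x) \<partial>M) \<longlonglongrightarrow> 0"
  proof (rule LIMSEQ_I)
    fix e :: real assume e: "e > 0"
    obtain N where N: "\<forall>i\<ge>N. \<forall>j\<ge>N. (\<integral>x. norm (f i x - f j x) \<partial>M) < e / 2" using cauchy[of "e / 2"] e by auto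
    have "norm ((\<integral>x. norm (f k x - g x) \<partial>M) - 0) < e" if k: "k \<ge> N" for k
    proof -
      have "ennreal (\<integral>x. norm (f k x - g x) \<partial>M) = (\<integral>\<^sup>+ x. ennreal (norm (f k x - g x)) \<partial>M)"
        by (rule nn_integral_eq_integral[symmetric]) (use f gi in auto)
      also have "\<dots> \<le> ennreal (e / 2)" by (rule nn[OF N k])
      finally have "(\<integral>x. norm (f k x - g x) \<partial>M) \<le> e / 2" using e by (simp add: ennreal_le_iff)
      then show ?thesis using e by simp
    qed
    then show "\<exists>N. \<forall>k\<ge>N. norm ((\<integral>x. norm (f k x - g x) \<partial>M) - 0) < e" by blast
  qed
  with gi that show ?thesis by blast
qed

locale hardy_setting = haar_flow \<beta> m
  for \<beta> :: "real \<Rightarrow> 'g::{topological_ab_group_add, t2_space}" and m :: "'g measure" +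
  fixes lam :: "nat \<Rightarrow> real"
  assumes freq: "frequency lam" and fdg: "freq_dirichlet_group lam \<beta>"
begin

definition h :: "nat \<Rightarrow> 'g \<Rightarrow> complex" where
  "h n = freq_char \<beta> (lam n)"

lemma h_rep: "represents_freq \<beta> (lam n) (h n)"
  unfolding h_def by (rule represents_freq_char[OF fdg])

lemma h_char: "group_character (h n)"
  using h_rep by (simp add: represents_freq_def)

lemma h_\<beta>: "h n (\<beta> t) = exp (- (\<i> * of_real (lam n) * of_real t))"
  using h_rep by (simp add: represents_freq_def)

lemma h_cont: "continuous_on UNIV (h n)"
  and h_norm [simp]: "norm (h n x) = 1"
  and h_add: "h n (x + y) = h n x * h n y"
  using h_char[of n] by (auto simp: group_character_def)

lemma lam_nonneg: "0 \<le> lam n" and lam_mono: "strict_mono lam"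
  and lam_top: "filterlim lam at_top sequentially"
  using freq by (auto simp: frequency_def)

lemma finite_below: "finite {n. lam n < R}"
proof -
  obtain N where "\<And>n. n \<ge> N \<Longrightarrow> lam n \<ge> R"
    using lam_top unfolding filterlim_at_top eventually_sequentially by blast
  then have "{n. lam n < R} \<subseteq> {..<N}" by (auto simp: not_le[symmetric])
  then show ?thesis using finite_subset by blast
qed

lemma h_inj: "h n = h k \<longleftrightarrow> n = k"
proof
  assume eq: "h n = h k"
  show "n = k"
  proof (rule ccontr)
    assume "n \<noteq> k"
    then have ne: "lam n \<noteq> lam k" using lam_mono by (metis strict_mono_eq)
    \<comment> \<open>At this time the two exponentials differ by the factor -1.\<close>
    define t where "t = pi / (lam n - lam k)"
    have "exp (- (\<i> * of_real (lam n) * of_real t)) = exp (- (\<i> * of_real (lam k) * of_real t))"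
      using h_\<beta>[of n t] h_\<beta>[of k t] eq by simp
    then have "exp (- (\<i> * of_real (lam n) * of_real t)) / exp (- (\<i> * of_real (lam k) * of_real t)) = 1" by simp
    then have "exp (- (\<i> * of_real (lam n) * of_real t) - - (\<i> * of_real (lam k) * of_real t)) = 1" by (simp only: exp_diff)
    also have "- (\<i> * of_real (lam n) * of_real t) - - (\<i> * of_real (lam k) * of_real t) = - (\<i> * of_real ((lam n - lam k) * t))"
      by (simp add: algebra_simps)
    also have "(lam n - lam k) * t = pi" using ne by (simp add: t_def)
    also have "exp (- (\<i> * of_real pi)) = (-1 :: complex)" by (simp add: exp_minus)
    finally show False by simp
  qed
qed simp

lemma orthogonality:
  assumes "group_character \<gamma>" "group_character \<gamma>'"
  shows "fourier_coeff m \<gamma>' \<gamma> = (if \<gamma> = \<gamma>' then 1 else 0)"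
proof (cases "\<gamma> = \<gamma>'")
  case True
  have "\<gamma> x * cnj (\<gamma> x) = 1" for x using assms by (simp add: group_character_def flip: complex_norm_square)
  then show ?thesis using True by (simp add: fourier_coeff_def)
next
  case False
  then obtain y where y: "\<gamma> y \<noteq> \<gamma>' y" by auto
  have c: "continuous_on UNIV \<gamma>'" and mul: "\<gamma>' (x + z) = \<gamma>' x * \<gamma>' z" for x z
    using assms by (auto simp: group_character_def)
  have "\<gamma> y * fourier_coeff m \<gamma>' \<gamma> = (\<integral>x. \<gamma>' (x + y) * cnj (\<gamma> x) \<partial>m)"
    by (rule fourier_coeff_translate[symmetric, OF assms(1) borel_measurable_continuous_onI[OF c]])
  also have "\<dots> = (\<integral>x. \<gamma>' y * (\<gamma>' x * cnj (\<gamma> x)) \<partial>m)" by (simp add: mul mult_ac)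
  also have "\<dots> = \<gamma>' y * fourier_coeff m \<gamma>' \<gamma>" by (simp add: fourier_coeff_def)
  finally have "(\<gamma> y - \<gamma>' y) * fourier_coeff m \<gamma>' \<gamma> = 0" by (simp add: left_diff_distrib)
  then show ?thesis using y False by simp
qed

text \<open>An integrable \<open>f\<close> has the Dirichlet series \<open>a\<close>; this is \<open>bohr_related\<close> freed from the exponent.\<close>
definition spec :: "(nat \<Rightarrow> complex) \<Rightarrow> ('g \<Rightarrow> complex) \<Rightarrow> bool" where
  "spec a f \<longleftrightarrow> integrable m f \<and> (\<forall>n. fourier_coeff m f (h n) = a n) \<and>
     (\<forall>\<gamma>. group_character \<gamma> \<longrightarrow> (\<forall>n. \<gamma> \<noteq> h n) \<longrightarrow> fourier_coeff m f \<gamma> = 0)"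

lemma specD: "spec a f \<Longrightarrow> integrable m f" "spec a f \<Longrightarrow> fourier_coeff m f (h n) = a n"
  "spec a f \<Longrightarrow> group_character \<gamma> \<Longrightarrow> (\<And>n. \<gamma> \<noteq> h n) \<Longrightarrow> fourier_coeff m f \<gamma> = 0"
  by (auto simp: spec_def)

lemma integrable_mult_character:
  assumes "integrable m f" "group_character \<gamma>"
  shows "integrable m (\<lambda>x. f x * cnj (\<gamma> x))"
  using assms by (intro integrable_mult_continuous continuous_intros) (auto simp: group_character_def)

lemma fourier_coeff_add:
  assumes "integrable m f" "integrable m g" "group_character \<gamma>"
  shows "fourier_coeff m (\<lambda>x. f x + g x) \<gamma> = fourier_coeff m f \<gamma> + fourier_coeff m g \<gamma>"
  unfolding fourier_coeff_def
  using integrable_mult_character[OF assms(1,3)] integrable_mult_character[OF assms(2,3)]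
  by (simp add: distrib_right)

lemma fourier_coeff_cmult: "fourier_coeff m (\<lambda>x. c * f x) \<gamma> = c * fourier_coeff m f \<gamma>"
  unfolding fourier_coeff_def by (simp add: mult.assoc)

lemma fourier_coeff_diff:
  assumes "integrable m f" "integrable m g" "group_character \<gamma>"
  shows "fourier_coeff m (\<lambda>x. f x - g x) \<gamma> = fourier_coeff m f \<gamma> - fourier_coeff m g \<gamma>"
  unfolding fourier_coeff_def
  using integrable_mult_character[OF assms(1,3)] integrable_mult_character[OF assms(2,3)]
  by (simp add: left_diff_distrib)

lemma fourier_coeff_le:
  assumes "integrable m f" "group_character \<gamma>"
  shows "norm (fourier_coeff m f \<gamma>) \<le> (\<integral>x. norm (f x) \<partial>m)"
proof -
  have "norm (fourier_coeff m f \<gamma>) \<le> (\<integral>x. norm (f x * cnj (\<gamma> x)) \<partial>m)"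
    unfolding fourier_coeff_def by (rule integral_norm_bound)
  then show ?thesis using assms(2) by (simp add: norm_mult group_character_def)
qed

lemma spec_add: "spec a f \<Longrightarrow> spec b g \<Longrightarrow> spec (\<lambda>n. a n + b n) (\<lambda>x. f x + g x)"
  by (auto simp: spec_def fourier_coeff_add h_char)

lemma spec_diff: "spec a f \<Longrightarrow> spec b g \<Longrightarrow> spec (\<lambda>n. a n - b n) (\<lambda>x. f x - g x)"
  by (auto simp: spec_def fourier_coeff_diff h_char)

lemma spec_cmult: "spec a f \<Longrightarrow> spec (\<lambda>n. c * a n) (\<lambda>x. c * f x)"
  by (auto simp: spec_def fourier_coeff_cmult)

lemma spec_unique:
  assumes "spec a f" "spec a g"
  shows "AE x in m. f x = g x"
proof -
  have d: "spec (\<lambda>n. a n - a n) (\<lambda>x. f x - g x)" by (rule spec_diff[OF assms])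
  have "AE x in m. f x - g x = 0"
  proof (rule fourier_uniqueness)
    fix \<gamma> :: "'g \<Rightarrow> complex" assume "group_character \<gamma>"
    then show "fourier_coeff m (\<lambda>x. f x - g x) \<gamma> = 0"
      using specD(2)[OF d] specD(3)[OF d] by (cases "\<exists>n. \<gamma> = h n") auto
  qed (rule specD[OF d])
  then show ?thesis by eventually_elim simp
qed

lemma spec_coeff_le: "spec a f \<Longrightarrow> norm (a n) \<le> (\<integral>x. norm (f x) \<partial>m)"
  using fourier_coeff_le[OF _ h_char[of n], of f] by (simp add: spec_def)

lemma spec_L1_limit:
  assumes s: "\<And>k. spec (a k) (f k)" and g: "integrable m g"
    and lim: "(\<lambda>k. \<integral>x. norm (f k x - g x) \<partial>m) \<longlonglongrightarrow> 0" and a: "\<And>n. (\<lambda>k. a k n) \<longlonglongrightarrow> b n"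
  shows "spec b g"
proof -
  have fi: "integrable m (f k)" for k using s specD by blast
  have c: "(\<lambda>k. fourier_coeff m (f k) \<gamma>) \<longlonglongrightarrow> fourier_coeff m g \<gamma>" if "group_character \<gamma>" for \<gamma>
  proof -
    have "(\<lambda>k. fourier_coeff m (f k) \<gamma> - fourier_coeff m g \<gamma>) \<longlonglongrightarrow> 0"
    proof (rule Lim_null_comparison[OF _ lim], rule always_eventually, rule allI)
      fix k
      show "norm (fourier_coeff m (f k) \<gamma> - fourier_coeff m g \<gamma>) \<le> (\<integral>x. norm (f k x - g x) \<partial>m)"
        using fourier_coeff_le[of "\<lambda>x. f k x - g x", OF _ that] fourier_coeff_diff[OF fi g that] fi g by simp
    qed
    then show ?thesis by (rule LIM_zero_cancel)
  qed
  show ?thesis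
    unfolding spec_def
  proof (intro conjI allI impI)
    fix n
    have "(\<lambda>k. a k n) \<longlonglongrightarrow> fourier_coeff m g (h n)" using c[OF h_char[of n]] specD(2)[OF s] by simp
    then show "fourier_coeff m g (h n) = b n" using a[of n] LIMSEQ_unique by blast
  next
    fix \<gamma> assume \<gamma>: "group_character \<gamma>" "\<forall>n. \<gamma> \<noteq> h n"
    then have "fourier_coeff m (f k) \<gamma> = 0" for k using specD(3)[OF s] by blast
    then show "fourier_coeff m g \<gamma> = 0" using c[OF \<gamma>(1)] LIMSEQ_unique[OF _ tendsto_const] by simp
  qed (rule g)
qed

definition dpoly :: "nat set \<Rightarrow> (nat \<Rightarrow> complex) \<Rightarrow> 'g \<Rightarrow> complex" where
  "dpoly S c x = (\<Sum>n\<in>S. c n * h n x)"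

lemma dpoly_cont: "continuous_on UNIV (dpoly S c)"
  unfolding dpoly_def[abs_def] by (intro continuous_intros h_cont)

lemma dpoly_le: "norm (dpoly S c x) \<le> (\<Sum>n\<in>S. norm (c n))"
  unfolding dpoly_def by (rule order_trans[OF norm_sum]) (simp add: norm_mult)

lemma spec_dpoly:
  assumes "finite S"
  shows "spec (\<lambda>n. if n \<in> S then c n else 0) (dpoly S c)"
proof -
  have fc: "fourier_coeff m (dpoly S c) \<gamma> = (\<Sum>n\<in>S. c n * (if \<gamma> = h n then 1 else 0))" if \<gamma>: "group_character \<gamma>" for \<gamma>
  proof -
    have "fourier_coeff m (dpoly S c) \<gamma> = (\<integral>x. (\<Sum>n\<in>S. c n * (h n x * cnj (\<gamma> x))) \<partial>m)"
      unfolding fourier_coeff_def dpoly_def by (simp add: sum_distrib_right mult.assoc)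
    also have "\<dots> = (\<Sum>n\<in>S. c n * fourier_coeff m (h n) \<gamma>)"
      using integrable_mult_character[OF continuous_integrable[OF h_cont] \<gamma>]
      by (subst Bochner_Integration.integral_sum) (auto simp: fourier_coeff_def)
    finally show ?thesis by (simp add: orthogonality[OF \<gamma> h_char])
  qed
  show ?thesis
    unfolding spec_def
  proof (intro conjI allI impI)
    show "fourier_coeff m (dpoly S c) (h n) = (if n \<in> S then c n else 0)" for n
      unfolding fc[OF h_char] h_inj using assms by (simp add: if_distrib[of "\<lambda>x. _ * x"] cong: if_cong)
    show "fourier_coeff m (dpoly S c) \<gamma> = 0" if "group_character \<gamma>" "\<forall>n. \<gamma> \<noteq> h n" for \<gamma>
      unfolding fc[OF that(1)] using that(2) by simp
  qed (rule continuous_integrable[OF dpoly_cont])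
qed

definition Pois :: "real \<Rightarrow> ('g \<Rightarrow> complex) \<Rightarrow> 'g \<Rightarrow> complex" where
  "Pois \<epsilon> = flow_avg \<beta> (poisson \<epsilon>) (\<lambda>_. 1)"

text \<open>The Poisson average with frequencies measured from \<open>R\<close>; its multiplier at \<open>lam n\<close> is
  \<open>exp (- \<epsilon> * (R + \<bar>lam n - R\<bar>))\<close>.\<close>
definition Tail :: "real \<Rightarrow> real \<Rightarrow> ('g \<Rightarrow> complex) \<Rightarrow> 'g \<Rightarrow> complex" where
  "Tail \<epsilon> R f x = of_real (exp (- \<epsilon> * R)) * flow_avg \<beta> (poisson \<epsilon>) (\<lambda>t. exp (\<i> * of_real R * of_real t)) f x"

lemma flow_average_Pois: "flow_average \<beta> m (poisson \<epsilon>) (\<lambda>_. 1)"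
  by (intro flow_average.intro haar_flow_axioms prob_space_poisson flow_average_axioms.intro) auto

lemma flow_average_Tail: "flow_average \<beta> m (poisson \<epsilon>) (\<lambda>t. exp (\<i> * of_real R * of_real t))"
  by (intro flow_average.intro haar_flow_axioms prob_space_poisson flow_average_axioms.intro)
     (auto intro!: borel_measurable_continuous_onI continuous_intros simp: norm_exp_eq_Re)

lemma spec_avg:
  assumes avg: "flow_average \<beta> m \<kappa> \<phi>" and s: "spec a f"
  shows "spec (\<lambda>n. a n * (\<integral>t. \<phi> t * h n (\<beta> t) \<partial>\<kappa>)) (flow_avg \<beta> \<kappa> \<phi> f)"
proof -
  interpret flow_average \<beta> m \<kappa> \<phi> by (rule avg)
  show ?thesis
    using s unfolding spec_def by (auto intro: integrable_avg simp: fourier_coeff_avg h_char)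
qed

lemma spec_Pois:
  assumes "spec a f" "\<epsilon> > 0"
  shows "spec (\<lambda>n. a n * of_real (exp (- \<epsilon> * lam n))) (Pois \<epsilon> f)"
  using spec_avg[OF flow_average_Pois[of \<epsilon>] assms(1)] poisson_char[OF assms(2), of "lam _"] lam_nonneg
  by (simp add: Pois_def h_\<beta>)

lemma spec_Tail:
  assumes "spec a f" "\<epsilon> > 0"
  shows "spec (\<lambda>n. a n * of_real (exp (- \<epsilon> * (R + \<bar>lam n - R\<bar>)))) (Tail \<epsilon> R f)"
proof -
  have "(\<integral>t. exp (\<i> * of_real R * of_real t) * h n (\<beta> t) \<partial>poisson \<epsilon>) = of_real (exp (- \<epsilon> * \<bar>lam n - R\<bar>))" for n
  proof -
    have "exp (\<i> * of_real R * of_real t) * h n (\<beta> t) = exp (- (\<i> * of_real (lam n - R) * of_real t))" for t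
      unfolding h_\<beta> by (simp add: algebra_simps flip: exp_add)
    then show ?thesis using poisson_char[OF assms(2), of "lam n - R"] by simp
  qed
  then have "spec (\<lambda>n. of_real (exp (- \<epsilon> * R)) * (a n * of_real (exp (- \<epsilon> * \<bar>lam n - R\<bar>)))) (Tail \<epsilon> R f)"
    using spec_cmult[OF spec_avg[OF flow_average_Tail[of \<epsilon> R] assms(1)], of "of_real (exp (- \<epsilon> * R))"]
    unfolding Tail_def[abs_def] by simp
  moreover have "of_real (exp (- \<epsilon> * R)) * (a n * of_real (exp (- \<epsilon> * \<bar>lam n - R\<bar>))) = a n * of_real (exp (- \<epsilon> * (R + \<bar>lam n - R\<bar>)))" for n
    by (simp add: distrib_left exp_add mult_ac exp_diff divide_inverse exp_minus)
  ultimately show ?thesis by (simp only:)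
qed

definition trunc :: "real \<Rightarrow> real \<Rightarrow> (nat \<Rightarrow> complex) \<Rightarrow> 'g \<Rightarrow> complex" where
  "trunc \<epsilon> R a = dpoly {n. lam n < R} (\<lambda>n. a n * of_real (exp (- \<epsilon> * lam n) - exp (- \<epsilon> * (2 * R - lam n))))"

text \<open>The multiplier of \<open>Tail\<close> agrees with \<open>exp (- \<epsilon> * lam n)\<close> as soon as \<open>lam n \<ge> R\<close>, so the difference of the two
  averages involves only the finitely many frequencies below \<open>R\<close>. The operator \<open>Tail\<close> has norm at most
  \<open>exp (- \<epsilon> * R)\<close>. So a translated series is, up to an error that is small uniformly on bounded sets, a
  polynomial whose coefficients depend on finitely many coefficients of the series.\<close>
lemma Pois_split:
  assumes "spec a f" "\<epsilon> > 0"
  shows "AE x in m. Pois \<epsilon> f x = trunc \<epsilon> R a x + Tail \<epsilon> R f x"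
proof (rule spec_unique[OF spec_Pois[OF assms]])
  have "spec (\<lambda>n. (if n \<in> {n. lam n < R} then a n * of_real (exp (- \<epsilon> * lam n) - exp (- \<epsilon> * (2 * R - lam n))) else 0)
     + a n * of_real (exp (- \<epsilon> * (R + \<bar>lam n - R\<bar>)))) (\<lambda>x. trunc \<epsilon> R a x + Tail \<epsilon> R f x)"
    unfolding trunc_def by (rule spec_add[OF spec_dpoly[OF finite_below] spec_Tail[OF assms]])
  also have "(\<lambda>n. (if n \<in> {n. lam n < R} then a n * of_real (exp (- \<epsilon> * lam n) - exp (- \<epsilon> * (2 * R - lam n))) else 0)
     + a n * of_real (exp (- \<epsilon> * (R + \<bar>lam n - R\<bar>)))) = (\<lambda>n. a n * of_real (exp (- \<epsilon> * lam n)))"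
  proof
    fix n
    have "R + \<bar>lam n - R\<bar> = 2 * R - lam n" if "lam n < R" using that by simp
    moreover have "R + \<bar>lam n - R\<bar> = lam n" if "\<not> lam n < R" using that by simp
    ultimately show "(if n \<in> {n. lam n < R} then a n * of_real (exp (- \<epsilon> * lam n) - exp (- \<epsilon> * (2 * R - lam n))) else 0)
     + a n * of_real (exp (- \<epsilon> * (R + \<bar>lam n - R\<bar>))) = a n * of_real (exp (- \<epsilon> * lam n))"
      by (cases "lam n < R") (simp_all add: right_diff_distrib)
  qed
  finally show "spec (\<lambda>n. a n * of_real (exp (- \<epsilon> * lam n))) (\<lambda>x. trunc \<epsilon> R a x + Tail \<epsilon> R f x)" .
qed

lemma trunc_le:
  assumes "\<epsilon> > 0"
  shows "norm (trunc \<epsilon> R a x) \<le> (\<Sum>n | lam n < R. norm (a n))"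
proof -
  have "norm (complex_of_real (exp (- \<epsilon> * lam n) - exp (- \<epsilon> * (2 * R - lam n)))) \<le> 1" if "lam n < R" for n
  proof -
    have "exp (- \<epsilon> * (2 * R - lam n)) \<le> exp (- \<epsilon> * lam n)" using assms that by simp
    moreover have "exp (- \<epsilon> * lam n) \<le> 1" using assms lam_nonneg[of n] by simp
    moreover have "0 \<le> exp (- \<epsilon> * (2 * R - lam n))" by simp
    ultimately show ?thesis unfolding norm_of_real by linarith
  qed
  then have "norm (a n * of_real (exp (- \<epsilon> * lam n) - exp (- \<epsilon> * (2 * R - lam n)))) \<le> norm (a n)" if "lam n < R" for n
    unfolding norm_mult using that by (intro mult_left_le) auto
  then have "(\<Sum>n | lam n < R. norm (a n * of_real (exp (- \<epsilon> * lam n) - exp (- \<epsilon> * (2 * R - lam n))))) \<le> (\<Sum>n | lam n < R. norm (a n))"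
    by (intro sum_mono) auto
  then show ?thesis unfolding trunc_def by (rule order_trans[OF dpoly_le])
qed

end

section \<open>Poisson means in the mean\<close>

context hardy_setting
begin

definition N1 :: "('g \<Rightarrow> complex) \<Rightarrow> real" where
  "N1 f = (\<integral>x. norm (f x) \<partial>m)"

lemma N1_nonneg [simp]: "0 \<le> N1 f"
  by (simp add: N1_def)

lemma N1_cong_AE:
  assumes "integrable m f" "integrable m g" "AE x in m. f x = g x"
  shows "N1 f = N1 g"
  unfolding N1_def using assms by (intro integral_cong_AE) (auto elim!: eventually_mono)

lemma N1_triangle:
  assumes "integrable m f" "integrable m g"
  shows "N1 (\<lambda>x. f x + g x) \<le> N1 f + N1 g"
proof -
  have "N1 (\<lambda>x. f x + g x) \<le> (\<integral>x. norm (f x) + norm (g x) \<partial>m)"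
    unfolding N1_def using assms by (intro integral_mono norm_triangle_ineq) auto
  then show ?thesis using assms by (simp add: N1_def)
qed

lemma N1_diff_triangle:
  assumes "integrable m f" "integrable m g" "integrable m k"
  shows "N1 (\<lambda>x. f x - k x) \<le> N1 (\<lambda>x. f x - g x) + N1 (\<lambda>x. g x - k x)"
  using N1_triangle[of "\<lambda>x. f x - g x" "\<lambda>x. g x - k x"] assms by simp

lemma N1_commute: "N1 (\<lambda>x. f x - g x) = N1 (\<lambda>x. g x - f x)"
  by (simp add: N1_def norm_minus_commute)

lemma N1_le_add_diff:
  assumes "integrable m f" "integrable m g"
  shows "N1 f \<le> N1 g + N1 (\<lambda>x. f x - g x)"
  using N1_triangle[of g "\<lambda>x. f x - g x"] assms by simp

lemma N1_bounded:
  assumes "\<And>x. norm (f x) \<le> B" "integrable m f"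
  shows "N1 f \<le> B"
proof -
  have "N1 f \<le> (\<integral>x. B \<partial>m)" unfolding N1_def using assms by (intro integral_mono) auto
  then show ?thesis by simp
qed

lemma integrable_Pois: "integrable m f \<Longrightarrow> integrable m (Pois \<epsilon> f)"
  unfolding Pois_def by (rule flow_average.integrable_avg[OF flow_average_Pois])

lemma N1_Pois: "integrable m f \<Longrightarrow> N1 (Pois \<epsilon> f) \<le> N1 f"
  unfolding Pois_def N1_def by (rule flow_average.avg_L1[OF flow_average_Pois])

lemma Pois_diff:
  "integrable m f \<Longrightarrow> integrable m g \<Longrightarrow> AE x in m. Pois \<epsilon> (\<lambda>x. f x - g x) x = Pois \<epsilon> f x - Pois \<epsilon> g x"
  unfolding Pois_def by (rule flow_average.avg_diff[OF flow_average_Pois])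

lemma N1_Pois_diff:
  assumes "integrable m f" "integrable m g"
  shows "N1 (\<lambda>x. Pois \<epsilon> f x - Pois \<epsilon> g x) \<le> N1 (\<lambda>x. f x - g x)"
proof -
  have "N1 (\<lambda>x. Pois \<epsilon> f x - Pois \<epsilon> g x) = N1 (Pois \<epsilon> (\<lambda>x. f x - g x))"
  proof (rule N1_cong_AE)
    show "AE x in m. Pois \<epsilon> f x - Pois \<epsilon> g x = Pois \<epsilon> (\<lambda>x. f x - g x) x"
      using Pois_diff[OF assms, of \<epsilon>] by eventually_elim simp
  qed (use assms in \<open>auto intro!: integrable_Pois\<close>)
  then show ?thesis using N1_Pois[of "\<lambda>x. f x - g x"] assms by simp
qed

lemma integrable_Tail: "integrable m f \<Longrightarrow> integrable m (Tail \<epsilon> R f)"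
  unfolding Tail_def[abs_def] by (intro integrable_mult_right flow_average.integrable_avg[OF flow_average_Tail])

lemma N1_Tail: "integrable m f \<Longrightarrow> N1 (Tail \<epsilon> R f) \<le> exp (- \<epsilon> * R) * N1 f"
  using flow_average.avg_L1[OF flow_average_Tail, of f \<epsilon> R] by (simp add: N1_def Tail_def norm_mult)

lemma Tail_Lp:
  assumes "Lp_le p m B f" "1 \<le> p"
  shows "Lp_le p m (exp (- \<epsilon> * R) * B) (Tail \<epsilon> R f)"
  unfolding Tail_def[abs_def]
  by (rule Lp_le_scale[OF flow_average.avg_Lp[OF flow_average_Tail assms]]) simp

lemma Pois_Lp: "Lp_le p m B f \<Longrightarrow> 1 \<le> p \<Longrightarrow> Lp_le p m B (Pois \<epsilon> f)"
  unfolding Pois_def by (rule flow_average.avg_Lp[OF flow_average_Pois])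

lemma integrable_trunc: "integrable m (trunc \<epsilon> R a)"
  unfolding trunc_def by (rule continuous_integrable[OF dpoly_cont])

lemma N1_Pois_trunc:
  assumes "spec a f" "\<epsilon> > 0"
  shows "N1 (\<lambda>x. Pois \<epsilon> f x - trunc \<epsilon> R a x) \<le> exp (- \<epsilon> * R) * N1 f"
proof -
  have fi: "integrable m f" using assms specD by blast
  have "N1 (\<lambda>x. Pois \<epsilon> f x - trunc \<epsilon> R a x) = N1 (Tail \<epsilon> R f)"
    by (rule N1_cong_AE)
       (use Pois_split[OF assms, of R] integrable_Pois[OF fi] integrable_trunc integrable_Tail[OF fi] in \<open>auto elim!: eventually_mono\<close>)
  then show ?thesis using N1_Tail[OF fi] by simp
qed

lemma N1_Pois_le:
  assumes "spec a f" "\<epsilon> > 0"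
  shows "N1 (Pois \<epsilon> f) \<le> (\<Sum>n | lam n < R. norm (a n)) + exp (- \<epsilon> * R) * N1 f"
proof -
  have fi: "integrable m f" using assms specD by blast
  have "N1 (Pois \<epsilon> f) \<le> N1 (trunc \<epsilon> R a) + N1 (\<lambda>x. Pois \<epsilon> f x - trunc \<epsilon> R a x)"
    by (rule N1_le_add_diff[OF integrable_Pois[OF fi] integrable_trunc])
  also have "\<dots> \<le> (\<Sum>n | lam n < R. norm (a n)) + exp (- \<epsilon> * R) * N1 f"
    by (intro add_mono N1_Pois_trunc[OF assms] N1_bounded trunc_le assms integrable_trunc)
  finally show ?thesis .
qed

lemma Pois_Lp_le:
  assumes "spec a f" "\<epsilon> > 0" "Lp_le p m B f" "1 \<le> p"
  shows "Lp_le p m (2 * ((\<Sum>n | lam n < R. norm (a n)) + exp (- \<epsilon> * R) * B)) (Pois \<epsilon> f)"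
proof (rule Lp_le_AE_cong)
  show "Lp_le p m (2 * ((\<Sum>n | lam n < R. norm (a n)) + exp (- \<epsilon> * R) * B)) (\<lambda>x. trunc \<epsilon> R a x + Tail \<epsilon> R f x)"
    by (intro Lp_le_add Tail_Lp Lp_le_bounded trunc_le assms) (use integrable_trunc in auto)
  show "AE x in m. trunc \<epsilon> R a x + Tail \<epsilon> R f x = Pois \<epsilon> f x"
    using Pois_split[OF assms(1,2), of R] by eventually_elim simp
  show "Pois \<epsilon> f \<in> borel_measurable m"
    using integrable_Pois[OF specD(1)[OF assms(1)]] by simp
qed

lemma Pois_dpoly:
  assumes "\<delta> > 0"
  shows "Pois \<delta> (dpoly S c) x = dpoly S (\<lambda>n. c n * of_real (exp (- \<delta> * lam n))) x"
proof -
  have "dpoly S c (x + \<beta> t) = (\<Sum>n\<in>S. (c n * h n x) * exp (- (\<i> * of_real (lam n) * of_real t)))" for t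
    by (simp add: dpoly_def h_add h_\<beta> mult.assoc)
  then have "Pois \<delta> (dpoly S c) x = (\<integral>t. (\<Sum>n\<in>S. (c n * h n x) * exp (- (\<i> * of_real (lam n) * of_real t))) \<partial>poisson \<delta>)"
    by (simp add: Pois_def flow_avg_def)
  also have "\<dots> = (\<Sum>n\<in>S. (c n * h n x) * of_real (exp (- \<delta> * lam n)))"
    by (rule poisson_H1_gap(1)[OF assms zero_less_one lam_nonneg])
  finally show ?thesis by (simp add: dpoly_def mult_ac)
qed

text \<open>For fixed \<open>x\<close>, the function \<open>t \<mapsto> q (x + \<beta> t)\<close> is the boundary function of an analytic function in the
  half-plane whose value at distance \<open>\<delta>\<close> from the origin is \<open>q1 x\<close>, so the gap inequality applies; integrate it over
  \<open>x\<close>. By invariance the left-hand side is the mean of \<open>\<bar>q x - q1 (x - \<beta> t)\<bar>\<close>, and averaging \<open>q1 (x - \<beta> t)\<close> over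
  \<open>t\<close> gives \<open>Pois (2 * \<delta>) q\<close>, the Poisson kernel being even.\<close>
lemma dpoly_gap:
  assumes \<delta>: "\<delta> > 0" and \<eta>: "\<eta> > 0"
  shows "N1 (\<lambda>x. dpoly S c x - Pois (2 * \<delta>) (dpoly S c) x) \<le>
    \<eta> * N1 (dpoly S c) + (N1 (dpoly S c) - N1 (Pois \<delta> (dpoly S c))) / \<eta>"
proof -
  define q where "q = dpoly S c"
  define c1 where "c1 n = c n * of_real (exp (- \<delta> * lam n))" for n
  define q1 where "q1 = dpoly S c1"
  have P1: "Pois \<delta> q = q1" unfolding q_def q1_def c1_def by (rule ext) (rule Pois_dpoly[OF \<delta>])
  interpret F: flow_average \<beta> m "poisson \<delta>" "\<lambda>_. 1" by (rule flow_average_Pois)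
  have qc: "continuous_on UNIV q" "continuous_on UNIV q1" unfolding q_def q1_def by (rule dpoly_cont)+
  have bd: "norm (q x) \<le> (\<Sum>n\<in>S. norm (c n))" "norm (q1 x) \<le> (\<Sum>n\<in>S. norm (c1 n))" for x
    unfolding q_def q1_def by (rule dpoly_le)+
  have pairi: "integrable (m \<Otimes>\<^sub>M poisson \<delta>) F"
    if "continuous_on UNIV F" "\<And>z. norm (F z) \<le> B" for F :: "'g \<times> real \<Rightarrow> complex" and B
  proof (rule F.pair.integrable_const_bound[of _ B])
    have "F \<in> measurable (borel \<Otimes>\<^sub>M borel) borel" by (rule borel_measurable_pair_continuous[OF that(1)])
    also have "measurable (borel \<Otimes>\<^sub>M borel) borel = measurable (m \<Otimes>\<^sub>M poisson \<delta>) borel"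
      by (intro measurable_cong_sets sets_pair_measure_cong) simp_all
    finally show "F \<in> borel_measurable (m \<Otimes>\<^sub>M poisson \<delta>)" .
  qed (use that(2) in auto)
  have cq: "continuous_on UNIV (\<lambda>z::'g \<times> real. g (fst z + \<beta> (k (snd z))))" if "continuous_on UNIV g" "continuous_on UNIV k"
    for g :: "'g \<Rightarrow> complex" and k
    by (intro continuous_on_compose2[OF that(1)] continuous_intros continuous_on_compose2[OF cont_\<beta>] continuous_on_compose2[OF that(2)]) auto
  have i1: "integrable (m \<Otimes>\<^sub>M poisson \<delta>) (\<lambda>(x, t). q (x + \<beta> t) - q1 x)"
    unfolding case_prod_beta'
    by (rule pairi[of _ "(\<Sum>n\<in>S. norm (c n)) + (\<Sum>n\<in>S. norm (c1 n))"])
       (auto intro!: continuous_intros cq qc continuous_on_compose2[OF qc(2)] order_trans[OF norm_triangle_ineq4] add_mono bd)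
  have i2: "integrable (m \<Otimes>\<^sub>M poisson \<delta>) (\<lambda>(x, t). q x - q1 (x + \<beta> (- t)))"
    unfolding case_prod_beta'
    by (rule pairi[of _ "(\<Sum>n\<in>S. norm (c n)) + (\<Sum>n\<in>S. norm (c1 n))"])
       (auto intro!: continuous_intros cq qc continuous_on_compose2[OF qc(1)] order_trans[OF norm_triangle_ineq4] add_mono bd)
  have n1: "integrable (m \<Otimes>\<^sub>M poisson \<delta>) (\<lambda>(x, t). norm (q (x + \<beta> t) - q1 x))"
    using integrable_norm[OF i1] by (simp add: case_prod_beta')
  have n2: "integrable (m \<Otimes>\<^sub>M poisson \<delta>) (\<lambda>(x, t). norm (q x - q1 (x + \<beta> (- t))))"
    using integrable_norm[OF i2] by (simp add: case_prod_beta')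
  have qi: "integrable m q" by (rule continuous_integrable[OF qc(1)])
  have nqi: "integrable m (\<lambda>x. norm (q x))" using qi by simp
  have P2: "(\<integral>t. q1 (x + \<beta> (- t)) \<partial>poisson \<delta>) = Pois (2 * \<delta>) q x" for x
  proof -
    have "q1 (x + \<beta> (- t)) = (\<Sum>n\<in>S. c1 n * h n x * exp (- (\<i> * of_real (- lam n) * of_real t)))" for t
      by (simp add: q1_def dpoly_def h_add h_\<beta> mult.assoc)
    then have "(\<integral>t. q1 (x + \<beta> (- t)) \<partial>poisson \<delta>) = (\<Sum>n\<in>S. c1 n * h n x * (\<integral>t. exp (- (\<i> * of_real (- lam n) * of_real t)) \<partial>poisson \<delta>))"
    proof (simp only:, subst Bochner_Integration.integral_sum)
      show "integrable (poisson \<delta>) (\<lambda>t. c1 n * h n x * exp (- (\<i> * of_real (- lam n) * of_real t)))" for n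
        by (intro integrable_mult_right F.kappa.integrable_const_bound[of _ 1])
           (auto simp: norm_exp_eq_Re intro!: borel_measurable_continuous_onI continuous_intros)
    qed simp
    also have "\<dots> = (\<Sum>n\<in>S. c1 n * h n x * of_real (exp (- \<delta> * lam n)))"
      using poisson_char[OF \<delta>, of "- lam _"] lam_nonneg by simp
    also have "\<dots> = dpoly S (\<lambda>n. c n * of_real (exp (- (2 * \<delta>) * lam n))) x"
      unfolding dpoly_def c1_def by (intro sum.cong refl) (simp add: mult_ac distrib_left flip: exp_add of_real_mult)
    also have "\<dots> = Pois (2 * \<delta>) q x" unfolding q_def using Pois_dpoly[of "2 * \<delta>"] \<delta> by simp
    finally show ?thesis .
  qed
  have "N1 (\<lambda>x. q x - Pois (2 * \<delta>) q x) \<le> (\<integral>x. (\<integral>t. norm (q x - q1 (x + \<beta> (- t))) \<partial>poisson \<delta>) \<partial>m)"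
    unfolding N1_def
  proof (rule integral_mono)
    fix x
    have "continuous_on UNIV (\<lambda>t. q1 (x + \<beta> (- t)))"
      by (intro continuous_on_compose2[OF qc(2)] continuous_on_compose2[OF cont_\<beta>] continuous_intros) auto
    then have [measurable]: "(\<lambda>t. q1 (x + \<beta> (- t))) \<in> borel_measurable borel" by (rule borel_measurable_continuous_onI)
    have i: "integrable (poisson \<delta>) (\<lambda>t. q1 (x + \<beta> (- t)))"
      by (rule F.kappa.integrable_const_bound[of _ "\<Sum>n\<in>S. norm (c1 n)"]) (simp_all add: bd)
    have "q x - Pois (2 * \<delta>) q x = (\<integral>t. q x - q1 (x + \<beta> (- t)) \<partial>poisson \<delta>)"
      unfolding P2[symmetric] using i F.kappa.prob_space by simp
    then show "norm (q x - Pois (2 * \<delta>) q x) \<le> (\<integral>t. norm (q x - q1 (x + \<beta> (- t))) \<partial>poisson \<delta>)"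
      using integral_norm_bound by metis
  qed (use integrable_Pois[OF qi] qi F.pair.integrable_fst'[OF n2] in auto)
  also have "\<dots> = (\<integral>t. (\<integral>x. norm (q x - q1 (x + \<beta> (- t))) \<partial>m) \<partial>poisson \<delta>)"
    using F.pair.Fubini_integral[OF n2] by simp
  also have "\<dots> = (\<integral>t. (\<integral>x. norm (q (x + \<beta> t) - q1 x) \<partial>m) \<partial>poisson \<delta>)"
  proof (rule Bochner_Integration.integral_cong[OF refl])
    fix t
    have "(\<lambda>x. norm (q x - q1 (x + \<beta> (- t)))) \<in> borel_measurable borel"
      by (intro borel_measurable_continuous_onI continuous_intros qc continuous_translate)
    from integral_translate[OF this, of "\<beta> t"]
    show "(\<integral>x. norm (q x - q1 (x + \<beta> (- t))) \<partial>m) = (\<integral>x. norm (q (x + \<beta> t) - q1 x) \<partial>m)"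
      by (simp add: \<beta>_minus)
  qed
  also have "\<dots> = (\<integral>x. (\<integral>t. norm (q (x + \<beta> t) - q1 x) \<partial>poisson \<delta>) \<partial>m)"
    using F.pair.Fubini_integral[OF n1] by simp
  also have "\<dots> \<le> (\<integral>x. \<eta> * (\<integral>t. norm (q (x + \<beta> t)) \<partial>poisson \<delta>) + ((\<integral>t. norm (q (x + \<beta> t)) \<partial>poisson \<delta>) - norm (q1 x)) / \<eta> \<partial>m)"
  proof (rule integral_mono)
    fix x
    have e: "q (x + \<beta> t) = (\<Sum>n\<in>S. (c n * h n x) * exp (- (\<i> * of_real (lam n) * of_real t)))" for t
      by (simp add: q_def dpoly_def h_add h_\<beta> mult.assoc)
    have e1: "q1 x = (\<Sum>n\<in>S. (c n * h n x) * of_real (exp (- \<delta> * lam n)))"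
      by (simp add: q1_def dpoly_def c1_def mult_ac)
    show "(\<integral>t. norm (q (x + \<beta> t) - q1 x) \<partial>poisson \<delta>) \<le> \<eta> * (\<integral>t. norm (q (x + \<beta> t)) \<partial>poisson \<delta>) + ((\<integral>t. norm (q (x + \<beta> t)) \<partial>poisson \<delta>) - norm (q1 x)) / \<eta>"
      unfolding e e1 by (rule poisson_H1_gap(2)[OF \<delta> \<eta> lam_nonneg])
  qed (use F.pair.integrable_fst'[OF n1] F.pair.integrable_fst'[OF F.integrable_flow(1)[OF nqi]] continuous_integrable[OF qc(2)] in auto)
  also have "\<dots> = \<eta> * N1 q + (N1 q - N1 q1) / \<eta>"
    using F.pair.integrable_fst'[OF F.integrable_flow(1)[OF nqi]] continuous_integrable[OF qc(2)]
    by (simp add: F.integrable_flow(2)[OF nqi] N1_def)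
  finally show ?thesis unfolding q_def[symmetric] P1 .
qed

lemma Pois_Pois:
  assumes "spec a f" "\<epsilon> > 0" "\<delta> > 0"
  shows "AE x in m. Pois \<delta> (Pois \<epsilon> f) x = Pois (\<epsilon> + \<delta>) f x"
proof (rule spec_unique)
  show "spec (\<lambda>n. a n * of_real (exp (- \<epsilon> * lam n)) * of_real (exp (- \<delta> * lam n))) (Pois \<delta> (Pois \<epsilon> f))"
    by (intro spec_Pois assms)
  have "spec (\<lambda>n. a n * of_real (exp (- (\<epsilon> + \<delta>) * lam n))) (Pois (\<epsilon> + \<delta>) f)"
    by (intro spec_Pois assms) (use assms in auto)
  moreover have "a n * of_real (exp (- (\<epsilon> + \<delta>) * lam n)) = a n * of_real (exp (- \<epsilon> * lam n)) * of_real (exp (- \<delta> * lam n))" for n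
    by (simp add: algebra_simps flip: of_real_mult exp_add)
  ultimately show "spec (\<lambda>n. a n * of_real (exp (- \<epsilon> * lam n)) * of_real (exp (- \<delta> * lam n))) (Pois (\<epsilon> + \<delta>) f)"
    by (simp only:)
qed

text \<open>Polynomials are dense enough: \<open>Pois \<epsilon> f\<close> is a limit in mean of the polynomials \<open>trunc \<epsilon> R a\<close>.\<close>
lemma Pois_gap:
  assumes s: "spec a f" and \<epsilon>: "\<epsilon> > 0" and \<delta>: "\<delta> > 0" and \<eta>: "\<eta> > 0"
  shows "N1 (\<lambda>x. Pois \<epsilon> f x - Pois (\<epsilon> + 2 * \<delta>) f x) \<le> \<eta> * N1 (Pois \<epsilon> f) + (N1 (Pois \<epsilon> f) - N1 (Pois (\<epsilon> + \<delta>) f)) / \<eta>"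
proof -
  have fi: "integrable m f" using s specD by blast
  define P where "P = Pois \<epsilon> f"
  have Pi: "integrable m P" unfolding P_def by (rule integrable_Pois[OF fi])
  have A1: "N1 (Pois (\<epsilon> + \<delta>) f) = N1 (Pois \<delta> P)"
    by (rule N1_cong_AE) (use Pois_Pois[OF s \<epsilon> \<delta>] integrable_Pois[OF fi] integrable_Pois[OF Pi] in \<open>auto simp: P_def elim!: eventually_mono\<close>)
  have A2: "N1 (\<lambda>x. Pois \<epsilon> f x - Pois (\<epsilon> + 2 * \<delta>) f x) = N1 (\<lambda>x. P x - Pois (2 * \<delta>) P x)"
    by (rule N1_cong_AE) (use Pois_Pois[OF s \<epsilon>, of "2 * \<delta>"] \<delta> Pi integrable_Pois[OF fi] integrable_Pois[OF Pi] in \<open>auto simp: P_def elim!: eventually_mono\<close>)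
  have main: "N1 (\<lambda>x. P x - Pois (2 * \<delta>) P x) \<le> \<eta> * N1 P + (N1 P - N1 (Pois \<delta> P)) / \<eta> + (2 + \<eta> + 2 / \<eta>) * \<tau>"
    if "\<tau> = N1 (\<lambda>x. P x - trunc \<epsilon> R a x)" for \<tau> R
  proof -
    define q where "q = trunc \<epsilon> R a"
    have qi: "integrable m q" unfolding q_def by (rule integrable_trunc)
    have t: "N1 (\<lambda>x. P x - q x) = \<tau>" using that by (simp add: q_def)
    have ii: "integrable m (Pois (2 * \<delta>) P)" "integrable m (Pois (2 * \<delta>) q)" "integrable m (Pois \<delta> P)" "integrable m (Pois \<delta> q)"
      using Pi qi by (auto intro: integrable_Pois)
    have "N1 (\<lambda>x. P x - Pois (2 * \<delta>) P x) \<le> N1 (\<lambda>x. P x - q x) + N1 (\<lambda>x. q x - Pois (2 * \<delta>) P x)"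
      by (rule N1_diff_triangle[OF Pi qi ii(1)])
    also have "N1 (\<lambda>x. q x - Pois (2 * \<delta>) P x) \<le> N1 (\<lambda>x. q x - Pois (2 * \<delta>) q x) + N1 (\<lambda>x. Pois (2 * \<delta>) q x - Pois (2 * \<delta>) P x)"
      by (rule N1_diff_triangle[OF qi ii(2,1)])
    also have "N1 (\<lambda>x. Pois (2 * \<delta>) q x - Pois (2 * \<delta>) P x) \<le> \<tau>"
      using N1_Pois_diff[OF qi Pi, of "2 * \<delta>"] t N1_commute[of q P] by simp
    also have "N1 (\<lambda>x. q x - Pois (2 * \<delta>) q x) \<le> \<eta> * N1 q + (N1 q - N1 (Pois \<delta> q)) / \<eta>"
      unfolding q_def trunc_def by (rule dpoly_gap[OF \<delta> \<eta>])
    finally have 1: "N1 (\<lambda>x. P x - Pois (2 * \<delta>) P x) \<le> \<tau> + (\<eta> * N1 q + (N1 q - N1 (Pois \<delta> q)) / \<eta> + \<tau>)"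
      using t by simp
    have 2: "N1 q \<le> N1 P + \<tau>" using N1_le_add_diff[OF qi Pi] t N1_commute[of q P] by simp
    have "N1 (Pois \<delta> P) \<le> N1 (Pois \<delta> q) + N1 (\<lambda>x. Pois \<delta> P x - Pois \<delta> q x)" by (rule N1_le_add_diff[OF ii(3,4)])
    then have 3: "N1 (Pois \<delta> P) \<le> N1 (Pois \<delta> q) + \<tau>" using N1_Pois_diff[OF Pi qi, of \<delta>] t by simp
    have "\<eta> * N1 q \<le> \<eta> * (N1 P + \<tau>)" using 2 \<eta> by simp
    moreover have "(N1 q - N1 (Pois \<delta> q)) / \<eta> \<le> (N1 P - N1 (Pois \<delta> P) + 2 * \<tau>) / \<eta>"
      using 2 3 \<eta> by (intro divide_right_mono) auto
    ultimately have "N1 (\<lambda>x. P x - Pois (2 * \<delta>) P x) \<le> \<tau> + (\<eta> * (N1 P + \<tau>) + (N1 P - N1 (Pois \<delta> P) + 2 * \<tau>) / \<eta> + \<tau>)"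
      using 1 by linarith
    also have "\<dots> = \<eta> * N1 P + (N1 P - N1 (Pois \<delta> P)) / \<eta> + (2 + \<eta> + 2 / \<eta>) * \<tau>"
      using \<eta> by (simp add: field_simps)
    finally show ?thesis .
  qed
  have t0: "(\<lambda>R::nat. N1 (\<lambda>x. P x - trunc \<epsilon> (real R) a x)) \<longlonglongrightarrow> 0"
  proof (rule Lim_null_comparison)
    show "eventually (\<lambda>R. norm (N1 (\<lambda>x. P x - trunc \<epsilon> (real R) a x)) \<le> exp (- \<epsilon> * real R) * N1 f) sequentially"
      using N1_Pois_trunc[OF s \<epsilon>] by (simp add: P_def)
    have "(\<lambda>R::nat. exp (- \<epsilon> * real R)) \<longlonglongrightarrow> 0" using \<epsilon> by real_asymp
    then show "(\<lambda>R::nat. exp (- \<epsilon> * real R) * N1 f) \<longlonglongrightarrow> 0" by (rule tendsto_mult_left_zero)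
  qed
  have "N1 (\<lambda>x. P x - Pois (2 * \<delta>) P x) \<le> \<eta> * N1 P + (N1 P - N1 (Pois \<delta> P)) / \<eta>"
  proof (rule LIMSEQ_le_const)
    show "(\<lambda>R::nat. \<eta> * N1 P + (N1 P - N1 (Pois \<delta> P)) / \<eta> + (2 + \<eta> + 2 / \<eta>) * N1 (\<lambda>x. P x - trunc \<epsilon> (real R) a x)) \<longlonglongrightarrow> \<eta> * N1 P + (N1 P - N1 (Pois \<delta> P)) / \<eta>"
      using tendsto_add[OF tendsto_const tendsto_mult[OF tendsto_const t0]] by (simp only: mult_zero_right add_0_right)
  qed (use main in blast)
  then show ?thesis unfolding A1 A2 unfolding P_def[symmetric] .
qed

end

section \<open>Compactness\<close>

context hardy_setting
begin

lemma exists_small_exp: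
  fixes \<epsilon> e K :: real
  assumes "\<epsilon> > 0" "e > 0"
  shows "\<exists>R::nat. exp (- \<epsilon> * real R) * K < e"
proof -
  have "(\<lambda>R::nat. exp (- \<epsilon> * real R)) \<longlonglongrightarrow> 0"
    using assms(1) by real_asymp
  from order_tendstoD(2)[OF tendsto_mult_left_zero[OF this, of K] assms(2)] show ?thesis
    by (auto simp: eventually_sequentially)
qed

lemma L1_limit_norm:
  assumes "\<And>k. integrable m (f k)" "integrable m g" "(\<lambda>k. N1 (\<lambda>x. f k x - g x)) \<longlonglongrightarrow> 0"
  shows "(\<lambda>k. N1 (f k)) \<longlonglongrightarrow> N1 g"
proof -
  have "(\<lambda>k. N1 (f k) - N1 g) \<longlonglongrightarrow> 0"
  proof (rule Lim_null_comparison[OF _ assms(3)], rule always_eventually, rule allI)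
    fix k
    show "norm (N1 (f k) - N1 g) \<le> N1 (\<lambda>x. f k x - g x)"
      using N1_le_add_diff[OF assms(1)[of k] assms(2)] N1_le_add_diff[OF assms(2) assms(1)[of k]] N1_commute[of "f k" g]
      by (simp add: abs_le_iff)
  qed
  then show ?thesis by (rule LIM_zero_cancel)
qed

lemma L1_limit_diff:
  assumes f: "\<And>k. integrable m (f k)" "integrable m g" "(\<lambda>k. N1 (\<lambda>x. f k x - g x)) \<longlonglongrightarrow> 0"
    and f': "\<And>k. integrable m (f' k)" "integrable m g'" "(\<lambda>k. N1 (\<lambda>x. f' k x - g' x)) \<longlonglongrightarrow> 0"
  shows "(\<lambda>k. N1 (\<lambda>x. f k x - f' k x)) \<longlonglongrightarrow> N1 (\<lambda>x. g x - g' x)"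
proof (rule L1_limit_norm)
  show "(\<lambda>k. N1 (\<lambda>x. (f k x - f' k x) - (g x - g' x))) \<longlonglongrightarrow> 0"
  proof (rule Lim_null_comparison, rule always_eventually, rule allI)
    fix k
    have "N1 (\<lambda>x. (f k x - g x) + (g' x - f' k x)) \<le> N1 (\<lambda>x. f k x - g x) + N1 (\<lambda>x. g' x - f' k x)"
      by (rule N1_triangle) (use f f' in auto)
    moreover have "(\<lambda>x. (f k x - f' k x) - (g x - g' x)) = (\<lambda>x. (f k x - g x) + (g' x - f' k x))" by auto
    ultimately show "norm (N1 (\<lambda>x. (f k x - f' k x) - (g x - g' x))) \<le> N1 (\<lambda>x. f k x - g x) + N1 (\<lambda>x. f' k x - g' x)"
      using N1_commute[of g' "f' k"] by simp
    show "(\<lambda>k. N1 (\<lambda>x. f k x - g x) + N1 (\<lambda>x. f' k x - g' x)) \<longlonglongrightarrow> 0"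
      using tendsto_add[OF f(3) f'(3)] by simp
  qed
qed (use f f' in auto)

text \<open>Apply the splitting of a Poisson mean to differences of the sequence: the polynomial part tends to
  zero with the coefficients, and the tail is small uniformly.\<close>
lemma Pois_converges:
  assumes s: "\<And>k. spec (a k) (f k)" and C: "\<And>k. N1 (f k) \<le> C"
    and a: "\<And>n. (\<lambda>k. a k n) \<longlonglongrightarrow> b n" and \<epsilon>: "\<epsilon> > 0"
  obtains g where "spec (\<lambda>n. b n * of_real (exp (- \<epsilon> * lam n))) g"
    "(\<lambda>k. N1 (\<lambda>x. Pois \<epsilon> (f k) x - g x)) \<longlonglongrightarrow> 0"
proof -
  have fi: "integrable m (f k)" for k using s specD by blast
  have Pi: "integrable m (Pois \<epsilon> (f k))" for k by (rule integrable_Pois[OF fi])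
  have C0: "0 \<le> C" using C[of 0] N1_nonneg[of "f 0"] by linarith
  have "\<exists>N. \<forall>i\<ge>N. \<forall>j\<ge>N. (\<integral>x. norm (Pois \<epsilon> (f i) x - Pois \<epsilon> (f j) x) \<partial>m) < e" if e: "e > 0" for e
  proof -
    have "e / 2 > 0" using e by simp
    then obtain R :: nat where R: "exp (- \<epsilon> * real R) * (2 * C) < e / 2"
      using exists_small_exp[OF \<epsilon>] by blast
    define S where "S = {n. lam n < real R}"
    have fS: "finite S" unfolding S_def by (rule finite_below)
    define d where "d = real (card S) + 1"
    have d: "d > 0" by (simp add: d_def)
    have "e / (4 * d) > 0" using e d by simp
    from LIMSEQ_D[OF a this] have "\<exists>N. \<forall>i\<ge>N. norm (a i n - b n) < e / (4 * d)" for n .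
    then obtain N where N: "\<And>n i. i \<ge> N n \<Longrightarrow> norm (a i n - b n) < e / (4 * d)" by metis
    define M where "M = (\<Sum>n\<in>S. N n)"
    have NM: "N n \<le> M" if "n \<in> S" for n unfolding M_def using fS that by (intro member_le_sum) auto
    have "N1 (\<lambda>x. Pois \<epsilon> (f i) x - Pois \<epsilon> (f j) x) < e" if "i \<ge> M" "j \<ge> M" for i j
    proof -
      have sd: "spec (\<lambda>n. a i n - a j n) (\<lambda>x. f i x - f j x)" by (rule spec_diff[OF s s])
      have "N1 (\<lambda>x. f i x - f j x) \<le> N1 (f i) + N1 (\<lambda>x. - f j x)"
        using N1_triangle[of "f i" "\<lambda>x. - f j x"] fi by simp
      also have "\<dots> \<le> 2 * C" using C[of i] C[of j] by (simp add: N1_def)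
      finally have n2: "N1 (\<lambda>x. f i x - f j x) \<le> 2 * C" .
      have "N1 (\<lambda>x. Pois \<epsilon> (f i) x - Pois \<epsilon> (f j) x) = N1 (Pois \<epsilon> (\<lambda>x. f i x - f j x))"
      proof (rule N1_cong_AE)
        show "AE x in m. Pois \<epsilon> (f i) x - Pois \<epsilon> (f j) x = Pois \<epsilon> (\<lambda>x. f i x - f j x) x"
          using Pois_diff[OF fi fi, of \<epsilon> i j] by eventually_elim simp
      qed (use fi Pi in \<open>auto intro!: integrable_Pois\<close>)
      also have "\<dots> \<le> (\<Sum>n\<in>S. norm (a i n - a j n)) + exp (- \<epsilon> * real R) * N1 (\<lambda>x. f i x - f j x)"
        unfolding S_def by (rule N1_Pois_le[OF sd \<epsilon>])
      also have "(\<Sum>n\<in>S. norm (a i n - a j n)) \<le> (\<Sum>n\<in>S. e / (2 * d))"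
      proof (rule sum_mono)
        fix n assume n: "n \<in> S"
        have "norm (a i n - a j n) \<le> norm (a i n - b n) + norm (a j n - b n)" by norm
        moreover have "norm (a i n - b n) < e / (4 * d)" "norm (a j n - b n) < e / (4 * d)"
          by (rule N[OF order_trans[OF NM[OF n] that(1)]] N[OF order_trans[OF NM[OF n] that(2)]])+
        moreover have "e / (2 * d) = e / (4 * d) + e / (4 * d)"
          by (simp add: add_divide_distrib[symmetric])
        ultimately show "norm (a i n - a j n) \<le> e / (2 * d)"
          by linarith
      qed
      also have "\<dots> \<le> e / 2" using e d by (simp add: d_def field_simps)
      also have "exp (- \<epsilon> * real R) * N1 (\<lambda>x. f i x - f j x) \<le> exp (- \<epsilon> * real R) * (2 * C)"
        using n2 by (intro mult_left_mono) auto
      finally show ?thesis using R by linarith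
    qed
    then show ?thesis unfolding N1_def by blast
  qed
  then obtain g where g: "integrable m g" "(\<lambda>k. \<integral>x. norm (Pois \<epsilon> (f k) x - g x) \<partial>m) \<longlonglongrightarrow> 0"
    by (rule L1_complete[OF Pi])
  have "spec (\<lambda>n. b n * of_real (exp (- \<epsilon> * lam n))) g"
    by (rule spec_L1_limit[OF spec_Pois[OF s \<epsilon>] g]) (intro tendsto_intros a)
  with g that show ?thesis unfolding N1_def by blast
qed

text \<open>This is where analyticity enters for \<open>p = 1\<close>, when bounded sequences need not have weakly convergent
  subsequences. The limits \<open>G \<epsilon>\<close> of the Poisson means inherit the gap inequality. Their norms decrease in
  \<open>\<epsilon>\<close> and are bounded, so the gaps tend to zero, and \<open>G \<epsilon>\<close> is Cauchy in mean as \<open>\<epsilon>\<close> tends to 0. Its limit has the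
  coefficients \<open>b\<close>, and Fatou's lemma gives the norm bound for every exponent.\<close>
lemma bounded_limit:
  assumes s: "\<And>k. spec (a k) (f k)" and C: "\<And>k. N1 (f k) \<le> C"
    and a: "\<And>n. (\<lambda>k. a k n) \<longlonglongrightarrow> b n"
    and p: "1 \<le> p" and Lp: "\<And>k. Lp_le p m B (f k)"
  obtains g where "spec b g" "Lp_le p m B g"
proof -
  have fi: "integrable m (f k)" for k using s specD by blast
  have Pi: "integrable m (Pois \<epsilon> (f k))" for k \<epsilon> by (rule integrable_Pois[OF fi])
  have C0: "0 \<le> C" using C[of 0] N1_nonneg[of "f 0"] by linarith
  have "\<exists>g. spec (\<lambda>n. b n * of_real (exp (- \<epsilon> * lam n))) g \<and> (\<lambda>k. N1 (\<lambda>x. Pois \<epsilon> (f k) x - g x)) \<longlonglongrightarrow> 0"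
    if \<epsilon>: "\<epsilon> > 0" for \<epsilon>
    by (rule Pois_converges[OF s C a \<epsilon>]) blast
  then have "\<forall>\<epsilon>. \<exists>g. \<epsilon> > 0 \<longrightarrow> spec (\<lambda>n. b n * of_real (exp (- \<epsilon> * lam n))) g \<and>
      (\<lambda>k. N1 (\<lambda>x. Pois \<epsilon> (f k) x - g x)) \<longlonglongrightarrow> 0" by blast
  from choice[OF this] obtain G where G: "\<forall>\<epsilon>. \<epsilon> > 0 \<longrightarrow> spec (\<lambda>n. b n * of_real (exp (- \<epsilon> * lam n))) (G \<epsilon>) \<and>
      (\<lambda>k. N1 (\<lambda>x. Pois \<epsilon> (f k) x - G \<epsilon> x)) \<longlonglongrightarrow> 0" by (rule exE)
  have Gs: "spec (\<lambda>n. b n * of_real (exp (- \<epsilon> * lam n))) (G \<epsilon>)"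
    and Gl: "(\<lambda>k. N1 (\<lambda>x. Pois \<epsilon> (f k) x - G \<epsilon> x)) \<longlonglongrightarrow> 0" if "\<epsilon> > 0" for \<epsilon>
    using G[rule_format, OF that] by (rule conjunct1, rule conjunct2)
  have Gi: "integrable m (G \<epsilon>)" if "\<epsilon> > 0" for \<epsilon> using Gs[OF that] specD by blast
  have GN: "(\<lambda>k. N1 (Pois \<epsilon> (f k))) \<longlonglongrightarrow> N1 (G \<epsilon>)" if "\<epsilon> > 0" for \<epsilon>
    by (rule L1_limit_norm[OF Pi Gi[OF that] Gl[OF that]])
  have GC: "N1 (G \<epsilon>) \<le> C" if "\<epsilon> > 0" for \<epsilon>
    by (rule LIMSEQ_le_const2[OF GN[OF that]]) (use N1_Pois[OF fi] C in \<open>meson order_trans\<close>)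
  have Gmono: "N1 (G (\<epsilon> + \<delta>)) \<le> N1 (G \<epsilon>)" if \<epsilon>: "\<epsilon> > 0" and \<delta>: "\<delta> > 0" for \<epsilon> \<delta>
  proof (rule LIMSEQ_le)
    show "(\<lambda>k. N1 (Pois (\<epsilon> + \<delta>) (f k))) \<longlonglongrightarrow> N1 (G (\<epsilon> + \<delta>))" using that by (intro GN) simp
    show "(\<lambda>k. N1 (Pois \<epsilon> (f k))) \<longlonglongrightarrow> N1 (G \<epsilon>)" using that by (intro GN) simp
    have "N1 (Pois (\<epsilon> + \<delta>) (f k)) = N1 (Pois \<delta> (Pois \<epsilon> (f k)))" for k
    proof (rule N1_cong_AE)
      show "AE x in m. Pois (\<epsilon> + \<delta>) (f k) x = Pois \<delta> (Pois \<epsilon> (f k)) x"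
        using Pois_Pois[OF s \<epsilon> \<delta>, of k] by eventually_elim simp
    qed (intro Pi integrable_Pois)+
    then show "\<exists>N. \<forall>k\<ge>N. N1 (Pois (\<epsilon> + \<delta>) (f k)) \<le> N1 (Pois \<epsilon> (f k))"
      using N1_Pois[OF Pi] by simp
  qed
  have Ggap: "N1 (\<lambda>x. G \<epsilon> x - G (\<epsilon> + 2 * \<delta>) x) \<le> \<eta> * N1 (G \<epsilon>) + (N1 (G \<epsilon>) - N1 (G (\<epsilon> + \<delta>))) / \<eta>"
    if \<epsilon>: "\<epsilon> > 0" and \<delta>: "\<delta> > 0" and \<eta>: "\<eta> > 0" for \<epsilon> \<delta> \<eta>
  proof (rule LIMSEQ_le)
    show "(\<lambda>k. N1 (\<lambda>x. Pois \<epsilon> (f k) x - Pois (\<epsilon> + 2 * \<delta>) (f k) x)) \<longlonglongrightarrow> N1 (\<lambda>x. G \<epsilon> x - G (\<epsilon> + 2 * \<delta>) x)"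
      by (rule L1_limit_diff) (use that in \<open>auto intro!: Pi Gi Gl\<close>)
    show "(\<lambda>k. \<eta> * N1 (Pois \<epsilon> (f k)) + (N1 (Pois \<epsilon> (f k)) - N1 (Pois (\<epsilon> + \<delta>) (f k))) / \<eta>) \<longlonglongrightarrow>
      \<eta> * N1 (G \<epsilon>) + (N1 (G \<epsilon>) - N1 (G (\<epsilon> + \<delta>))) / \<eta>"
      by (intro tendsto_intros GN) (use that in auto)
  qed (use Pois_gap[OF s that] in blast)
  define \<epsilon> where "\<epsilon> j = 1 / real (Suc j)" for j
  have \<epsilon>pos: "\<epsilon> j > 0" for j by (simp add: \<epsilon>_def)
  have \<epsilon>mono: "\<epsilon> k < \<epsilon> j" if "j < k" for j k using that by (simp add: \<epsilon>_def frac_less2)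
  have \<epsilon>0: "\<epsilon> \<longlonglongrightarrow> 0" unfolding \<epsilon>_def by (rule LIMSEQ_Suc[OF lim_1_over_n])
  define \<nu> where "\<nu> j = N1 (G (\<epsilon> j))" for j
  have Gmono': "N1 (G t) \<le> N1 (G s)" if "0 < s" "s \<le> t" for s t
    using Gmono[of s "t - s"] that by (cases "s = t") auto
  have "incseq \<nu>"
    unfolding incseq_def \<nu>_def
  proof (intro allI impI Gmono' \<epsilon>pos)
    fix j k :: nat assume "j \<le> k" then show "\<epsilon> k \<le> \<epsilon> j" using \<epsilon>mono[of j k] by (cases "j = k") auto
  qed
  moreover have "\<forall>j. \<nu> j \<le> C" using GC \<epsilon>pos by (simp add: \<nu>_def)
  ultimately obtain M where M: "\<nu> \<longlonglongrightarrow> M" "\<forall>j. \<nu> j \<le> M" using incseq_convergent by metis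
  have close: "N1 (\<lambda>x. G (\<epsilon> k) x - G (\<epsilon> j) x) \<le> \<eta> * C + (M - \<nu> j) / \<eta>" if "j < k" "\<eta> > 0" for j k \<eta>
  proof -
    \<comment> \<open>The gap inequality compares the levels \<open>\<epsilon> k\<close> and \<open>\<epsilon> k + 2 * \<delta>\<close>, which is \<open>\<epsilon> j\<close>.\<close>
    define \<delta> where "\<delta> = (\<epsilon> j - \<epsilon> k) / 2"
    have \<delta>: "\<delta> > 0" using \<epsilon>mono[OF that(1)] by (simp add: \<delta>_def)
    have "\<epsilon> j = \<epsilon> k + 2 * \<delta>" unfolding \<delta>_def by (simp add: field_simps)
    then have "N1 (\<lambda>x. G (\<epsilon> k) x - G (\<epsilon> j) x) \<le> \<eta> * N1 (G (\<epsilon> k)) + (N1 (G (\<epsilon> k)) - N1 (G (\<epsilon> k + \<delta>))) / \<eta>"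
      using Ggap[OF \<epsilon>pos[of k] \<delta> that(2)] by simp
    also have "\<dots> \<le> \<eta> * C + (M - \<nu> j) / \<eta>"
    proof (intro add_mono mult_left_mono divide_right_mono diff_mono)
      show "N1 (G (\<epsilon> k)) \<le> M" using M(2) by (simp add: \<nu>_def)
      show "\<nu> j \<le> N1 (G (\<epsilon> k + \<delta>))" unfolding \<nu>_def
        using \<delta> \<epsilon>pos[of k] by (intro Gmono') (auto simp: \<delta>_def field_simps)
    qed (use GC \<epsilon>pos that in auto)
    finally show ?thesis .
  qed
  have "\<exists>N. \<forall>i\<ge>N. \<forall>j\<ge>N. (\<integral>x. norm (G (\<epsilon> i) x - G (\<epsilon> j) x) \<partial>m) < e" if e: "e > 0" for e
  proof -
    define \<eta> where "\<eta> = e / (4 * (C + 1))"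
    have \<eta>: "\<eta> > 0" using e C0 by (simp add: \<eta>_def)
    have \<eta>C: "\<eta> * C < e / 2" using e C0 by (simp add: \<eta>_def field_simps add_pos_nonneg)
    obtain N where N: "\<And>j. j \<ge> N \<Longrightarrow> norm (\<nu> j - M) < \<eta> * (e / 2)"
      using LIMSEQ_D[OF M(1), of "\<eta> * (e / 2)"] \<eta> e by auto
    have lt: "N1 (\<lambda>x. G (\<epsilon> k) x - G (\<epsilon> j) x) < e" if "j < k" "j \<ge> N" for j k
    proof -
      have "M - \<nu> j < \<eta> * (e / 2)"
        using N[OF that(2)] abs_ge_minus_self[of "\<nu> j - M"] unfolding real_norm_def by linarith
      then have "(M - \<nu> j) / \<eta> < e / 2"
        by (subst pos_divide_less_eq[OF \<eta>]) (simp only: mult.commute)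
      then show ?thesis using close[OF that(1) \<eta>] \<eta>C by linarith
    qed
    have "N1 (\<lambda>x. G (\<epsilon> i) x - G (\<epsilon> j) x) < e" if "i \<ge> N" "j \<ge> N" for i j
    proof (cases i j rule: linorder_cases)
      case less
      then show ?thesis using lt[of i j] that N1_commute[of "G (\<epsilon> i)" "G (\<epsilon> j)"] by simp
    next
      case equal
      then show ?thesis using e by (simp add: N1_def)
    next
      case greater
      then show ?thesis using lt[of j i] that by simp
    qed
    then show ?thesis unfolding N1_def by blast
  qed
  then obtain g where g: "integrable m g" "(\<lambda>j. \<integral>x. norm (G (\<epsilon> j) x - g x) \<partial>m) \<longlonglongrightarrow> 0"
    by (rule L1_complete[OF Gi[OF \<epsilon>pos]])
  have "spec b g"
  proof (rule spec_L1_limit[OF Gs[OF \<epsilon>pos] g])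
    fix n
    have "(\<lambda>j. b n * of_real (exp (- \<epsilon> j * lam n))) \<longlonglongrightarrow> b n * of_real (exp (- 0 * lam n))"
      by (intro tendsto_intros \<epsilon>0)
    then show "(\<lambda>j. b n * of_real (exp (- \<epsilon> j * lam n))) \<longlonglongrightarrow> b n" by simp
  qed
  moreover have "Lp_le p m B g"
  proof (rule Lp_le_L1_limit[OF p _ Gi[OF \<epsilon>pos] g])
    show "Lp_le p m B (G (\<epsilon> j))" for j
      by (rule Lp_le_L1_limit[OF p Pois_Lp[OF Lp p] Pi Gi[OF \<epsilon>pos] Gl[OF \<epsilon>pos, unfolded N1_def]])
  qed
  ultimately show ?thesis using that by blast
qed

lemma bohr_related_iff:
  assumes "1 \<le> p"
  shows "bohr_related p lam \<beta> m a f \<longleftrightarrow> in_Lp p m f \<and> spec a f"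
proof -
  have "integrable m f" if "in_Lp p m f"
    using Lp_le_integrable(1)[OF in_Lp_imp_Lp_le[OF that order_refl assms] assms] .
  then show ?thesis
    unfolding bohr_related_def hardy_group_def spec_def h_def by blast
qed

lemma Lp_norm_cong_AE:
  assumes "AE x in m. f x = g x" "f \<in> borel_measurable m" "g \<in> borel_measurable m"
  shows "Lp_norm p m f = Lp_norm p m g"
proof (cases "p = \<infinity>")
  case True
  have [measurable]: "f \<in> borel_measurable m" "g \<in> borel_measurable m" by fact+
  have "esssup m (\<lambda>x. ennreal (norm (f x))) = esssup m (\<lambda>x. ennreal (norm (g x)))"
    by (rule esssup_AE_cong) (use assms in \<open>auto elim!: eventually_mono\<close>)
  then show ?thesis by (simp add: Lp_norm_def True)
next
  case False
  have [measurable]: "f \<in> borel_measurable m" "g \<in> borel_measurable m" by fact+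
  have "(\<integral>x. norm (f x) powr enn2real p \<partial>m) = (\<integral>x. norm (g x) powr enn2real p \<partial>m)"
    by (rule integral_cong_AE) (use assms in \<open>auto elim!: eventually_mono\<close>)
  then show ?thesis using False by (simp add: Lp_norm_def)
qed

lemma hardy_dir_norm_eq:
  assumes p: "1 \<le> p" and f: "bohr_related p lam \<beta> m a f"
  shows "hardy_dir_norm p lam \<beta> m a = Lp_norm p m f"
  unfolding hardy_dir_norm_def
proof (rule the_equality)
  show "\<exists>f'. bohr_related p lam \<beta> m a f' \<and> Lp_norm p m f = Lp_norm p m f'" using f by blast
next
  fix r assume "\<exists>f'. bohr_related p lam \<beta> m a f' \<and> r = Lp_norm p m f'"
  then obtain f' where f': "bohr_related p lam \<beta> m a f'" "r = Lp_norm p m f'" by blast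
  have "AE x in m. f' x = f x"
    using f f'(1) unfolding bohr_related_iff[OF p] by (blast intro: spec_unique)
  moreover have "f \<in> borel_measurable m" "f' \<in> borel_measurable m"
    using f f'(1) unfolding bohr_related_iff[OF p] by (auto simp: in_Lp_def)
  ultimately show "r = Lp_norm p m f" using Lp_norm_cong_AE f'(2) by blast
qed

lemma dir_translate_eq: "dir_translate lam (of_real \<epsilon>) a n = a n * of_real (exp (- \<epsilon> * lam n))"
  by (simp add: dir_translate_def mult.commute flip: of_real_mult of_real_minus exp_of_real)

lemma translate_related:
  assumes s: "spec a f" and Lp: "Lp_le p m B f" and p: "1 \<le> p" and \<epsilon>: "\<epsilon> > 0"
  shows "bohr_related p lam \<beta> m (dir_translate lam (of_real \<epsilon>) a) (Pois \<epsilon> f)"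
proof -
  have "dir_translate lam (of_real \<epsilon>) a = (\<lambda>n. a n * of_real (exp (- \<epsilon> * lam n)))"
    by (rule ext) (rule dir_translate_eq)
  then show ?thesis
    unfolding bohr_related_iff[OF p]
    using spec_Pois[OF s \<epsilon>] Lp_le_imp_in_Lp[OF Pois_Lp[OF Lp p]] by (simp only:)
qed

text \<open>The coefficients are bounded by the norms, so a subsequence converges coefficientwise; its limit is the
  Dirichlet series of a function \<open>g\<close> by the preceding lemma. The differences from \<open>g\<close> are bounded with
  coefficients tending to zero, and splitting their Poisson means shows that these tend to zero in norm.\<close>
lemma montel:
  assumes p: "1 \<le> p" and bd: "hardy_dir_bounded p lam \<beta> m D"
  shows "\<exists>r a. strict_mono (r :: nat \<Rightarrow> nat) \<and> a \<in> hardy_dir p lam \<beta> m \<and>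
           (\<forall>\<epsilon>::real. \<epsilon> > 0 \<longrightarrow>
              hardy_dir_tendsto p lam \<beta> m
                (\<lambda>k. dir_translate lam (of_real \<epsilon>) (D (r k)))
                (dir_translate lam (of_real \<epsilon>) a))"
proof -
  have "\<exists>f. bohr_related p lam \<beta> m (D N) f" for N
    using bd by (auto simp: hardy_dir_bounded_def hardy_dir_def)
  then obtain f where f: "\<And>N. bohr_related p lam \<beta> m (D N) (f N)" by metis
  obtain B where B: "\<And>N. hardy_dir_norm p lam \<beta> m (D N) \<le> B"
    using bd by (auto simp: hardy_dir_bounded_def)
  have Lp: "Lp_le p m B (f N)" for N
    using f[of N] B[of N] hardy_dir_norm_eq[OF p f[of N]] in_Lp_imp_Lp_le[of p m "f N" B] p
    by (simp add: bohr_related_iff[OF p])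
  have B0: "0 \<le> B" using Lp_leD(2)[OF Lp[of 0]] .
  have s: "spec (D N) (f N)" for N using f by (simp add: bohr_related_iff[OF p])
  define C where "C = 1 + B + B powr enn2real p"
  have C: "N1 (f N) \<le> C" for N unfolding N1_def C_def by (rule Lp_le_integrable(2)[OF Lp p])
  have "norm (D N n) \<le> C" for N n
    using spec_coeff_le[OF s[of N], of n] C[of N] by (simp add: N1_def)
  then obtain r where r: "strict_mono (r :: nat \<Rightarrow> nat)" "\<And>n. n \<in> UNIV \<Longrightarrow> \<exists>l. (\<lambda>k. D (r k) n) \<longlonglongrightarrow> l"
    by (rule function_convergent_subsequence[OF countableI_type, of UNIV D C]) blast
  then obtain a where a: "\<And>n. (\<lambda>k. D (r k) n) \<longlonglongrightarrow> a n" by (metis UNIV_I)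
  obtain g where g: "spec a g" "Lp_le p m B g"
    by (rule bounded_limit[of "\<lambda>k. D (r k)" "\<lambda>k. f (r k)" C a p B]) (use s C a p Lp in auto)
  have "bohr_related p lam \<beta> m a g"
    unfolding bohr_related_iff[OF p] using g Lp_le_imp_in_Lp by blast
  then have mem: "a \<in> hardy_dir p lam \<beta> m" by (auto simp: hardy_dir_def)
  have conv: "hardy_dir_tendsto p lam \<beta> m (\<lambda>k. dir_translate lam (of_real \<epsilon>) (D (r k))) (dir_translate lam (of_real \<epsilon>) a)"
    if \<epsilon>: "\<epsilon> > 0" for \<epsilon> :: real
    unfolding hardy_dir_tendsto_def
  proof (intro conjI allI)
    show "dir_translate lam (of_real \<epsilon>) (D (r k)) \<in> hardy_dir p lam \<beta> m" for k
      using translate_related[OF s Lp p \<epsilon>] by (auto simp: hardy_dir_def)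
    show "dir_translate lam (of_real \<epsilon>) a \<in> hardy_dir p lam \<beta> m"
      using translate_related[OF g p \<epsilon>] by (auto simp: hardy_dir_def)
    define w where "w k x = f (r k) x - g x" for k x
    define c where "c k n = D (r k) n - a n" for k n
    have ws: "spec (c k) (w k)" for k
      unfolding c_def w_def by (rule spec_diff[OF s g(1)])
    have "Lp_le p m (1 * B) (\<lambda>x. -1 * g x)" by (rule Lp_le_scale[OF g(2)]) simp
    from Lp_le_add[OF Lp this p] have wLp: "Lp_le p m (4 * B) (w k)" for k
      by (simp add: w_def[abs_def])
    have diff: "(\<lambda>n. dir_translate lam (of_real \<epsilon>) (D (r k)) n - dir_translate lam (of_real \<epsilon>) a n) = dir_translate lam (of_real \<epsilon>) (c k)" for k
      by (simp add: dir_translate_def c_def left_diff_distrib)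
    have nrm: "hardy_dir_norm p lam \<beta> m (dir_translate lam (of_real \<epsilon>) (c k)) = Lp_norm p m (Pois \<epsilon> (w k))" for k
      by (rule hardy_dir_norm_eq[OF p translate_related[OF ws wLp p \<epsilon>]])
    have c0: "(\<lambda>k. c k n) \<longlonglongrightarrow> 0" for n
      unfolding c_def using a[of n] by (simp add: LIM_zero)
    show "(\<lambda>k. hardy_dir_norm p lam \<beta> m (\<lambda>n. dir_translate lam (of_real \<epsilon>) (D (r k)) n - dir_translate lam (of_real \<epsilon>) a n)) \<longlonglongrightarrow> 0"
      unfolding diff nrm
    proof (rule LIMSEQ_I)
      fix e :: real assume e: "e > 0"
      have e4: "e / 4 > 0" using e by simp
      then obtain R :: nat where R: "exp (- \<epsilon> * real R) * (4 * B) < e / 4"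
        using exists_small_exp[OF \<epsilon>] by blast
      have "(\<lambda>k. \<Sum>n | lam n < real R. norm (c k n)) \<longlonglongrightarrow> (\<Sum>n | lam n < real R. norm (0::complex))"
        by (intro tendsto_intros c0)
      then have "(\<lambda>k. \<Sum>n | lam n < real R. norm (c k n)) \<longlonglongrightarrow> 0" by simp
      from order_tendstoD(2)[OF this e4] obtain K where K: "\<And>k. k \<ge> K \<Longrightarrow> (\<Sum>n | lam n < real R. norm (c k n)) < e / 4"
        unfolding eventually_sequentially by blast
      have "norm (Lp_norm p m (Pois \<epsilon> (w k)) - 0) < e" if "k \<ge> K" for k
      proof -
        have "Lp_norm p m (Pois \<epsilon> (w k)) \<le> 2 * ((\<Sum>n | lam n < real R. norm (c k n)) + exp (- \<epsilon> * real R) * (4 * B))"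
          by (rule Lp_le_imp_Lp_norm_le[OF Pois_Lp_le[OF ws \<epsilon> wLp p] p])
        also have "\<dots> < 2 * (e / 4 + e / 4)"
          by (intro mult_strict_left_mono add_strict_mono K[OF that] R) simp
        also have "\<dots> = e" by simp
        finally show ?thesis using Lp_norm_nonneg[of p m "Pois \<epsilon> (w k)"] by simp
      qed
      then show "\<exists>K. \<forall>k\<ge>K. norm (Lp_norm p m (Pois \<epsilon> (w k)) - 0) < e" by blast
    qed
  qed
  show ?thesis using r(1) mem conv by blast
qed

end

theorem theorem4p19:
  fixes lam :: "nat \<Rightarrow> real"
    and \<beta> :: "real \<Rightarrow> 'g::{topological_ab_group_add, t2_space}"
    and m :: "'g measure"
    and p :: ennreal
    and D :: "nat \<Rightarrow> nat \<Rightarrow> complex"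
  assumes "frequency lam"
    and "freq_L lam = 0 \<or> (landau_condition lam \<and> freq_L lam < \<infinity>) \<or> rat_lin_independent lam"
    and "freq_dirichlet_group lam \<beta>"
    and "normalized_haar m"
    and "1 \<le> p"
    and "hardy_dir_bounded p lam \<beta> m D"
  shows "\<exists>r a. strict_mono (r :: nat \<Rightarrow> nat) \<and> a \<in> hardy_dir p lam \<beta> m \<and>
           (\<forall>\<epsilon>::real. \<epsilon> > 0 \<longrightarrow>
              hardy_dir_tendsto p lam \<beta> m
                (\<lambda>k. dir_translate lam (of_real \<epsilon>) (D (r k)))
                (dir_translate lam (of_real \<epsilon>) a))"
proof -
  interpret hardy_setting \<beta> m lam
    by unfold_locales (use assms in \<open>auto simp: freq_dirichlet_group_def\<close>)
  show ?thesis by (rule montel) fact+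
qed

end
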